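(* There is an absolute constant $C>0$ such that, for every $m,n\in\mathbb N$, every symmetric complex $m$-linear form $T:(\mathbb C^n)^m\to\mathbb C$ satisfies \[ \Bigl(\sum_{i_1,\ldots,i_m=1}^n|T(e_{i_1},\ldots,e_{i_m})|^{\frac{2m}{m+1}}\Bigr)^{\frac{m+1}{2m}} \le\Bigl(1+\frac Cm\Bigr)\sup_{\|z\|_{\ell_\infty^n}\le1}|T(z,\ldots,z)|. \] Moreover, there is an absolute $m_0\in\mathbb N$ such that, for every integer $m\ge m_0$, every $n\in\mathbb N$, and every symmetric complex $m$-linear form $T:(\mathbb C^n)^m\to\mathbb C$, the factor $1+C/m$ in this inequality can be replaced by $1$, that is, \[ \Bigl(\sum_{i_1,\ldots,i_m=1}^n|T(e_{i_1},\ldots,e_{i_m})|^{\frac{2m}{m+1}}\Bigr)^{\frac{m+1}{2m}} \le\sup_{\|z\|_{\ell_\infty^n}\le1}|T(z,\ldots,z)|. \]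
   Context: $e_1,\ldots,e_n$ is the canonical basis of $\mathbb C^n$; the supremum on the right is over $z\in\mathbb C^n$ with $\max_j|z_j|\le1$. "Absolute" means independent of $m,n,T$. *)

theory Defs
  imports
    Complex_Main
    "HOL-Library.FuncSet"
    "HOL-Combinatorics.Permutations"
    "Jordan_Normal_Form.Matrix"
begin

text \<open>
  \<open>\<complex>\<^sup>n\<close> is \<open>carrier_vec n\<close>, with coordinates and canonical basis vectors \<open>unit_vec n j\<close> indexed by
  \<open>j < n\<close>. An \<open>m\<close>-tuple of vectors is an extensional function on \<open>{..<m}\<close>, so the domain of an
  \<open>m\<close>-linear form on \<open>\<complex>\<^sup>n\<close> is \<open>{..<m} \<rightarrow>\<^sub>E carrier_vec n\<close>; values of \<open>T\<close> outside it play no role.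
\<close>

definition multilinear_form :: "nat \<Rightarrow> nat \<Rightarrow> ((nat \<Rightarrow> complex vec) \<Rightarrow> complex) \<Rightarrow> bool" where
  "multilinear_form m n T \<longleftrightarrow>
     (\<forall>x \<in> {..<m} \<rightarrow>\<^sub>E carrier_vec n. \<forall>k<m.
        (\<forall>u \<in> carrier_vec n. \<forall>v \<in> carrier_vec n.
           T (x(k := u + v)) = T (x(k := u)) + T (x(k := v))) \<and>
        (\<forall>c. \<forall>u \<in> carrier_vec n. T (x(k := c \<cdot>\<^sub>v u)) = c * T (x(k := u))))"

text \<open>Since \<open>\<pi>\<close> fixes every index \<open>k \<ge> m\<close>, the permuted tuple \<open>x \<circ> \<pi>\<close> is again extensional.\<close>

definition symmetric_form :: "nat \<Rightarrow> nat \<Rightarrow> ((nat \<Rightarrow> complex vec) \<Rightarrow> complex) \<Rightarrow> bool" where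
  "symmetric_form m n T \<longleftrightarrow>
     (\<forall>x \<in> {..<m} \<rightarrow>\<^sub>E carrier_vec n. \<forall>\<pi>. \<pi> permutes {..<m} \<longrightarrow> T (x \<circ> \<pi>) = T x)"

text \<open>Only meaningful for vectors of positive dimension, as \<open>Max {}\<close> is unspecified.\<close>

definition linf_norm :: "complex vec \<Rightarrow> real" where
  "linf_norm z = Max ((\<lambda>j. cmod (z $ j)) ` {..<dim_vec z})"

text \<open>
  The real supremum is a genuine one for a multilinear form \<open>T\<close> and \<open>n \<ge> 1\<close>: the range is
  nonempty, and it is bounded above by the sum of the absolute values of the coefficients of \<open>T\<close>.
\<close>

definition diag_sup_norm :: "nat \<Rightarrow> nat \<Rightarrow> ((nat \<Rightarrow> complex vec) \<Rightarrow> complex) \<Rightarrow> real" where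
  "diag_sup_norm m n T =
     (SUP z \<in> {z \<in> carrier_vec n. linf_norm z \<le> 1}. cmod (T (\<lambda>k\<in>{..<m}. z)))"

end

theory Submission
  imports
    Defs
    "HOL-Complex_Analysis.Cauchy_Integral_Formula"
    "HOL-Combinatorics.Multiset_Permutations"
begin

text \<open>
  Write \<open>P(z) = T(z,\<dots>,z) = \<Sum> c\<^sub>\<alpha> z\<^sup>\<alpha>\<close> and \<open>p = 2m/(m+1)\<close>, so that the left-hand side is the power \<open>1/p\<close> of
  \<open>\<Sum> M\<^sub>\<alpha> \<bar>c\<^sub>\<alpha> / M\<^sub>\<alpha>\<bar>\<^sup>p\<close> with the multinomial coefficients \<open>M\<^sub>\<alpha>\<close>.

  For the polynomials \<open>T\<^sub>j(z) = T(e\<^sub>j,z,\<dots>,z)\<close> the \<open>L\<^sup>1\<close> norms \<open>b\<^sub>j\<close> on the torus satisfy \<open>\<Sum> b\<^sub>j \<le> e sup \<bar>P\<bar>\<close>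
  by Cauchy's inequality. A hypercontractive estimate, obtained from an \<open>L\<^sup>4\<close> bound by Hoelder, controls the
  coefficients of the parts of \<open>T\<^sub>j\<close> of fixed degree in \<open>z\<^sub>j\<close> by \<open>b\<^sub>j\<close>, with a loss that is small when \<open>z\<^sub>j\<close> dominates.
  Interpolating with the weights \<open>\<Prod> b\<^sub>j powr (- \<alpha>\<^sub>j/m)\<close> and applying AM-GM bounds the contribution of each \<open>\<alpha>\<close> by an
  explicit factor. It is finite for every \<open>m\<close>, which settles small \<open>m\<close>, and it is \<open>O(1/m)\<close> off the diagonal
  (even \<open>O(1/m\<^sup>2)\<close> unless \<open>\<alpha> = (m-1,1)\<close>).

  For large \<open>m\<close> normalise \<open>sup \<bar>P\<bar> = 1\<close> and let \<open>a\<close> be the largest modulus of a diagonal coefficient, say that of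
  \<open>z\<^sub>l\<^sup>m\<close>. The diagonal coefficients have \<open>l\<^sup>1\<close> norm at most 1, and by positivity of \<open>Re (1 - f)\<close> for \<open>\<bar>f\<bar> \<le> 1\<close>
  every slice of \<open>P\<close> of fixed degree \<open>< m\<close> in \<open>z\<^sub>l\<close> has sup norm at most \<open>2(1 - a)\<close>. Hence the off-diagonal part
  contributes only \<open>o(1) (1 - a)\<^sup>p\<close>, which is absorbed by the slack of the diagonal.
\<close>

section \<open>Monomials indexed by multisets\<close>

definition mpow :: "(nat \<Rightarrow> 'a::comm_monoid_mult) \<Rightarrow> nat multiset \<Rightarrow> 'a" where
  "mpow z \<alpha> = (\<Prod>i\<in>#\<alpha>. z i)"

lemma mpow_empty [simp]: "mpow z {#} = 1"
  by (simp add: mpow_def)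

lemma mpow_add_mset [simp]: "mpow z (add_mset i \<alpha>) = z i * mpow z \<alpha>"
  by (simp add: mpow_def)

lemma mpow_union: "mpow z (\<alpha> + \<beta>) = mpow z \<alpha> * mpow z \<beta>"
  by (simp add: mpow_def)

lemma mpow_mult: "mpow (\<lambda>i. z i * w i) \<alpha> = mpow z \<alpha> * mpow w \<alpha>"
  by (induction \<alpha>) (auto simp: ac_simps)

lemma mpow_replicate [simp]: "mpow z (replicate_mset k i) = z i ^ k"
  by (induction k) auto

lemma mpow_cong: "(\<And>i. i \<in># \<alpha> \<Longrightarrow> z i = w i) \<Longrightarrow> mpow z \<alpha> = mpow w \<alpha>"
  unfolding mpow_def by (intro arg_cong[where f = prod_mset] image_mset_cong) auto

text \<open>The dictionary to exponent notation: \<open>count \<alpha> i\<close> is the exponent of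
  the i-th variable. In multiset form a tuple of indices yields its monomial through
  \<open>mset\<close>, lowering one exponent is \<open>- {#j#}\<close>, and identities follow by
  induction on the multiset.\<close>

lemma mpow_eq_prod:
  assumes "set_mset \<alpha> \<subseteq> {..<n}"
  shows "mpow z \<alpha> = (\<Prod>i<n. z i ^ count \<alpha> i)"
proof -
  have "mpow z \<alpha> = (\<Prod>i\<in>set_mset \<alpha>. z i ^ count \<alpha> i)"
    by (simp add: mpow_def image_prod_mset_multiplicity)
  also have "\<dots> = (\<Prod>i<n. z i ^ count \<alpha> i)"
    using assms by (intro prod.mono_neutral_left) (auto simp: not_in_iff)
  finally show ?thesis .
qed

subsection \<open>Averages over the discrete torus\<close>

text \<open>These finite groups stand in for the unit circle. Inner products of monomials with
  exponents below N are the same as on the circle, and every average is a finite sum.\<close>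

definition unity_roots :: "nat \<Rightarrow> complex set" where
  "unity_roots N = {w. w ^ N = 1}"

lemma card_unity_roots: "N > 0 \<Longrightarrow> card (unity_roots N) = N"
  unfolding unity_roots_def by (rule card_roots_unity_eq)

lemma finite_unity_roots: "N > 0 \<Longrightarrow> finite (unity_roots N)"
  using card_unity_roots card_gt_0_iff by metis

lemma unity_roots_norm: "N > 0 \<Longrightarrow> w \<in> unity_roots N \<Longrightarrow> cmod w = 1"
  unfolding unity_roots_def using power_eq_1_iff[of w N] by auto

lemma unity_roots_mult:
  "w \<in> unity_roots N \<Longrightarrow> v \<in> unity_roots N \<Longrightarrow> w * v \<in> unity_roots N"
  by (simp add: unity_roots_def power_mult_distrib)

lemma bij_mult_unity_roots:
  assumes "N > 0" "w \<in> unity_roots N"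
  shows "bij_betw ((*) w) (unity_roots N) (unity_roots N)"
proof -
  have "w \<noteq> 0" using unity_roots_norm[OF assms] by auto
  then have inj: "inj_on ((*) w) (unity_roots N)" by (auto simp: inj_on_def)
  have "(*) w ` unity_roots N \<subseteq> unity_roots N" using assms by (auto intro: unity_roots_mult)
  then show ?thesis using inj finite_unity_roots[OF assms(1)]
    by (simp add: bij_betw_def endo_inj_surj)
qed

text \<open>The sum is multiplied by v^k under the rotation w -> v w, which permutes the roots. If N
  does not divide k, some root v has v^k \<noteq> 1, and the sum must vanish.\<close>

lemma sum_unity_roots_power:
  assumes "N > 0"
  shows "(\<Sum>w\<in>unity_roots N. w ^ k) = (if N dvd k then of_nat N else 0)"
proof (cases "N dvd k")
  case True
  then obtain q where "k = N * q" by auto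
  then have "w ^ k = 1" if "w \<in> unity_roots N" for w
    using that by (simp add: unity_roots_def power_mult)
  then show ?thesis using True card_unity_roots[OF assms] by simp
next
  case False
  define r where "r = k mod N"
  have r: "0 < r" "r < N" using False assms by (simp_all add: r_def mod_greater_zero_iff_not_dvd)
  \<comment> \<open>As 0 < r < N, there are too few r-th roots of unity to contain all N-th
    ones.\<close>
  have "\<not> unity_roots N \<subseteq> unity_roots r"
    using card_mono[OF finite_unity_roots[OF r(1)], of "unity_roots N"]
      card_unity_roots[OF r(1)] card_unity_roots[OF assms] r(2) by linarith
  then obtain v where v: "v \<in> unity_roots N" "v ^ r \<noteq> 1" by (auto simp: unity_roots_def)
  have "v ^ k = v ^ r"
  proof -
    have "k = N * (k div N) + r" by (simp add: r_def)
    then have "v ^ k = (v ^ N) ^ (k div N) * v ^ r" by (metis power_add power_mult)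
    then show ?thesis using v by (simp add: unity_roots_def)
  qed
  have "(\<Sum>w\<in>unity_roots N. w ^ k) = (\<Sum>w\<in>unity_roots N. (v * w) ^ k)"
    using sum.reindex_bij_betw[OF bij_mult_unity_roots[OF assms v(1)], of "\<lambda>w. w ^ k"] by simp
  also have "\<dots> = v ^ r * (\<Sum>w\<in>unity_roots N. w ^ k)"
    by (simp add: power_mult_distrib sum_distrib_left \<open>v ^ k = v ^ r\<close>)
  finally show ?thesis using v False by simp
qed

lemma unity_roots_cnj: "N > 0 \<Longrightarrow> w \<in> unity_roots N \<Longrightarrow> w * cnj w = 1"
  using unity_roots_norm[of N w] complex_norm_square[of w] by simp

lemma sum_unity_roots_orth:
  assumes "a < N" "b < N"
  shows "(\<Sum>w\<in>unity_roots N. w ^ a * cnj w ^ b) = (if a = b then of_nat N else 0)"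
proof -
  have N: "N > 0" using assms by simp
  have *: "(\<Sum>w\<in>unity_roots N. w ^ a * cnj w ^ b) = (if a = b then of_nat N else 0)"
    if "b \<le> a" "a < N" for a b
  proof -
    have "w ^ a * cnj w ^ b = w ^ (a - b)" if "w \<in> unity_roots N" for w
    proof -
      have "w ^ a = w ^ (a - b) * w ^ b" using \<open>b \<le> a\<close> by (simp flip: power_add)
      then have "w ^ a * cnj w ^ b = w ^ (a - b) * (w * cnj w) ^ b"
        by (simp add: power_mult_distrib)
      then show ?thesis using unity_roots_cnj[OF N that] by simp
    qed
    then have "(\<Sum>w\<in>unity_roots N. w ^ a * cnj w ^ b) = (\<Sum>w\<in>unity_roots N. w ^ (a - b))" by simp
    moreover have "N dvd a - b \<longleftrightarrow> a = b" using that by (auto dest: dvd_imp_le)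
    ultimately show ?thesis by (simp add: sum_unity_roots_power[OF N])
  qed
  show ?thesis
  proof (cases "b \<le> a")
    case True then show ?thesis using * assms by blast
  next
    case False
    have "(\<Sum>w\<in>unity_roots N. w ^ a * cnj w ^ b) = cnj (\<Sum>w\<in>unity_roots N. w ^ b * cnj w ^ a)"
      by (simp add: mult.commute)
    then show ?thesis using *[of a b] False assms by simp
  qed
qed

definition torus :: "nat \<Rightarrow> nat \<Rightarrow> (nat \<Rightarrow> complex) set" where
  "torus N n = {..<n} \<rightarrow>\<^sub>E unity_roots N"

definition avg :: "'b set \<Rightarrow> ('b \<Rightarrow> 'a::field) \<Rightarrow> 'a" where
  "avg A f = (\<Sum>x\<in>A. f x) / of_nat (card A)"

lemma avg_mono: "(\<And>x. x \<in> A \<Longrightarrow> f x \<le> g x) \<Longrightarrow> avg A f \<le> (avg A g :: real)"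
  unfolding avg_def by (intro divide_right_mono sum_mono) auto

lemma avg_nonneg: "(\<And>x. x \<in> A \<Longrightarrow> 0 \<le> f x) \<Longrightarrow> 0 \<le> (avg A f :: real)"
  unfolding avg_def by (intro divide_nonneg_nonneg sum_nonneg) auto

lemma avg_cong: "(\<And>x. x \<in> A \<Longrightarrow> f x = g x) \<Longrightarrow> avg A f = avg A g"
  unfolding avg_def by simp

lemma avg_sum: "avg A (\<lambda>x. \<Sum>i\<in>I. f i x) = (\<Sum>i\<in>I. avg A (f i))"
  unfolding avg_def by (subst sum.swap) (simp add: sum_divide_distrib)

lemma avg_cmult: "avg A (\<lambda>x. c * f x) = c * avg A f"
  unfolding avg_def by (simp flip: sum_distrib_left)

lemma avg_of_real: "avg A (\<lambda>x. of_real (f x)) = (of_real (avg A f) :: complex)"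
  unfolding avg_def by simp

lemma cmod_avg: "cmod (avg A f) \<le> avg A (\<lambda>x. cmod (f x))"
  unfolding avg_def by (simp add: norm_divide divide_right_mono norm_sum)

lemma avg_const: "finite A \<Longrightarrow> A \<noteq> {} \<Longrightarrow> avg A (\<lambda>_. c) = (c :: 'a::field_char_0)"
  unfolding avg_def by simp

lemma avg_reindex: "bij_betw h A A \<Longrightarrow> avg A (\<lambda>x. f (h x)) = avg A f"
  unfolding avg_def using sum.reindex_bij_betw[of h A A f] by simp

lemma avg_CS: "(avg A (\<lambda>x. f x * g x))\<^sup>2 \<le> avg A (\<lambda>x. (f x)\<^sup>2) * avg A (\<lambda>x. (g x)\<^sup>2 :: real)"
proof -
  have "(\<Sum>x\<in>A. f x * g x)\<^sup>2 \<le> (\<Sum>x\<in>A. (f x)\<^sup>2) * (\<Sum>x\<in>A. (g x)\<^sup>2)"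
    by (rule Cauchy_Schwarz_ineq_sum)
  then show ?thesis unfolding avg_def
    by (simp add: power_divide divide_right_mono power2_eq_square)
qed

lemma finite_torus: "N > 0 \<Longrightarrow> finite (torus N n)"
  unfolding torus_def by (intro finite_PiE) (auto intro: finite_unity_roots)

lemma card_torus: "N > 0 \<Longrightarrow> card (torus N n) = N ^ n"
  unfolding torus_def by (simp add: card_PiE card_unity_roots)

lemma torus_nonempty: "N > 0 \<Longrightarrow> torus N n \<noteq> {}"
  using card_torus[of N n] by force

lemma torus_norm: "N > 0 \<Longrightarrow> z \<in> torus N n \<Longrightarrow> i < n \<Longrightarrow> cmod (z i) = 1"
  unfolding torus_def using unity_roots_norm PiE_mem by (metis lessThan_iff)

lemma avg_torus_prod:
  assumes "N > 0"
  shows "avg (torus N n) (\<lambda>z. \<Prod>i<n. g i (z i)) = (\<Prod>i<n. avg (unity_roots N) (g i) :: complex)"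
proof -
  have "(\<Sum>z\<in>torus N n. \<Prod>i<n. g i (z i)) = (\<Prod>i<n. \<Sum>w\<in>unity_roots N. g i w)"
    unfolding torus_def by (subst prod_sum_PiE) (auto intro: finite_unity_roots assms)
  then show ?thesis
    by (simp add: avg_def card_torus card_unity_roots assms prod_dividef)
qed

text \<open>The average factorises over the coordinates. The exponents stay below N because
  exponents congruent modulo N cannot be told apart on \<open>unity_roots N\<close>.\<close>

lemma avg_torus_orth:
  assumes "set_mset \<alpha> \<subseteq> {..<n}" "set_mset \<beta> \<subseteq> {..<n}"
    and "\<And>i. count \<alpha> i < N" "\<And>i. count \<beta> i < N"
  shows "avg (torus N n) (\<lambda>z. mpow z \<alpha> * cnj (mpow z \<beta>)) = of_bool (\<alpha> = \<beta>)"
proof -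
  have N: "N > 0" using assms(3)[of 0] by simp
  have "avg (torus N n) (\<lambda>z. mpow z \<alpha> * cnj (mpow z \<beta>))
      = avg (torus N n) (\<lambda>z. \<Prod>i<n. z i ^ count \<alpha> i * cnj (z i) ^ count \<beta> i)"
    using assms by (simp add: mpow_eq_prod prod.distrib)
  also have "\<dots> = (\<Prod>i<n. avg (unity_roots N) (\<lambda>w. w ^ count \<alpha> i * cnj w ^ count \<beta> i))"
    by (rule avg_torus_prod[OF N])
  also have "\<dots> = (\<Prod>i<n. of_bool (count \<alpha> i = count \<beta> i))"
    using assms N by (intro prod.cong) (auto simp: avg_def sum_unity_roots_orth card_unity_roots)
  also have "\<dots> = of_bool (\<forall>i<n. count \<alpha> i = count \<beta> i)"
    by (induction n) (auto simp: less_Suc_eq)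
  also have "(\<forall>i<n. count \<alpha> i = count \<beta> i) \<longleftrightarrow> \<alpha> = \<beta>"
    using assms(1,2) by (metis (no_types, opaque_lifting) count_eq_zero_iff lessThan_iff multiset_eq_iff subset_iff)
  finally show ?thesis .
qed

lemma avg_torus_inner:
  assumes "finite S" "\<And>\<alpha>. \<alpha> \<in> S \<Longrightarrow> set_mset \<alpha> \<subseteq> {..<n}" "\<And>\<alpha> i. \<alpha> \<in> S \<Longrightarrow> count \<alpha> i < N"
  shows "avg (torus N n) (\<lambda>z. (\<Sum>\<alpha>\<in>S. a \<alpha> * mpow z \<alpha>) * cnj (\<Sum>\<alpha>\<in>S. b \<alpha> * mpow z \<alpha>))
    = (\<Sum>\<alpha>\<in>S. a \<alpha> * cnj (b \<alpha>))"
proof -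
  have "avg (torus N n) (\<lambda>z. (\<Sum>\<alpha>\<in>S. a \<alpha> * mpow z \<alpha>) * cnj (\<Sum>\<alpha>\<in>S. b \<alpha> * mpow z \<alpha>))
      = avg (torus N n) (\<lambda>z. \<Sum>\<alpha>\<in>S. \<Sum>\<beta>\<in>S. (a \<alpha> * cnj (b \<beta>)) * (mpow z \<alpha> * cnj (mpow z \<beta>)))"
    by (intro avg_cong) (simp add: sum_product algebra_simps)
  also have "\<dots> = (\<Sum>\<alpha>\<in>S. \<Sum>\<beta>\<in>S. (a \<alpha> * cnj (b \<beta>)) * of_bool (\<alpha> = \<beta>))"
    unfolding avg_sum avg_cmult using assms by (intro sum.cong refl) (simp add: avg_torus_orth)
  also have "\<dots> = (\<Sum>\<alpha>\<in>S. a \<alpha> * cnj (b \<alpha>))"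
    using assms(1) by (intro sum.cong refl) (simp add: sum.delta if_distrib of_bool_def cong: if_cong)
  finally show ?thesis .
qed

lemma parseval:
  assumes "finite S" "\<And>\<alpha>. \<alpha> \<in> S \<Longrightarrow> set_mset \<alpha> \<subseteq> {..<n}" "\<And>\<alpha> i. \<alpha> \<in> S \<Longrightarrow> count \<alpha> i < N"
  shows "avg (torus N n) (\<lambda>z. (cmod (\<Sum>\<alpha>\<in>S. a \<alpha> * mpow z \<alpha>))\<^sup>2) = (\<Sum>\<alpha>\<in>S. (cmod (a \<alpha>))\<^sup>2)"
proof -
  have "complex_of_real (avg (torus N n) (\<lambda>z. (cmod (\<Sum>\<alpha>\<in>S. a \<alpha> * mpow z \<alpha>))\<^sup>2))
     = (\<Sum>\<alpha>\<in>S. a \<alpha> * cnj (a \<alpha>))"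
    unfolding avg_of_real[symmetric] complex_norm_square by (rule avg_torus_inner[OF assms])
  also have "\<dots> = complex_of_real (\<Sum>\<alpha>\<in>S. (cmod (a \<alpha>))\<^sup>2)"
    by (simp add: complex_norm_square del: of_real_power)
  finally show ?thesis using of_real_eq_iff by blast
qed

subsection \<open>A hypercontractive estimate\<close>

text \<open>The number of divisors of the monomial that remains of z^\<beta> when all powers of z_j
  are dropped. Leaving j out keeps the count small when \<beta> is concentrated at j.\<close>

definition off_divisors :: "nat \<Rightarrow> nat \<Rightarrow> nat multiset \<Rightarrow> nat" where
  "off_divisors n j \<beta> = (\<Prod>i\<in>{..<n} - {j}. count \<beta> i + 1)"

lemma off_divisors_pos: "off_divisors n j \<beta> > 0"
  unfolding off_divisors_def by (simp add: prod_pos)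

lemma size_eq_sum_count:
  fixes \<beta> :: "nat multiset"
  assumes "set_mset \<beta> \<subseteq> {..<n}"
  shows "size \<beta> = (\<Sum>i<n. count \<beta> i)"
proof -
  have "size \<beta> = (\<Sum>i\<in>set_mset \<beta>. count \<beta> i)" by (simp add: size_multiset_overloaded_eq)
  also have "\<dots> = (\<Sum>i<n. count \<beta> i)"
    using assms by (intro sum.mono_neutral_left) (auto simp: not_in_iff)
  finally show ?thesis .
qed

lemma size_eq_count_plus:
  fixes \<beta> :: "nat multiset"
  assumes "set_mset \<beta> \<subseteq> {..<n}" "j < n"
  shows "size \<beta> = count \<beta> j + (\<Sum>i\<in>{..<n} - {j}. count \<beta> i)"
  using assms by (simp add: size_eq_sum_count sum.remove)

lemma off_divisors_le:
  assumes "set_mset \<beta> \<subseteq> {..<n}" "j < n"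
  shows "off_divisors n j \<beta> \<le> 2 ^ (size \<beta> - count \<beta> j)"
proof -
  have "k + 1 \<le> (2::nat) ^ k" for k by (induction k) auto
  then have "off_divisors n j \<beta> \<le> (\<Prod>i\<in>{..<n} - {j}. 2 ^ count \<beta> i)"
    unfolding off_divisors_def by (intro prod_mono) (auto simp del: One_nat_def)
  also have "\<dots> = 2 ^ (size \<beta> - count \<beta> j)"
    using size_eq_count_plus[OF assms] by (simp add: power_sum)
  finally show ?thesis .
qed

text \<open>Since the count at j is r throughout \<open>S\<close>, a decomposition is determined by
  the counts of its first member at the other variables, each at most the count in \<beta> +
  \<gamma>. The two factors come from x + y + 1 \<le> (x + 1)(y + 1).\<close>

lemma card_decompositions_le:
  assumes S: "finite S" "\<And>\<beta>. \<beta> \<in> S \<Longrightarrow> set_mset \<beta> \<subseteq> {..<n}" "\<And>\<beta>. \<beta> \<in> S \<Longrightarrow> count \<beta> j = r"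
    and "\<beta> \<in> S" "\<gamma> \<in> S"
  shows "card {p \<in> S \<times> S. fst p + snd p = \<beta> + \<gamma>} \<le> off_divisors n j \<beta> * off_divisors n j \<gamma>"
proof -
  let ?F = "{p \<in> S \<times> S. fst p + snd p = \<beta> + \<gamma>}" and ?I = "{..<n} - {j}"
  let ?h = "\<lambda>p :: nat multiset \<times> nat multiset. restrict (count (fst p)) ?I"
  have "inj_on ?h ?F"
  proof (rule inj_onI)
    fix p q assume p: "p \<in> ?F" and q: "q \<in> ?F" and eq: "?h p = ?h q"
    have "count (fst p) i = count (fst q) i" for i
    proof (cases "i \<in> ?I")
      case True then show ?thesis using eq by (metis restrict_apply')
    next
      case False
      then consider "i = j" | "i \<ge> n" by fastforce
      then show ?thesis
      proof cases
        case 1 then show ?thesis using p q S(3) by auto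
      next
        case 2
        then have "i \<notin># fst p" "i \<notin># fst q" using p q S(2) by fastforce+
        then show ?thesis by (simp add: not_in_iff)
      qed
    qed
    then have "fst p = fst q" by (simp add: multiset_eq_iff)
    moreover from this p q have "snd p = snd q"
      by (metis (mono_tags, lifting) add_left_cancel mem_Collect_eq)
    ultimately show "p = q" by (simp add: prod_eq_iff)
  qed
  moreover have "?h ` ?F \<subseteq> (\<Pi>\<^sub>E i\<in>?I. {..count (\<beta> + \<gamma>) i})"
    by (auto simp: PiE_def Pi_def) (metis count_union le_add1)
  ultimately have "card ?F \<le> card (\<Pi>\<^sub>E i\<in>?I. {..count (\<beta> + \<gamma>) i})"
    by (intro card_inj_on_le[where f = ?h]) (auto intro!: finite_PiE)
  also have "\<dots> = (\<Prod>i\<in>?I. count (\<beta> + \<gamma>) i + 1)" by (simp add: card_PiE)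
  also have "\<dots> \<le> (\<Prod>i\<in>?I. (count \<beta> i + 1) * (count \<gamma> i + 1))"
    by (intro prod_mono) auto
  also have "\<dots> = off_divisors n j \<beta> * off_divisors n j \<gamma>"
    by (simp add: off_divisors_def prod.distrib del: mult_Suc mult_Suc_right)
  finally show ?thesis .
qed

text \<open>
  Cauchy-Schwarz on the coefficients of the square: a multiset has few decompositions into two members of \<open>S\<close>.
\<close>

lemma avg_fourth_power_le:
  assumes S: "finite S" "\<And>\<beta>. \<beta> \<in> S \<Longrightarrow> set_mset \<beta> \<subseteq> {..<n}" "\<And>\<beta>. \<beta> \<in> S \<Longrightarrow> count \<beta> j = r"
    and size: "\<And>\<beta>. \<beta> \<in> S \<Longrightarrow> size \<beta> \<le> d" and N: "2 * d < N"
  shows "avg (torus N n) (\<lambda>z. cmod (\<Sum>\<beta>\<in>S. a \<beta> * mpow z \<beta>) ^ 4)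
    \<le> (\<Sum>\<beta>\<in>S. real (off_divisors n j \<beta>) * (cmod (a \<beta>))\<^sup>2)\<^sup>2"
proof -
  define D where "D = (\<lambda>p. fst p + snd p) ` (S \<times> S)"
  define F where "F = (\<lambda>\<delta>. {p \<in> S \<times> S. fst p + snd p = \<delta>})"
  define e where "e = (\<lambda>\<delta>. \<Sum>p\<in>F \<delta>. a (fst p) * a (snd p))"
  let ?w = "\<lambda>\<beta>. real (off_divisors n j \<beta>)"
  have finD: "finite D" unfolding D_def using S(1) by auto
  have finF: "finite (F \<delta>)" for \<delta> unfolding F_def using S(1) by auto
  have square: "(\<Sum>\<beta>\<in>S. a \<beta> * mpow z \<beta>)\<^sup>2 = (\<Sum>\<delta>\<in>D. e \<delta> * mpow z \<delta>)" for z
  proof -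
    have "(\<Sum>\<beta>\<in>S. a \<beta> * mpow z \<beta>)\<^sup>2 = (\<Sum>p\<in>S \<times> S. a (fst p) * a (snd p) * mpow z (fst p + snd p))"
      by (simp add: power2_eq_square sum_product sum.cartesian_product case_prod_unfold mpow_union ac_simps)
    also have "\<dots> = (\<Sum>\<delta>\<in>D. \<Sum>p\<in>F \<delta>. a (fst p) * a (snd p) * mpow z (fst p + snd p))"
      unfolding D_def F_def using S(1) by (intro sum.image_gen) auto
    also have "\<dots> = (\<Sum>\<delta>\<in>D. e \<delta> * mpow z \<delta>)"
      unfolding e_def sum_distrib_right by (intro sum.cong refl) (auto simp: F_def)
    finally show ?thesis .
  qed
  have eb: "(cmod (e \<delta>))\<^sup>2 \<le> (\<Sum>p\<in>F \<delta>. ?w (fst p) * ?w (snd p) * ((cmod (a (fst p)))\<^sup>2 * (cmod (a (snd p)))\<^sup>2))"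
    for \<delta>
  proof -
    have "(cmod (e \<delta>))\<^sup>2 \<le> (\<Sum>p\<in>F \<delta>. cmod (a (fst p)) * cmod (a (snd p)))\<^sup>2"
      unfolding e_def by (intro power_mono order.trans[OF norm_sum]) (simp_all add: norm_mult)
    also have "\<dots> \<le> (\<Sum>p\<in>F \<delta>. (cmod (a (fst p)) * cmod (a (snd p)))\<^sup>2) * card (F \<delta>)"
      by (rule sum_squared_le_sum_of_squares)
    also have "\<dots> = (\<Sum>p\<in>F \<delta>. card (F \<delta>) * ((cmod (a (fst p)))\<^sup>2 * (cmod (a (snd p)))\<^sup>2))"
      by (simp add: sum_distrib_left power_mult_distrib mult.commute)
    also have "\<dots> \<le> (\<Sum>p\<in>F \<delta>. ?w (fst p) * ?w (snd p) * ((cmod (a (fst p)))\<^sup>2 * (cmod (a (snd p)))\<^sup>2))"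
    proof (intro sum_mono mult_right_mono)
      fix p assume "p \<in> F \<delta>"
      then show "real (card (F \<delta>)) \<le> ?w (fst p) * ?w (snd p)"
        using card_decompositions_le[OF S, of "fst p" "snd p"]
        by (auto simp: F_def simp flip: of_nat_mult)
    qed auto
    finally show ?thesis .
  qed
  have "avg (torus N n) (\<lambda>z. cmod (\<Sum>\<beta>\<in>S. a \<beta> * mpow z \<beta>) ^ 4)
      = avg (torus N n) (\<lambda>z. (cmod (\<Sum>\<delta>\<in>D. e \<delta> * mpow z \<delta>))\<^sup>2)"
    by (simp add: norm_power flip: square)
  also have "\<dots> = (\<Sum>\<delta>\<in>D. (cmod (e \<delta>))\<^sup>2)"
  proof (rule parseval[OF finD])
    fix \<delta> assume "\<delta> \<in> D"
    then obtain \<beta> \<gamma> where *: "\<beta> \<in> S" "\<gamma> \<in> S" "\<delta> = \<beta> + \<gamma>" by (auto simp: D_def)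
    then show "set_mset \<delta> \<subseteq> {..<n}" using S(2) by auto
    fix i
    \<comment> \<open>Parseval is applied to the square of the polynomial, whose exponents reach 2
      d; this is why N exceeds 2 d.\<close>
    have "count \<delta> i \<le> size \<delta>" by (rule count_le_size)
    also have "\<dots> \<le> 2 * d" using size[OF *(1)] size[OF *(2)] *(3) by simp
    finally show "count \<delta> i < N" using N by simp
  qed
  also have "\<dots> \<le> (\<Sum>\<delta>\<in>D. \<Sum>p\<in>F \<delta>. ?w (fst p) * ?w (snd p) * ((cmod (a (fst p)))\<^sup>2 * (cmod (a (snd p)))\<^sup>2))"
    by (intro sum_mono eb)
  also have "\<dots> = (\<Sum>p\<in>S \<times> S. ?w (fst p) * ?w (snd p) * ((cmod (a (fst p)))\<^sup>2 * (cmod (a (snd p)))\<^sup>2))"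
    unfolding D_def F_def using S(1) by (intro sum.image_gen[symmetric]) auto
  also have "\<dots> = (\<Sum>\<beta>\<in>S. ?w \<beta> * (cmod (a \<beta>))\<^sup>2)\<^sup>2"
    by (simp add: power2_eq_square sum_product sum.cartesian_product case_prod_unfold ac_simps)
  finally show ?thesis .
qed

text \<open>
  With \<open>X = \<Sum> t\<^sub>\<beta> z\<^sup>\<beta>\<close> and the dual polynomial \<open>R = \<Sum> t\<^sub>\<beta> / d\<^sub>\<beta> z\<^sup>\<beta>\<close>, the left-hand side \<open>A\<close> is the inner product of
  \<open>X\<close> and \<open>R\<close>. Hoelder bounds it by the \<open>L\<^sup>1\<close> and \<open>L\<^sup>2\<close> norms of \<open>X\<close> and the \<open>L\<^sup>4\<close> norm of \<open>R\<close>, and the last two are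
  again controlled by \<open>A\<close>.
\<close>

lemma weighted_sum_le_avg:
  assumes S: "finite S" "\<And>\<beta>. \<beta> \<in> S \<Longrightarrow> set_mset \<beta> \<subseteq> {..<n}" "\<And>\<beta>. \<beta> \<in> S \<Longrightarrow> count \<beta> j = r"
    and size: "\<And>\<beta>. \<beta> \<in> S \<Longrightarrow> size \<beta> = d" and N: "2 * d < N" and j: "j < n"
  shows "(\<Sum>\<beta>\<in>S. (cmod (t \<beta>))\<^sup>2 / real (off_divisors n j \<beta>))
    \<le> 2 ^ (d - r) * (avg (torus N n) (\<lambda>z. cmod (\<Sum>\<beta>\<in>S. t \<beta> * mpow z \<beta>)))\<^sup>2"
proof -
  let ?w = "\<lambda>\<beta>. real (off_divisors n j \<beta>)"
  define X where "X = (\<lambda>z. \<Sum>\<beta>\<in>S. t \<beta> * mpow z \<beta>)"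
  define R where "R = (\<lambda>z. \<Sum>\<beta>\<in>S. t \<beta> / ?w \<beta> * mpow z \<beta>)"
  define A where "A = (\<Sum>\<beta>\<in>S. (cmod (t \<beta>))\<^sup>2 / ?w \<beta>)"
  define L where "L = avg (torus N n) (\<lambda>z. cmod (X z))"
  have wpos: "?w \<beta> > 0" for \<beta> using off_divisors_pos by simp
  have A0: "A \<ge> 0" unfolding A_def using wpos by (intro sum_nonneg divide_nonneg_pos) auto
  have L0: "L \<ge> 0" unfolding L_def by (intro avg_nonneg) auto
  have cnt: "count \<beta> i < N" if "\<beta> \<in> S" for \<beta> i
    using count_le_size[of \<beta> i] size[OF that] N by linarith
  have "complex_of_real A = avg (torus N n) (\<lambda>z. X z * cnj (R z))"
    unfolding X_def R_def by (subst avg_torus_inner[OF S(1,2) cnt])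
      (auto simp: A_def complex_norm_square simp del: of_real_power)
  then have "A = cmod (avg (torus N n) (\<lambda>z. X z * cnj (R z)))"
    using A0 by (metis abs_of_nonneg norm_of_real)
  also have "\<dots> \<le> avg (torus N n) (\<lambda>z. cmod (X z) * cmod (R z))"
    by (rule order.trans[OF cmod_avg]) (simp add: norm_mult)
  \<comment> \<open>Splitting |X| into two square roots lets Cauchy-Schwarz isolate the L^1 norm
    \<open>L\<close>. A second Cauchy-Schwarz separates |X|^2 from |R|^4.\<close>
  finally have 1: "A \<le> avg (torus N n) (\<lambda>z. sqrt (cmod (X z)) * (sqrt (cmod (X z)) * cmod (R z)))"
    by (simp flip: mult.assoc)
  have "A\<^sup>2 \<le> (avg (torus N n) (\<lambda>z. sqrt (cmod (X z)) * (sqrt (cmod (X z)) * cmod (R z))))\<^sup>2"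
    by (rule power_mono[OF 1 A0])
  also have "\<dots> \<le> L * avg (torus N n) (\<lambda>z. cmod (X z) * (cmod (R z))\<^sup>2)"
    using avg_CS[of "torus N n" "\<lambda>z. sqrt (cmod (X z))" "\<lambda>z. sqrt (cmod (X z)) * cmod (R z)"]
    by (simp add: L_def power_mult_distrib)
  finally have 2: "A\<^sup>2 \<le> L * avg (torus N n) (\<lambda>z. cmod (X z) * (cmod (R z))\<^sup>2)" .
  have X2: "avg (torus N n) (\<lambda>z. (cmod (X z))\<^sup>2) \<le> 2 ^ (d - r) * A"
  proof -
    have "avg (torus N n) (\<lambda>z. (cmod (X z))\<^sup>2) = (\<Sum>\<beta>\<in>S. (cmod (t \<beta>))\<^sup>2)"
      unfolding X_def by (rule parseval[OF S(1,2) cnt])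
    also have "\<dots> \<le> (\<Sum>\<beta>\<in>S. 2 ^ (d - r) * ((cmod (t \<beta>))\<^sup>2 / ?w \<beta>))"
    proof (intro sum_mono)
      fix \<beta> assume \<beta>: "\<beta> \<in> S"
      have "off_divisors n j \<beta> \<le> 2 ^ (d - r)"
        using off_divisors_le[OF S(2)[OF \<beta>] j] size[OF \<beta>] S(3)[OF \<beta>] by simp
      then have "?w \<beta> \<le> 2 ^ (d - r)" by (metis of_nat_le_iff of_nat_numeral of_nat_power)
      then have "?w \<beta> * ((cmod (t \<beta>))\<^sup>2 / ?w \<beta>) \<le> 2 ^ (d - r) * ((cmod (t \<beta>))\<^sup>2 / ?w \<beta>)"
        by (intro mult_right_mono) auto
      then show "(cmod (t \<beta>))\<^sup>2 \<le> 2 ^ (d - r) * ((cmod (t \<beta>))\<^sup>2 / ?w \<beta>)"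
        using wpos[of \<beta>] by simp
    qed
    finally show ?thesis by (simp add: A_def sum_distrib_left)
  qed
  have R4: "avg (torus N n) (\<lambda>z. cmod (R z) ^ 4) \<le> A\<^sup>2"
  proof -
    have "avg (torus N n) (\<lambda>z. cmod (R z) ^ 4) \<le> (\<Sum>\<beta>\<in>S. ?w \<beta> * (cmod (t \<beta> / ?w \<beta>))\<^sup>2)\<^sup>2"
      unfolding R_def using size by (intro avg_fourth_power_le[OF S _ N]) auto
    also have "(\<Sum>\<beta>\<in>S. ?w \<beta> * (cmod (t \<beta> / ?w \<beta>))\<^sup>2) = A"
      unfolding A_def using off_divisors_pos[of n j]
      by (intro sum.cong refl) (simp add: norm_divide power_divide power2_eq_square less_imp_neq[symmetric])
    finally show ?thesis .
  qed
  have "(avg (torus N n) (\<lambda>z. cmod (X z) * (cmod (R z))\<^sup>2))\<^sup>2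
      \<le> avg (torus N n) (\<lambda>z. (cmod (X z))\<^sup>2) * avg (torus N n) (\<lambda>z. cmod (R z) ^ 4)"
    using avg_CS[of "torus N n" "\<lambda>z. cmod (X z)" "\<lambda>z. (cmod (R z))\<^sup>2"] by simp
  also have "\<dots> \<le> (2 ^ (d - r) * A) * A\<^sup>2"
    by (intro mult_mono X2 R4 avg_nonneg) (use A0 in auto)
  finally have 3: "(avg (torus N n) (\<lambda>z. cmod (X z) * (cmod (R z))\<^sup>2))\<^sup>2 \<le> 2 ^ (d - r) * A ^ 3"
    by (simp add: power2_eq_square power3_eq_cube ac_simps)
  have "(A\<^sup>2)\<^sup>2 \<le> (L * avg (torus N n) (\<lambda>z. cmod (X z) * (cmod (R z))\<^sup>2))\<^sup>2"
    by (intro power_mono 2) auto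
  also have "\<dots> \<le> L\<^sup>2 * (2 ^ (d - r) * A ^ 3)"
    using 3 by (simp add: power_mult_distrib mult_left_mono)
  \<comment> \<open>Both remaining norms are bounded through \<open>A\<close>, so
    \<open>A ^ 3\<close> can be divided out unless \<open>A\<close> is 0.\<close>
  finally have "A ^ 3 * A \<le> A ^ 3 * (2 ^ (d - r) * L\<^sup>2)"
    by (simp add: power2_eq_square power3_eq_cube ac_simps)
  then have "A \<le> 2 ^ (d - r) * L\<^sup>2" if "A > 0"
    using that by (metis mult_le_cancel_left_pos zero_less_power)
  then have "A \<le> 2 ^ (d - r) * L\<^sup>2" using A0 by (cases "A = 0") auto
  then show ?thesis unfolding A_def L_def X_def .
qed

lemma bij_torus_rotate:
  assumes "N > 0" "v \<in> unity_roots N" "j < n"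
  shows "bij_betw (\<lambda>z. z(j := v * z j)) (torus N n) (torus N n)"
proof -
  have v0: "v \<noteq> 0" using unity_roots_norm[OF assms(1,2)] by auto
  have "inj_on (\<lambda>z. z(j := v * z j)) (torus N n)"
  proof (rule inj_onI)
    fix z w :: "nat \<Rightarrow> complex" assume eq: "z(j := v * z j) = w(j := v * w j)"
    have "z i = w i" for i
      using fun_cong[OF eq, of i] v0 by (cases "i = j") auto
    then show "z = w" by auto
  qed
  moreover have "(\<lambda>z. z(j := v * z j)) ` torus N n \<subseteq> torus N n"
    using assms(2,3) by (auto simp: torus_def PiE_def Pi_def extensional_def intro!: unity_roots_mult)
  ultimately show ?thesis using finite_torus[OF assms(1)]
    by (simp add: bij_betw_def endo_inj_surj)
qed

lemma mpow_rotate: "mpow (z(j := v * z j)) \<alpha> = v ^ count \<alpha> j * mpow z \<alpha>"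
  by (induction \<alpha>) (auto simp: ac_simps)

text \<open>The part of degree r in z_j is a Fourier coefficient of v -> Q(..., v z_j, ...), hence
  an average of rotated copies of Q with unimodular factors. Rotations preserve the average over the
  torus, so the triangle inequality suffices.\<close>

lemma avg_part_le:
  assumes "finite S" "N > 0" "j < n" "\<And>\<beta>. \<beta> \<in> S \<Longrightarrow> count \<beta> j < N" "r < N"
  shows "avg (torus N n) (\<lambda>z. cmod (\<Sum>\<beta>\<in>{\<beta>\<in>S. count \<beta> j = r}. t \<beta> * mpow z \<beta>))
    \<le> avg (torus N n) (\<lambda>z. cmod (\<Sum>\<beta>\<in>S. t \<beta> * mpow z \<beta>))"
proof -
  let ?Q = "\<lambda>z. \<Sum>\<beta>\<in>S. t \<beta> * mpow z \<beta>"
  let ?U = "unity_roots N"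
  have part: "(\<Sum>\<beta>\<in>{\<beta>\<in>S. count \<beta> j = r}. t \<beta> * mpow z \<beta>)
      = avg ?U (\<lambda>v. cnj v ^ r * ?Q (z(j := v * z j)))" for z
  proof -
    have "avg ?U (\<lambda>v. cnj v ^ r * ?Q (z(j := v * z j)))
        = avg ?U (\<lambda>v. \<Sum>\<beta>\<in>S. t \<beta> * mpow z \<beta> * (v ^ count \<beta> j * cnj v ^ r))"
      by (intro avg_cong) (simp add: mpow_rotate sum_distrib_left ac_simps)
    also have "\<dots> = (\<Sum>\<beta>\<in>S. t \<beta> * mpow z \<beta> * of_bool (count \<beta> j = r))"
      unfolding avg_sum avg_cmult using assms
      by (intro sum.cong refl) (simp add: avg_def sum_unity_roots_orth card_unity_roots)
    also have "\<dots> = (\<Sum>\<beta>\<in>{\<beta>\<in>S. count \<beta> j = r}. t \<beta> * mpow z \<beta>)"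
      using assms(1) by (intro sum.mono_neutral_cong_right) auto
    finally show ?thesis by simp
  qed
  have "avg (torus N n) (\<lambda>z. cmod (\<Sum>\<beta>\<in>{\<beta>\<in>S. count \<beta> j = r}. t \<beta> * mpow z \<beta>))
      \<le> avg (torus N n) (\<lambda>z. avg ?U (\<lambda>v. cmod (?Q (z(j := v * z j)))))"
  proof (intro avg_mono)
    fix z
    show "cmod (\<Sum>\<beta>\<in>{\<beta>\<in>S. count \<beta> j = r}. t \<beta> * mpow z \<beta>)
        \<le> avg ?U (\<lambda>v. cmod (?Q (z(j := v * z j))))"
      unfolding part using unity_roots_norm[OF assms(2)]
      by (intro order.trans[OF cmod_avg] avg_mono) (simp add: norm_mult norm_power)
  qed
  also have "\<dots> = avg ?U (\<lambda>v. avg (torus N n) (\<lambda>z. cmod (?Q (z(j := v * z j)))))"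
    unfolding avg_def by (simp add: sum_divide_distrib sum.swap[of _ _ "torus N n"] mult.commute)
  also have "\<dots> = avg ?U (\<lambda>v. avg (torus N n) (\<lambda>z. cmod (?Q z)))"
    by (rule avg_cong, rule avg_reindex[OF bij_torus_rotate[OF assms(2) _ assms(3)]])
  also have "\<dots> = avg (torus N n) (\<lambda>z. cmod (?Q z))"
    using assms(2) card_unity_roots[OF assms(2)]
    by (intro avg_const finite_unity_roots) force+
  finally show ?thesis .
qed

subsection \<open>Fixing one slot of the form\<close>

definition perms :: "nat multiset \<Rightarrow> real" where
  "perms \<alpha> = real (card (permutations_of_multiset \<alpha>))"

lemma perms_ge_1: "perms \<alpha> \<ge> 1"
proof -
  have "card (permutations_of_multiset \<alpha>) > 0" by (simp add: card_gt_0_iff)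
  then show ?thesis by (simp add: perms_def Suc_le_eq)
qed

lemma perms_pos: "perms \<alpha> > 0"
  using perms_ge_1[of \<alpha>] by simp

text \<open>With index tuples recoded as lists, the fibre over a type \<alpha> consists of the
  orderings of \<alpha>, counted by the multinomial coefficient. This is the passage between sums
  over index tuples and sums over multi-indices.\<close>

lemma sum_mset_types:
  fixes f :: "nat multiset \<Rightarrow> 'a::{semiring_1}"
  shows "(\<Sum>i\<in>{..<m} \<rightarrow>\<^sub>E {..<n}. f (mset (map i [0..<m])))
    = (\<Sum>\<alpha>\<in>multisets_of_size {..<n} m. of_nat (card (permutations_of_multiset \<alpha>)) * f \<alpha>)"
proof -
  define L where "L = {xs. set xs \<subseteq> {..<n} \<and> length xs = m}"
  have finL: "finite L" unfolding L_def by (rule finite_lists_length_eq) simp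
  have "(\<Sum>i\<in>{..<m} \<rightarrow>\<^sub>E {..<n}. f (mset (map i [0..<m]))) = (\<Sum>xs\<in>L. f (mset xs))"
  proof (rule sum.reindex_bij_witness[where j = "\<lambda>i. map i [0..<m]" and i = "\<lambda>xs. \<lambda>k\<in>{..<m}. xs ! k"])
    fix i assume "i \<in> {..<m} \<rightarrow>\<^sub>E {..<n}"
    then have "restrict i {..<m} = i" by (rule PiE_restrict)
    moreover have "(\<lambda>k\<in>{..<m}. map i [0..<m] ! k) = restrict i {..<m}"
      by (intro restrict_ext) simp
    ultimately show "(\<lambda>k\<in>{..<m}. map i [0..<m] ! k) = i" by simp
    show "map i [0..<m] \<in> L" using \<open>i \<in> _\<close> by (force simp: L_def PiE_iff)
  next
    fix xs assume xs: "xs \<in> L"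
    then show "map (\<lambda>k\<in>{..<m}. xs ! k) [0..<m] = xs" by (intro nth_equalityI) (auto simp: L_def)
    show "(\<lambda>k\<in>{..<m}. xs ! k) \<in> {..<m} \<rightarrow>\<^sub>E {..<n}"
    proof (rule PiE_I)
      fix k assume "k \<in> {..<m}"
      then have "xs ! k \<in> set xs" using xs by (simp add: L_def)
      then have "xs ! k \<in> {..<n}" using xs unfolding L_def by blast
      then show "(\<lambda>k\<in>{..<m}. xs ! k) k \<in> {..<n}" using \<open>k \<in> {..<m}\<close> by simp
    qed simp
  qed simp
  also have "\<dots> = (\<Sum>\<alpha>\<in>multisets_of_size {..<n} m. \<Sum>xs\<in>{xs\<in>L. mset xs = \<alpha>}. f (mset xs))"
    using finite_multisets_of_size[of "{..<n}" m]
    by (intro sum.group[symmetric, OF finL]) (auto simp: L_def multisets_of_size_def)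
  also have "\<dots> = (\<Sum>\<alpha>\<in>multisets_of_size {..<n} m. of_nat (card (permutations_of_multiset \<alpha>)) * f \<alpha>)"
  proof (intro sum.cong refl)
    fix \<alpha> assume "\<alpha> \<in> multisets_of_size {..<n} m"
    then have "{xs\<in>L. mset xs = \<alpha>} = permutations_of_multiset \<alpha>"
      by (auto simp: L_def multisets_of_size_def permutations_of_multiset_def)
    then show "(\<Sum>xs\<in>{xs\<in>L. mset xs = \<alpha>}. f (mset xs)) = of_nat (card (permutations_of_multiset \<alpha>)) * f \<alpha>"
      by (simp add: permutations_of_multiset_def)
  qed
  finally show ?thesis .
qed

lemma mpow_mset_map: "mpow z (mset (map i [0..<m])) = (\<Prod>k<m. z (i k))"
  by (induction m) (auto simp: ac_simps)

lemma multinomial_mset: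
  fixes b :: "nat \<Rightarrow> real"
  shows "(\<Sum>\<alpha>\<in>multisets_of_size {..<n} m. perms \<alpha> * mpow b \<alpha>) = (\<Sum>j<n. b j) ^ m"
proof -
  have "(\<Sum>j<n. b j) ^ m = (\<Prod>k<m. \<Sum>j<n. b j)" by simp
  also have "\<dots> = (\<Sum>i\<in>{..<m} \<rightarrow>\<^sub>E {..<n}. \<Prod>k<m. b (i k))"
    by (rule prod_sum_PiE) auto
  also have "\<dots> = (\<Sum>\<alpha>\<in>multisets_of_size {..<n} m. perms \<alpha> * mpow b \<alpha>)"
    unfolding perms_def sum_mset_types[symmetric] by (simp only: mpow_mset_map)
  finally show ?thesis ..
qed

section \<open>Directional derivatives and the slot polynomials\<close>

lemma mpow_has_field_derivative:
  "((\<lambda>t. mpow (\<lambda>i. z i + t * w i) \<alpha>) has_field_derivative (\<Sum>j\<in>#\<alpha>. w j * mpow z (\<alpha> - {#j#}))) (at (0::complex))"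
proof (induction \<alpha>)
  case (add x \<alpha>)
  have *: "w j * mpow z (add_mset x \<alpha> - {#j#}) = z x * (w j * mpow z (\<alpha> - {#j#}))" if "j \<in># \<alpha>" for j
    using that by simp
  have "(\<Sum>j\<in>#add_mset x \<alpha>. w j * mpow z (add_mset x \<alpha> - {#j#}))
      = w x * mpow z \<alpha> + z x * (\<Sum>j\<in>#\<alpha>. w j * mpow z (\<alpha> - {#j#}))"
    using * by (simp add: sum_mset_distrib_left multiset.map_comp comp_def mult.left_commute cong: image_mset_cong)
  moreover have "((\<lambda>t. z x + t * w x) has_field_derivative w x) (at 0)"
    by (auto intro!: derivative_eq_intros)
  from DERIV_mult[OF this add.IH]
  have "((\<lambda>t. (z x + t * w x) * mpow (\<lambda>i. z i + t * w i) \<alpha>) has_field_derivative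
      w x * mpow z \<alpha> + z x * (\<Sum>j\<in>#\<alpha>. w j * mpow z (\<alpha> - {#j#}))) (at 0)"
    by (simp add: mult.commute)
  ultimately show ?case by simp
qed simp

lemma mpow_holomorphic: "(\<lambda>t. mpow (\<lambda>i. z i + t * w i) \<alpha>) holomorphic_on A"
  by (induction \<alpha>) (auto intro!: holomorphic_intros)

lemma sum_mset_eq_sum_count:
  fixes f :: "nat \<Rightarrow> 'a::comm_semiring_1"
  assumes "set_mset \<alpha> \<subseteq> {..<n}"
  shows "(\<Sum>j\<in>#\<alpha>. f j) = (\<Sum>j<n. of_nat (count \<alpha> j) * f j)"
  using assms
proof (induction \<alpha>)
  case (add x \<alpha>)
  have "(\<Sum>j<n. of_nat (count (add_mset x \<alpha>) j) * f j)
      = (\<Sum>j<n. of_nat (count \<alpha> j) * f j + (if j = x then f j else 0))"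
    by (intro sum.cong) (auto simp: algebra_simps)
  also have "\<dots> = (\<Sum>j<n. of_nat (count \<alpha> j) * f j) + f x"
    using add.prems by (simp add: sum.distrib)
  finally show ?case using add by (simp add: add.commute)
qed simp

lemma mpow_scale: "mpow (\<lambda>i. s * z i) \<alpha> = s ^ size \<alpha> * mpow z \<alpha>"
  by (induction \<alpha>) (auto simp: ac_simps)

text \<open>This is \<open>T(e\<^sub>j,z,\<dots>,z)\<close>, that is, \<open>1/m\<close> times the \<open>j\<close>-th partial derivative of \<open>\<Sum> c\<^sub>\<alpha> z\<^sup>\<alpha>\<close>.\<close>

definition partial_slot :: "nat \<Rightarrow> nat \<Rightarrow> (nat multiset \<Rightarrow> complex) \<Rightarrow> nat \<Rightarrow> (nat \<Rightarrow> complex) \<Rightarrow> complex" where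
  "partial_slot m n c j z =
     (\<Sum>\<beta>\<in>multisets_of_size {..<n} (m - 1). of_nat (count \<beta> j + 1) / of_nat m * c (add_mset j \<beta>) * mpow z \<beta>)"

lemma bij_add_mset:
  assumes "m \<ge> 1" "j < n"
  shows "bij_betw (add_mset j) (multisets_of_size {..<n} (m - 1)) {\<alpha>\<in>multisets_of_size {..<n} m. j \<in># \<alpha>}"
  by (rule bij_betw_byWitness[where f' = "\<lambda>\<alpha>. \<alpha> - {#j#}"])
    (use assms in \<open>auto simp: multisets_of_size_def size_Diff_singleton dest: in_diffD\<close>)

lemma partial_slot_eq:
  assumes "m \<ge> 1" "j < n"
  shows "of_nat m * partial_slot m n c j z
    = (\<Sum>\<alpha>\<in>multisets_of_size {..<n} m. of_nat (count \<alpha> j) * c \<alpha> * mpow z (\<alpha> - {#j#}))"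
proof -
  have "(\<Sum>\<alpha>\<in>multisets_of_size {..<n} m. of_nat (count \<alpha> j) * c \<alpha> * mpow z (\<alpha> - {#j#}))
    = (\<Sum>\<alpha>\<in>{\<alpha>\<in>multisets_of_size {..<n} m. j \<in># \<alpha>}. of_nat (count \<alpha> j) * c \<alpha> * mpow z (\<alpha> - {#j#}))"
    by (intro sum.mono_neutral_right) (auto simp: not_in_iff)
  also have "\<dots> = (\<Sum>\<beta>\<in>multisets_of_size {..<n} (m - 1).
      of_nat (count (add_mset j \<beta>) j) * c (add_mset j \<beta>) * mpow z (add_mset j \<beta> - {#j#}))"
    by (rule sum.reindex_bij_betw[OF bij_add_mset[OF assms], symmetric])
  also have "\<dots> = of_nat m * partial_slot m n c j z"
    unfolding partial_slot_def sum_distrib_left using assms by (intro sum.cong) auto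
  finally show ?thesis ..
qed

lemma cnj_sgn_mult: "cnj (sgn T) * T = of_real (cmod T)"
proof (cases "T = 0")
  case False
  have "cnj (sgn T) * T = (T * cnj T) / of_real (cmod T)" by (simp add: sgn_eq)
  also have "\<dots> = of_real ((cmod T)\<^sup>2) / of_real (cmod T)" by (simp only: complex_norm_square)
  also have "\<dots> = of_real (cmod T)" by (simp add: power2_eq_square)
  finally show ?thesis .
qed simp

text \<open>For phases w_j that turn each T_j(z) into its modulus, the sum is 1/m times the
  derivative of t -> P(z + t w) at 0. Cauchy's inequality is applied on the circle of radius 1/m:
  there z + t w lies in the polydisc enlarged by 1 + 1/m, and homogeneity of degree m gives the
  factor.\<close>

lemma sum_partial_slot_le:
  assumes m: "m \<ge> 1"
    and V: "\<And>z. (\<And>i. i < n \<Longrightarrow> cmod (z i) \<le> 1) \<Longrightarrow> cmod (\<Sum>\<alpha>\<in>multisets_of_size {..<n} m. c \<alpha> * mpow z \<alpha>) \<le> V"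
    and z: "\<And>i. i < n \<Longrightarrow> cmod (z i) \<le> 1"
  shows "(\<Sum>j<n. cmod (partial_slot m n c j z)) \<le> (1 + 1 / real m) ^ m * V"
proof -
  let ?M = "multisets_of_size {..<n} m" and ?T = "\<lambda>j. partial_slot m n c j z"
  define w where "w = (\<lambda>j. cnj (sgn (?T j)))"
  define s where "s = 1 + 1 / real m"
  define F where "F = (\<lambda>t. \<Sum>\<alpha>\<in>?M. c \<alpha> * mpow (\<lambda>i. z i + t * w i) \<alpha>)"
  have s: "s > 0" unfolding s_def by (simp add: add_pos_nonneg)
  have w1: "cmod (w j) \<le> 1" for j by (simp add: w_def norm_sgn)
  have wT: "w j * ?T j = of_real (cmod (?T j))" for j
    unfolding w_def by (rule cnj_sgn_mult)
  have "(F has_field_derivative (\<Sum>\<alpha>\<in>?M. c \<alpha> * (\<Sum>j\<in>#\<alpha>. w j * mpow z (\<alpha> - {#j#})))) (at 0)"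
    unfolding F_def by (intro DERIV_sum DERIV_cmult mpow_has_field_derivative)
  moreover have "(\<Sum>\<alpha>\<in>?M. c \<alpha> * (\<Sum>j\<in>#\<alpha>. w j * mpow z (\<alpha> - {#j#}))) = of_nat m * of_real (\<Sum>j<n. cmod (?T j))"
  proof -
    have "(\<Sum>\<alpha>\<in>?M. c \<alpha> * (\<Sum>j\<in>#\<alpha>. w j * mpow z (\<alpha> - {#j#})))
        = (\<Sum>\<alpha>\<in>?M. \<Sum>j<n. w j * (of_nat (count \<alpha> j) * c \<alpha> * mpow z (\<alpha> - {#j#})))"
    proof (intro sum.cong refl)
      fix \<alpha> assume "\<alpha> \<in> ?M"
      then have "set_mset \<alpha> \<subseteq> {..<n}" by (simp add: multisets_of_size_def)
      then show "c \<alpha> * (\<Sum>j\<in>#\<alpha>. w j * mpow z (\<alpha> - {#j#}))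
          = (\<Sum>j<n. w j * (of_nat (count \<alpha> j) * c \<alpha> * mpow z (\<alpha> - {#j#})))"
        by (subst sum_mset_eq_sum_count) (auto simp: sum_distrib_left ac_simps)
    qed
    also have "\<dots> = (\<Sum>j<n. w j * (of_nat m * ?T j))"
      by (subst sum.swap) (simp add: partial_slot_eq[OF m] flip: sum_distrib_left)
    also have "\<dots> = of_nat m * of_real (\<Sum>j<n. cmod (?T j))"
      by (simp add: sum_distrib_left wT mult.left_commute)
    finally show ?thesis .
  qed
  ultimately have "deriv F 0 = of_nat m * of_real (\<Sum>j<n. cmod (?T j))"
    by (auto dest: DERIV_imp_deriv)
  moreover have "norm ((deriv ^^ 1) F 0) \<le> fact 1 * (s ^ m * V) / (1 / real m) ^ 1"
  proof (rule Cauchy_inequality)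
    show "F holomorphic_on (ball 0 (1 / real m))"
      unfolding F_def by (intro holomorphic_intros mpow_holomorphic)
    show "continuous_on (cball 0 (1 / real m)) F"
      unfolding F_def by (intro holomorphic_on_imp_continuous_on holomorphic_intros mpow_holomorphic)
    show "0 < 1 / real m" using m by simp
    fix t :: complex assume "norm (0 - t) = 1 / real m"
    then have t: "cmod t = 1 / real m" by simp
    have "mpow (\<lambda>i. z i + t * w i) \<alpha> = of_real s ^ m * mpow (\<lambda>i. (z i + t * w i) / of_real s) \<alpha>"
      if "\<alpha> \<in> ?M" for \<alpha>
      using mpow_scale[of "of_real s" "\<lambda>i. (z i + t * w i) / of_real s" \<alpha>] that s
      by (simp add: multisets_of_size_def)
    then have "F t = of_real s ^ m * (\<Sum>\<alpha>\<in>?M. c \<alpha> * mpow (\<lambda>i. (z i + t * w i) / of_real s) \<alpha>)"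
      unfolding F_def sum_distrib_left by (intro sum.cong) auto
    moreover have "cmod (\<Sum>\<alpha>\<in>?M. c \<alpha> * mpow (\<lambda>i. (z i + t * w i) / of_real s) \<alpha>) \<le> V"
    proof (rule V)
      fix i assume "i < n"
      have "cmod (z i + t * w i) \<le> cmod (z i) + cmod t * cmod (w i)"
        by (metis norm_mult norm_triangle_ineq)
      also have "\<dots> \<le> 1 + 1 / real m * 1"
        using z[OF \<open>i < n\<close>] w1[of i] t by (intro add_mono mult_mono) auto
      finally show "cmod ((z i + t * w i) / of_real s) \<le> 1"
        using s by (simp add: norm_divide flip: s_def)
    qed
    ultimately show "norm (F t) \<le> s ^ m * V"
      using s by (simp add: norm_mult norm_power mult_left_mono)
  qed
  ultimately have "real m * (\<Sum>j<n. cmod (?T j)) \<le> real m * (s ^ m * V)"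
    using m by (simp add: norm_mult sum_nonneg abs_of_nonneg mult.commute del: of_real_sum)
  then show ?thesis using m by (simp add: s_def)
qed

text \<open>The coefficient of T_j at \<alpha> with one j removed is (\<alpha>_j/m) c_\<alpha>. Thus
  the claim is \<open>weighted_sum_le_avg\<close> for the part of T_j of degree m - 1 - k in z_j,
  where the other variables have total degree k; \<open>avg_part_le\<close> then returns to the
  whole of T_j.\<close>

lemma slot_coefficients_le:
  assumes m: "m \<ge> 1" and j: "j < n" and k: "k < m" and N: "2 * m < N"
  shows "(\<Sum>\<alpha>\<in>{\<alpha>\<in>multisets_of_size {..<n} m. count \<alpha> j = m - k}.
      (real (count \<alpha> j) / real m)\<^sup>2 * (cmod (c \<alpha>))\<^sup>2 / real (off_divisors n j \<alpha>))
    \<le> 2 ^ k * (avg (torus N n) (\<lambda>z. cmod (partial_slot m n c j z)))\<^sup>2"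
proof -
  define S where "S = multisets_of_size {..<n} (m - 1)"
  define t where "t = (\<lambda>\<beta>. of_nat (count \<beta> j + 1) / of_nat m * c (add_mset j \<beta>))"
  define r where "r = m - 1 - k"
  let ?Sr = "{\<beta>\<in>S. count \<beta> j = r}"
  have finS: "finite S" unfolding S_def by auto
  have off: "off_divisors n j (add_mset j \<beta>) = off_divisors n j \<beta>" for \<beta>
    unfolding off_divisors_def by (intro prod.cong) auto
  have aux: "j \<in># \<alpha>" if "count \<alpha> j = size \<alpha> - k" "k < size \<alpha>" for \<alpha> :: "nat multiset"
    using that by (metis count_greater_zero_iff zero_less_diff)
  have bij: "bij_betw (add_mset j) ?Sr {\<alpha>\<in>multisets_of_size {..<n} m. count \<alpha> j = m - k}"
    by (rule bij_betw_byWitness[where f' = "\<lambda>\<alpha>. \<alpha> - {#j#}"])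
      (use m j k in \<open>auto simp: S_def r_def multisets_of_size_def size_Diff_singleton aux dest: in_diffD\<close>)
  have "(\<Sum>\<alpha>\<in>{\<alpha>\<in>multisets_of_size {..<n} m. count \<alpha> j = m - k}.
      (real (count \<alpha> j) / real m)\<^sup>2 * (cmod (c \<alpha>))\<^sup>2 / real (off_divisors n j \<alpha>))
    = (\<Sum>\<beta>\<in>?Sr. (real (count (add_mset j \<beta>) j) / real m)\<^sup>2 * (cmod (c (add_mset j \<beta>)))\<^sup>2
        / real (off_divisors n j (add_mset j \<beta>)))"
    by (rule sum.reindex_bij_betw[OF bij, symmetric])
  also have "\<dots> = (\<Sum>\<beta>\<in>?Sr. (cmod (t \<beta>))\<^sup>2 / real (off_divisors n j \<beta>))"
  proof (intro sum.cong refl)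
    fix \<beta>
    have "cmod (of_nat (count \<beta> j + 1)) = real (count \<beta> j + 1)" by (rule norm_of_nat)
    then show "(real (count (add_mset j \<beta>) j) / real m)\<^sup>2 * (cmod (c (add_mset j \<beta>)))\<^sup>2
        / real (off_divisors n j (add_mset j \<beta>)) = (cmod (t \<beta>))\<^sup>2 / real (off_divisors n j \<beta>)"
      unfolding off t_def by (simp add: norm_mult norm_divide power_mult_distrib power_divide)
  qed
  also have "\<dots> \<le> 2 ^ (m - 1 - r) * (avg (torus N n) (\<lambda>z. cmod (\<Sum>\<beta>\<in>?Sr. t \<beta> * mpow z \<beta>)))\<^sup>2"
  proof (rule weighted_sum_le_avg)
    show "finite ?Sr" using finS by simp
  qed (use N j in \<open>auto simp: S_def multisets_of_size_def\<close>)
  also have "\<dots> \<le> 2 ^ (m - 1 - r) * (avg (torus N n) (\<lambda>z. cmod (\<Sum>\<beta>\<in>S. t \<beta> * mpow z \<beta>)))\<^sup>2"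
  proof (intro mult_left_mono power_mono avg_part_le avg_nonneg finS)
    fix \<beta> assume "\<beta> \<in> S"
    then have "count \<beta> j \<le> m - 1" using count_le_size[of \<beta> j] by (simp add: S_def multisets_of_size_def)
    then show "count \<beta> j < N" using N by simp
  qed (use N j in \<open>auto simp: r_def\<close>)
  also have "m - 1 - r = k" using k by (simp add: r_def)
  finally show ?thesis by (simp add: partial_slot_def S_def t_def)
qed

subsection \<open>Interpolation\<close>

text \<open>Concavity of ln: its tangent at the weighted mean A gives ln y_i \<le> ln A + y_i/A - 1,
  and the corrections cancel in the weighted sum.\<close>

lemma weighted_AM_GM:
  fixes q y :: "'a \<Rightarrow> real"
  assumes "finite I" "\<And>i. i \<in> I \<Longrightarrow> q i \<ge> 0" "(\<Sum>i\<in>I. q i) = 1" "\<And>i. i \<in> I \<Longrightarrow> y i > 0"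
  shows "(\<Prod>i\<in>I. y i powr q i) \<le> (\<Sum>i\<in>I. q i * y i)"
proof -
  define A where "A = (\<Sum>i\<in>I. q i * y i)"
  have "A \<ge> 0" unfolding A_def using assms by (intro sum_nonneg mult_nonneg_nonneg) (auto intro: less_imp_le)
  moreover have "A \<noteq> 0"
  proof
    assume "A = 0"
    then have "\<forall>i\<in>I. q i * y i = 0"
      unfolding A_def using assms by (subst (asm) sum_nonneg_eq_0_iff) (auto intro: less_imp_le mult_nonneg_nonneg)
    then have "\<forall>i\<in>I. q i = 0" using assms(4) by fastforce
    then show False using assms(3) by simp
  qed
  ultimately have A: "A > 0" by simp
  have "(\<Prod>i\<in>I. y i powr q i) = (\<Prod>i\<in>I. exp (q i * ln (y i)))"
    by (intro prod.cong refl) (use assms(4) in \<open>force simp: powr_def\<close>)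
  also have "\<dots> = exp (\<Sum>i\<in>I. q i * ln (y i))" using assms(1) by (simp add: exp_sum)
  also have "(\<Sum>i\<in>I. q i * ln (y i)) \<le> (\<Sum>i\<in>I. q i * (ln A + (y i / A - 1)))"
  proof (intro sum_mono mult_left_mono assms)
    fix i assume "i \<in> I"
    then have "ln (y i / A) \<le> y i / A - 1" using assms(4) A by (intro ln_le_minus_one) auto
    then show "ln (y i) \<le> ln A + (y i / A - 1)" using assms(4)[OF \<open>i \<in> I\<close>] A by (simp add: ln_div)
  qed
  also have "\<dots> = (\<Sum>i\<in>I. q i * (ln A - 1) + (q i * y i) / A)"
    by (intro sum.cong) (auto simp: algebra_simps)
  also have "\<dots> = ln A"
    using A by (simp add: sum.distrib assms(3) A_def[symmetric] flip: sum_distrib_right sum_divide_distrib)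
  finally show ?thesis using A by (simp add: A_def)
qed

text \<open>
  The base \<open>5/2\<close> may be any number strictly between 2 and \<open>e\<close>: above 2, the loss \<open>2\<^sup>k\<close> in degree \<open>k\<close> remains
  summable over \<open>k\<close>; below \<open>e\<close>, the multinomial coefficients outgrow the weights.
\<close>

definition slot_weight :: "nat \<Rightarrow> nat multiset \<Rightarrow> nat \<Rightarrow> real" where
  "slot_weight n \<alpha> j =
     (5/2) ^ (size \<alpha> - count \<alpha> j) * real (off_divisors n j \<alpha>) * real (size \<alpha>) / real (count \<alpha> j)"

text \<open>The loss that the interpolation incurs at \<alpha>. The geometric mean comes from AM-GM
  in \<open>blei_term_le\<close>; the constant 5 is the sum of the geometric series of ratio 4/5
  that appears in \<open>slot_sum_le\<close>.\<close>

definition blei_weight :: "nat \<Rightarrow> nat multiset \<Rightarrow> real" where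
  "blei_weight n \<alpha> =
     5 * (\<Prod>j\<in>set_mset \<alpha>. slot_weight n \<alpha> j powr (real (count \<alpha> j) / real (size \<alpha>))) / perms \<alpha>"

lemma slot_weight_pos: "j \<in># \<alpha> \<Longrightarrow> slot_weight n \<alpha> j > 0"
  unfolding slot_weight_def using off_divisors_pos[of n j \<alpha>]
  by (intro divide_pos_pos mult_pos_pos) (auto simp: nonempty_has_size[symmetric])

lemma mpow_powr:
  assumes "\<And>j. j \<in># \<alpha> \<Longrightarrow> b j > 0"
  shows "mpow b \<alpha> powr r = (\<Prod>j\<in>set_mset \<alpha>. b j powr (real (count \<alpha> j) * r))"
proof -
  have "mpow b \<alpha> = (\<Prod>j\<in>set_mset \<alpha>. b j ^ count \<alpha> j)"
    by (simp add: mpow_def image_prod_mset_multiplicity)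
  also have "\<dots> powr r = (\<Prod>j\<in>set_mset \<alpha>. (b j ^ count \<alpha> j) powr r)"
    by (rule prod_powr_distrib)
  also have "\<dots> = (\<Prod>j\<in>set_mset \<alpha>. b j powr (real (count \<alpha> j) * r))"
    using assms by (intro prod.cong) (auto simp: powr_powr simp flip: powr_realpow)
  finally show ?thesis .
qed

lemma sum_q_eq_1:
  fixes \<alpha> :: "nat multiset"
  assumes "size \<alpha> = m" "m \<ge> 1"
  shows "(\<Sum>j\<in>set_mset \<alpha>. real (count \<alpha> j) / real m) = 1"
proof -
  have "(\<Sum>j\<in>set_mset \<alpha>. count \<alpha> j) = m" using assms(1) by (simp add: size_multiset_overloaded_eq)
  then have "(\<Sum>j\<in>set_mset \<alpha>. real (count \<alpha> j)) = real m" by (metis of_nat_sum)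
  then show ?thesis using assms(2) by (simp flip: sum_divide_distrib)
qed

text \<open>AM-GM with weights \<alpha>_j/m for the numbers 1/(X_j b_j), where X_j is the slot
  weight. The form of X_j is dictated by the outcome: each summand carries exactly the weight of
  \<alpha> in \<open>slot_sum_le\<close>, divided by b_j.\<close>

lemma blei_term_le:
  assumes m: "m \<ge> 1" and \<alpha>: "\<alpha> \<in> multisets_of_size {..<n} m" and b: "\<And>j. j < n \<Longrightarrow> b j > 0"
  shows "mpow b \<alpha> powr (- 1 / real m) / perms \<alpha>
    \<le> blei_weight n \<alpha> / 5 * (\<Sum>j<n. (real (count \<alpha> j) / real m)\<^sup>2 * (2/5) ^ (m - count \<alpha> j)
        / (real (off_divisors n j \<alpha>) * b j))"
proof -
  let ?J = "set_mset \<alpha>" and ?q = "\<lambda>j. real (count \<alpha> j) / real m" and ?X = "slot_weight n \<alpha>"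
  have sub: "?J \<subseteq> {..<n}" and size: "size \<alpha> = m" using \<alpha> by (auto simp: multisets_of_size_def)
  have bJ: "b j > 0" if "j \<in># \<alpha>" for j using b sub that by auto
  have "mpow b \<alpha> powr (- 1 / real m) = (\<Prod>j\<in>?J. b j powr (- ?q j))"
    using mpow_powr[of \<alpha> b "- 1 / real m"] bJ by simp
  also have "\<dots> = (\<Prod>j\<in>?J. ?X j powr ?q j * (1 / (?X j * b j)) powr ?q j)"
  proof (intro prod.cong refl)
    fix j assume j: "j \<in> ?J"
    show "b j powr (- ?q j) = ?X j powr ?q j * (1 / (?X j * b j)) powr ?q j"
      using slot_weight_pos[OF j, of n] bJ[OF j]
      by (simp add: powr_mult powr_divide powr_minus_divide)
  qed
  also have "\<dots> = (\<Prod>j\<in>?J. ?X j powr ?q j) * (\<Prod>j\<in>?J. (1 / (?X j * b j)) powr ?q j)"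
    by (rule prod.distrib)
  also have "\<dots> \<le> (\<Prod>j\<in>?J. ?X j powr ?q j) * (\<Sum>j\<in>?J. ?q j * (1 / (?X j * b j)))"
    using slot_weight_pos[of _ \<alpha> n] bJ sum_q_eq_1[OF size m]
    by (intro mult_left_mono weighted_AM_GM prod_nonneg) auto
  also have "(\<Prod>j\<in>?J. ?X j powr ?q j) = blei_weight n \<alpha> / 5 * perms \<alpha>"
    using perms_pos[of \<alpha>] by (simp add: blei_weight_def size)
  also have "(\<Sum>j\<in>?J. ?q j * (1 / (?X j * b j))) = (\<Sum>j<n. (?q j)\<^sup>2 * (2/5) ^ (m - count \<alpha> j)
        / (real (off_divisors n j \<alpha>) * b j))"
  proof (rule sum.mono_neutral_cong_left)
    fix j assume j: "j \<in> ?J"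
    then have "count \<alpha> j > 0" by simp
    moreover have "(2/5::real) ^ k = 1 / (5/2) ^ k" for k by (simp add: power_divide)
    ultimately show "?q j * (1 / (?X j * b j)) = (?q j)\<^sup>2 * (2/5) ^ (m - count \<alpha> j) / (real (off_divisors n j \<alpha>) * b j)"
      using m by (simp add: slot_weight_def size power2_eq_square)
  qed (use sub in \<open>auto simp: not_in_iff\<close>)
  finally show ?thesis using perms_pos[of \<alpha>] by (simp add: divide_le_eq algebra_simps)
qed

text \<open>Grouping by k = m - \<alpha>_j, the loss 2^k of \<open>slot_coefficients_le\<close>
  meets the damping (2/5)^k and leaves a geometric series of ratio 4/5.\<close>

lemma slot_sum_le:
  assumes m: "m \<ge> 1" and j: "j < n" and N: "2 * m < N"
    and b: "avg (torus N n) (\<lambda>z. cmod (partial_slot m n c j z)) \<le> b"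
  shows "(\<Sum>\<alpha>\<in>multisets_of_size {..<n} m. (real (count \<alpha> j) / real m)\<^sup>2 * (2/5) ^ (m - count \<alpha> j)
      * (cmod (c \<alpha>))\<^sup>2 / real (off_divisors n j \<alpha>)) \<le> 5 * b\<^sup>2"
proof -
  let ?M = "multisets_of_size {..<n} m"
  let ?f = "\<lambda>\<alpha>. (real (count \<alpha> j) / real m)\<^sup>2 * (cmod (c \<alpha>))\<^sup>2 / real (off_divisors n j \<alpha>)"
  have finM: "finite ?M" by auto
  have a0: "avg (torus N n) (\<lambda>z. cmod (partial_slot m n c j z)) \<ge> 0" by (intro avg_nonneg) auto
  have "(\<Sum>\<alpha>\<in>?M. (2/5) ^ (m - count \<alpha> j) * ?f \<alpha>)
      = (\<Sum>\<alpha>\<in>{\<alpha>\<in>?M. j \<in># \<alpha>}. (2/5) ^ (m - count \<alpha> j) * ?f \<alpha>)"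
    using finM by (intro sum.mono_neutral_right) (auto simp: not_in_iff)
  also have "\<dots> = (\<Sum>k<m. \<Sum>\<alpha>\<in>{\<alpha>\<in>{\<alpha>\<in>?M. j \<in># \<alpha>}. m - count \<alpha> j = k}. (2/5) ^ (m - count \<alpha> j) * ?f \<alpha>)"
  proof (rule sum.group[symmetric])
    show "(\<lambda>\<alpha>. m - count \<alpha> j) ` {\<alpha>\<in>?M. j \<in># \<alpha>} \<subseteq> {..<m}"
      using m by auto
  qed (use finM in auto)
  also have "\<dots> = (\<Sum>k<m. (2/5) ^ k * (\<Sum>\<alpha>\<in>{\<alpha>\<in>?M. count \<alpha> j = m - k}. ?f \<alpha>))"
  proof (intro sum.cong refl)
    fix k assume "k \<in> {..<m}"
    then have "{\<alpha>\<in>{\<alpha>\<in>?M. j \<in># \<alpha>}. m - count \<alpha> j = k} = {\<alpha>\<in>?M. count \<alpha> j = m - k}"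
      using count_le_size[of _ j] by (force simp: multisets_of_size_def simp flip: count_greater_zero_iff)
    then show "(\<Sum>\<alpha>\<in>{\<alpha>\<in>{\<alpha>\<in>?M. j \<in># \<alpha>}. m - count \<alpha> j = k}. (2/5) ^ (m - count \<alpha> j) * ?f \<alpha>)
        = (2/5) ^ k * (\<Sum>\<alpha>\<in>{\<alpha>\<in>?M. count \<alpha> j = m - k}. ?f \<alpha>)"
      using \<open>k \<in> _\<close> unfolding sum_distrib_left by (intro sum.cong) auto
  qed
  also have "\<dots> \<le> (\<Sum>k<m. (2/5) ^ k * (2 ^ k * b\<^sup>2))"
  proof (intro sum_mono mult_left_mono)
    fix k assume "k \<in> {..<m}"
    then have "(\<Sum>\<alpha>\<in>{\<alpha>\<in>?M. count \<alpha> j = m - k}. ?f \<alpha>)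
        \<le> 2 ^ k * (avg (torus N n) (\<lambda>z. cmod (partial_slot m n c j z)))\<^sup>2"
      using slot_coefficients_le[OF m j _ N, of k c] by simp
    also have "\<dots> \<le> 2 ^ k * b\<^sup>2" using b a0 by (intro mult_left_mono power_mono) auto
    finally show "(\<Sum>\<alpha>\<in>{\<alpha>\<in>?M. count \<alpha> j = m - k}. ?f \<alpha>) \<le> 2 ^ k * b\<^sup>2" .
  qed auto
  also have "\<dots> = (\<Sum>k<m. (4/5) ^ k) * b\<^sup>2"
    unfolding sum_distrib_right by (intro sum.cong) (auto simp: power_divide simp flip: power_mult_distrib)
  also have "\<dots> \<le> 5 * b\<^sup>2"
  proof (intro mult_right_mono)
    have "(\<Sum>k<m. (4/5::real) ^ k) = 5 * (1 - (4/5) ^ m)" by (subst sum_gp_strict) auto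
    then show "(\<Sum>k<m. (4/5::real) ^ k) \<le> 5" by simp
  qed auto
  finally show ?thesis by (simp add: ac_simps)
qed

text \<open>Young's inequality with exponents r = m/(m+1) and 1 - r splits each term into a
  quadratic quantity \<open>x \<alpha>\<close>, of total at most \<epsilon> B by the slot estimates,
  and M_\<alpha> b^\<alpha>, of total at most B^m by the multinomial theorem. Cauchy's inequality
  bounds B by a multiple of V.\<close>

lemma coefficient_sum_le:
  assumes m: "m \<ge> 1" and V: "V > 0"
    and bound: "\<And>z. (\<And>i. i < n \<Longrightarrow> cmod (z i) \<le> 1) \<Longrightarrow> cmod (\<Sum>\<alpha>\<in>multisets_of_size {..<n} m. c \<alpha> * mpow z \<alpha>) \<le> V"
    and \<A>: "\<A> \<subseteq> multisets_of_size {..<n} m" and \<epsilon>: "\<epsilon> > 0" "\<And>\<alpha>. \<alpha> \<in> \<A> \<Longrightarrow> blei_weight n \<alpha> \<le> \<epsilon>"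
  shows "(\<Sum>\<alpha>\<in>\<A>. perms \<alpha> * (cmod (c \<alpha>) / perms \<alpha>) powr (2 * real m / (real m + 1)))
    \<le> \<epsilon> powr (real m / (real m + 1)) * (3 * V) powr (2 * real m / (real m + 1))"
proof (cases "n = 0")
  case True
  then have "\<A> = {}" using \<A> m by auto
  then show ?thesis by simp
next
  case False
  let ?M = "multisets_of_size {..<n} m"
  define r where "r = real m / (real m + 1)"
  define N where "N = 2 * m + 1"
  \<comment> \<open>the summand \<open>V / (10 n)\<close> only serves to make \<open>b\<close> strictly positive\<close>
  define b where "b = (\<lambda>j. avg (torus N n) (\<lambda>z. cmod (partial_slot m n c j z)) + V / (10 * real n))"
  define B where "B = (\<Sum>j<n. b j)"
  have N: "2 * m < N" "N > 0" by (auto simp: N_def)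
  have finM: "finite ?M" by auto
  have fin\<A>: "finite \<A>" using finite_subset[OF \<A> finM] .
  have b: "b j > 0" for j
    unfolding b_def using V False by (intro add_nonneg_pos avg_nonneg) auto
  have B: "B > 0" unfolding B_def using b False by (intro sum_pos) auto
  have B3: "B \<le> 3 * V"
  proof -
    \<comment> \<open>The L^1 norms sum to at most e V and the extra summands of \<open>b\<close> to
      V/10; 2.72 + 0.1 is below 3.\<close>
    have e: "(1 + 1 / real m) ^ m \<le> 272/100"
    proof -
      have "(1 + 1 / real m) ^ m \<le> exp (1 / real m) ^ m" by (intro power_mono exp_ge_add_one_self) auto
      also have "\<dots> = exp 1" using m by (simp flip: exp_of_nat_mult)
      also have "\<dots> \<le> 272/100" using e_less_272 by simp
      finally show ?thesis .
    qed
    have "(\<Sum>j<n. avg (torus N n) (\<lambda>z. cmod (partial_slot m n c j z)))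
        = avg (torus N n) (\<lambda>z. \<Sum>j<n. cmod (partial_slot m n c j z))" by (simp add: avg_sum)
    also have "\<dots> \<le> avg (torus N n) (\<lambda>z. (1 + 1 / real m) ^ m * V)"
      using torus_norm[OF N(2)] by (intro avg_mono sum_partial_slot_le[OF m bound]) (auto simp: le_less)
    also have "\<dots> = (1 + 1 / real m) ^ m * V"
      by (rule avg_const[OF finite_torus[OF N(2)] torus_nonempty[OF N(2)]])
    also have "\<dots> \<le> 272/100 * V" using e V by (intro mult_right_mono) auto
    finally show ?thesis using False V by (simp add: B_def b_def sum.distrib)
  qed
  define x where "x = (\<lambda>\<alpha>. (cmod (c \<alpha>))\<^sup>2 * (mpow b \<alpha> powr (- 1 / real m) / perms \<alpha>))"
  have mb: "mpow b \<alpha> > 0" for \<alpha> using b by (induction \<alpha>) auto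
  have x0: "x \<alpha> \<ge> 0" for \<alpha> unfolding x_def using perms_pos[of \<alpha>] by simp
  have sumx: "(\<Sum>\<alpha>\<in>\<A>. x \<alpha>) \<le> \<epsilon> * B"
  proof -
    let ?g = "\<lambda>\<alpha> j. (real (count \<alpha> j) / real m)\<^sup>2 * (2/5) ^ (m - count \<alpha> j)
        / (real (off_divisors n j \<alpha>) * b j)"
    have g0: "?g \<alpha> j \<ge> 0" for \<alpha> j using b[of j] by (intro divide_nonneg_nonneg mult_nonneg_nonneg) auto
    have "(\<Sum>\<alpha>\<in>\<A>. x \<alpha>) \<le> (\<Sum>\<alpha>\<in>\<A>. (cmod (c \<alpha>))\<^sup>2 * (\<epsilon> / 5 * (\<Sum>j<n. ?g \<alpha> j)))"
    proof (intro sum_mono)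
      fix \<alpha> assume a: "\<alpha> \<in> \<A>"
      have "mpow b \<alpha> powr (- 1 / real m) / perms \<alpha> \<le> blei_weight n \<alpha> / 5 * (\<Sum>j<n. ?g \<alpha> j)"
        using blei_term_le[OF m, of \<alpha> n b] a \<A> b by auto
      also have "\<dots> \<le> \<epsilon> / 5 * (\<Sum>j<n. ?g \<alpha> j)"
        using \<epsilon>(2)[OF a] by (intro mult_right_mono sum_nonneg g0) auto
      finally show "x \<alpha> \<le> (cmod (c \<alpha>))\<^sup>2 * (\<epsilon> / 5 * (\<Sum>j<n. ?g \<alpha> j))"
        unfolding x_def by (intro mult_left_mono) auto
    qed
    also have "\<dots> \<le> (\<Sum>\<alpha>\<in>?M. (cmod (c \<alpha>))\<^sup>2 * (\<epsilon> / 5 * (\<Sum>j<n. ?g \<alpha> j)))"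
      using \<A> finM \<epsilon>(1) by (intro sum_mono2 mult_nonneg_nonneg sum_nonneg g0) auto
    also have "\<dots> = (\<Sum>j<n. \<epsilon> / 5 / b j * (\<Sum>\<alpha>\<in>?M. (real (count \<alpha> j) / real m)\<^sup>2 * (2/5) ^ (m - count \<alpha> j)
      * (cmod (c \<alpha>))\<^sup>2 / real (off_divisors n j \<alpha>)))"
      unfolding sum_distrib_left by (subst sum.swap) (intro sum.cong refl, simp add: ac_simps)
    also have "\<dots> \<le> (\<Sum>j<n. \<epsilon> / 5 / b j * (5 * (b j)\<^sup>2))"
    proof (intro sum_mono mult_left_mono slot_sum_le[OF m _ N(1)])
      fix j assume "j \<in> {..<n}"
      then show "j < n" by simp
      show "avg (torus N n) (\<lambda>z. cmod (partial_slot m n c j z)) \<le> b j"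
        unfolding b_def using V by simp
      show "0 \<le> \<epsilon> / 5 / b j" using \<epsilon>(1) b[of j] by simp
    qed
    also have "\<dots> = \<epsilon> * B"
      unfolding B_def sum_distrib_left using b by (intro sum.cong refl) (simp add: power2_eq_square less_imp_neq[symmetric])
    finally show ?thesis .
  qed
  have sumy: "(\<Sum>\<alpha>\<in>\<A>. perms \<alpha> * mpow b \<alpha>) \<le> B ^ m"
  proof -
    have "(\<Sum>\<alpha>\<in>\<A>. perms \<alpha> * mpow b \<alpha>) \<le> (\<Sum>\<alpha>\<in>?M. perms \<alpha> * mpow b \<alpha>)"
      using \<A> finM perms_pos mb by (intro sum_mono2 mult_nonneg_nonneg) (auto intro: less_imp_le)
    then show ?thesis by (simp add: multinomial_mset B_def)
  qed
  have r: "0 < r" "r < 1" "1 - r = 1 / (real m + 1)" using m by (auto simp: r_def field_simps)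
  let ?K = "\<epsilon> powr r * B powr (2 * r)"
  have "(\<Sum>\<alpha>\<in>\<A>. perms \<alpha> * (cmod (c \<alpha>) / perms \<alpha>) powr (2 * r))
      \<le> (\<Sum>\<alpha>\<in>\<A>. ?K * (r * (x \<alpha> / (\<epsilon> * B)) + (1 - r) * (perms \<alpha> * mpow b \<alpha> / B ^ m)))"
  proof (intro sum_mono)
    fix \<alpha>
    let ?M = "perms \<alpha>" and ?g = "mpow b \<alpha>"
    show "?M * (cmod (c \<alpha>) / ?M) powr (2 * r)
        \<le> ?K * (r * (x \<alpha> / (\<epsilon> * B)) + (1 - r) * (?M * ?g / B ^ m))"
    proof (cases "c \<alpha> = 0")
      case True
      then show ?thesis using r B \<epsilon>(1) x0[of \<alpha>] perms_pos[of \<alpha>] mb[of \<alpha>] by simp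
    next
      case False
      define C where "C = cmod (c \<alpha>)"
      have C: "C > 0" using False by (simp add: C_def)
      have pos: "?M > 0" "?g > 0" by (rule perms_pos mb)+
      have xpos: "x \<alpha> > 0" unfolding x_def using C pos by (simp add: C_def)
      have "(x \<alpha> / (\<epsilon> * B)) powr r * (?M * ?g / B ^ m) powr (1 - r)
          \<le> r * (x \<alpha> / (\<epsilon> * B)) + (1 - r) * (?M * ?g / B ^ m)"
        using r xpos \<epsilon>(1) B pos by (intro Youngs_inequality_0) auto
      moreover have "?K * ((x \<alpha> / (\<epsilon> * B)) powr r * (?M * ?g / B ^ m) powr (1 - r))
          = ?M * (C / ?M) powr (2 * r)"
      proof -
        \<comment> \<open>These relations determine r: by the second the powers of b^\<alpha>
          cancel, by the first those of B.\<close>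
        have eqs: "real m * (1 - r) = r" "r / real m = 1 - r"
          unfolding r(3) using m by (simp_all add: r_def)
        have "ln (?K * ((x \<alpha> / (\<epsilon> * B)) powr r * (?M * ?g / B ^ m) powr (1 - r)))
            = r * ln \<epsilon> + 2 * r * ln B + r * (ln (x \<alpha>) - (ln \<epsilon> + ln B))
              + (1 - r) * (ln ?M + ln ?g - real m * ln B)"
          using \<epsilon>(1) B xpos pos by (simp add: ln_mult ln_div ln_powr ln_realpow)
        also have "ln (x \<alpha>) = 2 * ln C + (- ln ?g / real m - ln ?M)"
          unfolding x_def C_def[symmetric] using C pos by (simp add: ln_mult ln_div ln_powr ln_realpow)
        also have "r * ln \<epsilon> + 2 * r * ln B + r * (2 * ln C + (- ln ?g / real m - ln ?M) - (ln \<epsilon> + ln B))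
              + (1 - r) * (ln ?M + ln ?g - real m * ln B)
            = r * (2 * ln C) + (1 - 2 * r) * ln ?M + (r - real m * (1 - r)) * ln B + (1 - r - r / real m) * ln ?g"
          by (simp add: algebra_simps)
        also have "\<dots> = r * (2 * ln C) + (1 - 2 * r) * ln ?M" by (simp add: eqs)
        also have "\<dots> = ln (?M * (C / ?M) powr (2 * r))"
          using C pos by (simp add: ln_mult ln_div ln_powr algebra_simps)
        finally show ?thesis
          using C pos \<epsilon>(1) B xpos perms_pos[of \<alpha>] mb[of \<alpha>]
          by (subst (asm) ln_inj_iff) auto
      qed
      ultimately show ?thesis using \<epsilon>(1) B unfolding C_def by (metis mult_left_mono mult_nonneg_nonneg powr_ge_zero)
    qed
  qed
  also have "\<dots> = ?K * (r * ((\<Sum>\<alpha>\<in>\<A>. x \<alpha>) / (\<epsilon> * B)) + (1 - r) * ((\<Sum>\<alpha>\<in>\<A>. perms \<alpha> * mpow b \<alpha>) / B ^ m))"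
    by (simp add: sum.distrib sum_distrib_left[symmetric] sum_divide_distrib[symmetric])
  also have "\<dots> \<le> ?K * (r * 1 + (1 - r) * 1)"
    using sumx sumy \<epsilon>(1) B r by (intro mult_left_mono add_mono) (auto simp: divide_le_eq)
  also have "\<dots> = \<epsilon> powr r * B powr (2 * r)" by simp
  also have "\<dots> \<le> \<epsilon> powr r * (3 * V) powr (2 * r)"
    using B3 B r by (intro mult_left_mono powr_mono2) auto
  finally show ?thesis by (simp add: r_def)
qed

subsection \<open>Size of the weights\<close>

lemma perms_mult_facts: "perms \<alpha> * (\<Prod>j\<in>set_mset \<alpha>. fact (count \<alpha> j)) = fact (size \<alpha>)"
proof -
  have "real (card (permutations_of_multiset \<alpha>) * (\<Prod>j\<in>set_mset \<alpha>. fact (count \<alpha> j))) = real (fact (size \<alpha>))"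
    by (simp only: card_permutations_of_multiset_aux)
  then show ?thesis by (simp add: perms_def of_nat_prod)
qed

lemma prod_fact_le_fact_sum: "finite I \<Longrightarrow> (\<Prod>i\<in>I. fact (f i) :: nat) \<le> fact (\<Sum>i\<in>I. f i)"
proof (induction I rule: finite_induct)
  case (insert x I)
  have "(\<Prod>i\<in>insert x I. fact (f i) :: nat) \<le> fact (f x) * fact (\<Sum>i\<in>I. f i)"
    using insert by simp
  also have "\<dots> \<le> fact (f x + (\<Sum>i\<in>I. f i))"
    by (rule dvd_imp_le[OF fact_fact_dvd_fact]) simp
  finally show ?case using insert by simp
qed simp

text \<open>In the multinomial coefficient, the factorials of the counts other than that of l
  multiply to at most the factorial of their sum.\<close>

lemma perms_ge_choose:
  assumes "l \<in># \<alpha>"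
  shows "perms \<alpha> \<ge> real (size \<alpha> choose (size \<alpha> - count \<alpha> l))"
proof -
  let ?J = "set_mset \<alpha> - {l}" and ?k = "size \<alpha> - count \<alpha> l"
  have "size \<alpha> = (\<Sum>j\<in>set_mset \<alpha>. count \<alpha> j)" by (simp add: size_multiset_overloaded_eq)
  also have "\<dots> = count \<alpha> l + (\<Sum>j\<in>?J. count \<alpha> j)" using assms by (simp add: sum.remove)
  finally have k: "(\<Sum>j\<in>?J. count \<alpha> j) = ?k" by simp
  have "(\<Prod>j\<in>?J. fact (count \<alpha> j) :: nat) \<le> fact ?k"
    using prod_fact_le_fact_sum[of ?J "count \<alpha>"] k by simp
  then have "real (\<Prod>j\<in>?J. fact (count \<alpha> j)) \<le> real (fact ?k)" by (rule of_nat_mono)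
  then have le: "(\<Prod>j\<in>?J. fact (count \<alpha> j)) \<le> (fact ?k :: real)" by simp
  have "fact (size \<alpha>) = perms \<alpha> * (fact (count \<alpha> l) * (\<Prod>j\<in>?J. fact (count \<alpha> j)))"
    using perms_mult_facts[of \<alpha>] assms by (simp add: prod.remove)
  also have "\<dots> \<le> perms \<alpha> * (fact (count \<alpha> l) * fact ?k)"
    using perms_pos[of \<alpha>] le by (intro mult_left_mono) auto
  finally have "fact (size \<alpha>) / (fact ?k * fact (count \<alpha> l)) \<le> perms \<alpha>"
    by (simp add: divide_le_eq mult.commute)
  moreover have "size \<alpha> - ?k = count \<alpha> l" using count_le_size[of \<alpha> l] by simp
  ultimately show ?thesis by (simp add: binomial_fact)
qed

lemma prod_powr_le_powr_sum:
  fixes x q :: "'a \<Rightarrow> real"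
  assumes "\<And>i. i \<in> I \<Longrightarrow> 0 \<le> x i \<and> x i \<le> K" "\<And>i. i \<in> I \<Longrightarrow> q i \<ge> 0" "K > 0" "finite I"
  shows "(\<Prod>i\<in>I. x i powr q i) \<le> K powr (\<Sum>i\<in>I. q i)"
proof -
  have "(\<Prod>i\<in>I. x i powr q i) \<le> (\<Prod>i\<in>I. K powr q i)"
    using assms by (intro prod_mono) (auto intro: powr_mono2)
  also have "\<dots> = K powr (\<Sum>i\<in>I. q i)" using assms by (simp add: powr_sum)
  finally show ?thesis .
qed

text \<open>For the finitely many small m, any bound independent of n and \<alpha> will do. Each
  slot weight is at most (5/2)^m 2^m m, hence so is their weighted geometric mean.\<close>

lemma blei_weight_crude:
  assumes m: "m \<ge> 1" and \<alpha>: "\<alpha> \<in> multisets_of_size {..<n} m"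
  shows "blei_weight n \<alpha> \<le> 5 * (5 ^ m * real m)"
proof -
  have sub: "set_mset \<alpha> \<subseteq> {..<n}" and size: "size \<alpha> = m" using \<alpha> by (auto simp: multisets_of_size_def)
  have "(\<Prod>j\<in>set_mset \<alpha>. slot_weight n \<alpha> j powr (real (count \<alpha> j) / real m))
      \<le> (5 ^ m * real m) powr (\<Sum>j\<in>set_mset \<alpha>. real (count \<alpha> j) / real m)"
  proof (rule prod_powr_le_powr_sum)
    fix j assume j: "j \<in># \<alpha>"
    have "off_divisors n j \<alpha> \<le> 2 ^ (m - count \<alpha> j)"
      using off_divisors_le[OF sub, of j] j sub size by auto
    also have "\<dots> \<le> 2 ^ m" by (rule power_increasing) auto
    finally have "real (off_divisors n j \<alpha>) \<le> 2 ^ m" by (metis of_nat_le_iff of_nat_numeral of_nat_power)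
    moreover have "(5/2::real) ^ (m - count \<alpha> j) \<le> (5/2) ^ m" by (rule power_increasing) auto
    ultimately have "(5/2::real) ^ (m - count \<alpha> j) * real (off_divisors n j \<alpha>) * real m \<le> (5/2) ^ m * 2 ^ m * real m"
      by (intro mult_mono) auto
    moreover have "(5/2::real) ^ m * 2 ^ m = 5 ^ m" by (simp flip: power_mult_distrib)
    moreover have "slot_weight n \<alpha> j \<le> (5/2::real) ^ (m - count \<alpha> j) * real (off_divisors n j \<alpha>) * real m / 1"
      unfolding slot_weight_def size using j by (intro divide_left_mono) (auto simp: Suc_le_eq simp flip: count_greater_zero_iff)
    ultimately show "0 \<le> slot_weight n \<alpha> j \<and> slot_weight n \<alpha> j \<le> 5 ^ m * real m"
      using slot_weight_pos[OF j, of n] by simp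
  qed (use m in auto)
  also have "\<dots> = 5 ^ m * real m" using sum_q_eq_1[OF size m] m by simp
  finally have *: "(\<Prod>j\<in>set_mset \<alpha>. slot_weight n \<alpha> j powr (real (count \<alpha> j) / real m)) \<le> 5 ^ m * real m" .
  have "blei_weight n \<alpha> \<le> 5 * (5 ^ m * real m) / 1"
    unfolding blei_weight_def size using * perms_ge_1[of \<alpha>] m by (intro frac_le) auto
  then show ?thesis by simp
qed

lemma prod_Suc_count_remove:
  assumes "l < n"
  shows "(\<Prod>i<n. count \<alpha> i + 1) = (count \<alpha> l + 1) * off_divisors n l \<alpha>"
  unfolding off_divisors_def using assms by (subst prod.remove[of _ l]) auto

lemma off_divisors_le_prod: "off_divisors n j \<alpha> \<le> (\<Prod>i<n. count \<alpha> i + 1)"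
proof (cases "j < n")
  case True
  then show ?thesis using prod_Suc_count_remove[OF True, of \<alpha>] by simp
next
  case False
  then have "{..<n} - {j} = {..<n}" by auto
  then show ?thesis by (simp add: off_divisors_def)
qed

text \<open>The variable l carries all but k of the degree, so its slot weight is at most 2 times
  5^k. The other slots have total exponent k/m, which reduces their crude bound 20^m to 20^k.
  Finally the multinomial coefficient is at least the binomial coefficient of m over k, hence at
  least (m/k)^k.\<close>

lemma blei_weight_concentrated:
  assumes m: "m \<ge> 1" and \<alpha>: "\<alpha> \<in> multisets_of_size {..<n} m"
    and k: "k = m - count \<alpha> l" "1 \<le> k" "200 * k \<le> m"
  shows "blei_weight n \<alpha> \<le> 10 * (100 * real k / real m) ^ k"
proof -
  let ?J = "set_mset \<alpha>" and ?q = "\<lambda>j. real (count \<alpha> j) / real m" and ?X = "slot_weight n \<alpha>"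
  have sub: "?J \<subseteq> {..<n}" and size: "size \<alpha> = m" using \<alpha> by (auto simp: multisets_of_size_def)
  have "count \<alpha> l > 0" using k by (cases "count \<alpha> l = 0") auto
  then have l: "l \<in># \<alpha>" "l < n" using sub by auto
  have cl: "count \<alpha> l = m - k" "k < m" using k count_le_size[of \<alpha> l] size by auto
  have off_l: "off_divisors n l \<alpha> \<le> 2 ^ k" using off_divisors_le[OF sub l(2)] size k(1) by simp
  \<comment> \<open>20 is the product of 5/2 from the slot weight, 4 from the divisor count, and 2
    from m \<le> 2^m.\<close>
  define K where "K = (20::real) ^ m"
  have Xl: "?X l \<le> 2 * 5 ^ k"
  proof -
    have "?X l = (5/2) ^ k * real (off_divisors n l \<alpha>) * (real m / real (m - k))"
      unfolding slot_weight_def size using k(1) cl by simp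
    also have "\<dots> \<le> (5/2) ^ k * 2 ^ k * 2"
    proof (intro mult_mono)
      show "real (off_divisors n l \<alpha>) \<le> 2 ^ k" using off_l by (metis of_nat_le_iff of_nat_numeral of_nat_power)
      show "real m / real (m - k) \<le> 2" using k cl by (simp add: divide_le_eq of_nat_diff)
    qed auto
    also have "\<dots> = 2 * 5 ^ k" by (simp flip: power_mult_distrib)
    finally show ?thesis .
  qed
  have Xj: "?X j \<le> K" if j: "j \<in># \<alpha>" for j
  proof -
    have "off_divisors n j \<alpha> \<le> (count \<alpha> l + 1) * off_divisors n l \<alpha>"
      using off_divisors_le_prod[of n j \<alpha>] prod_Suc_count_remove[OF l(2), of \<alpha>] by simp
    also have "\<dots> \<le> 2 ^ m * 2 ^ m"
    proof (intro mult_mono)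
      have "count \<alpha> l + 1 \<le> m" using k cl by simp
      then show "count \<alpha> l + 1 \<le> 2 ^ m" using less_exp[of m] by linarith
      show "off_divisors n l \<alpha> \<le> 2 ^ m"
        by (rule order.trans[OF off_l], rule power_increasing) (use cl in auto)
    qed auto
    also have "\<dots> = 4 ^ m" by (simp flip: power_mult_distrib)
    finally have o: "real (off_divisors n j \<alpha>) \<le> 4 ^ m" by (metis of_nat_le_iff of_nat_numeral of_nat_power)
    have "?X j \<le> (5/2::real) ^ (m - count \<alpha> j) * real (off_divisors n j \<alpha>) * real m / 1"
      unfolding slot_weight_def size using j by (intro divide_left_mono) (auto simp: Suc_le_eq simp flip: count_greater_zero_iff)
    also have "\<dots> = (5/2::real) ^ (m - count \<alpha> j) * real (off_divisors n j \<alpha>) * real m" by simp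
    also have "\<dots> \<le> (5/2) ^ m * 4 ^ m * 2 ^ m"
    proof (intro mult_mono o)
      show "(5/2::real) ^ (m - count \<alpha> j) \<le> (5/2) ^ m" by (rule power_increasing) auto
      show "real m \<le> 2 ^ m" by (rule of_nat_less_two_power[THEN less_imp_le])
    qed auto
    also have "\<dots> = K" unfolding K_def by (simp flip: power_mult_distrib)
    finally show ?thesis .
  qed
  have q: "(\<Sum>j\<in>?J - {l}. ?q j) = real k / real m"
  proof -
    have "(\<Sum>j\<in>?J. ?q j) = ?q l + (\<Sum>j\<in>?J - {l}. ?q j)" using l(1) by (simp add: sum.remove)
    then show ?thesis using sum_q_eq_1[OF size m] cl m by (simp add: of_nat_diff field_simps)
  qed
  have "(\<Prod>j\<in>?J. ?X j powr ?q j) = ?X l powr ?q l * (\<Prod>j\<in>?J - {l}. ?X j powr ?q j)"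
    using l(1) by (simp add: prod.remove)
  also have "\<dots> \<le> (2 * 5 ^ k) * K powr (\<Sum>j\<in>?J - {l}. ?q j)"
  proof (intro mult_mono prod_powr_le_powr_sum prod_nonneg)
    have "?X l powr ?q l \<le> (2 * 5 ^ k) powr ?q l"
      using Xl slot_weight_pos[OF l(1), of n] by (intro powr_mono2) auto
    also have "\<dots> \<le> (2 * 5 ^ k) powr 1"
    proof (intro powr_mono)
      have "(1::real) * 1 \<le> 2 * 5 ^ k" by (intro mult_mono) auto
      then show "(1::real) \<le> 2 * 5 ^ k" by simp
      show "?q l \<le> 1" using cl m by simp
    qed
    finally show "?X l powr ?q l \<le> 2 * 5 ^ k" by simp
    fix j assume "j \<in> ?J - {l}"
    then show "0 \<le> ?X j \<and> ?X j \<le> K" using Xj slot_weight_pos[of j \<alpha> n] by auto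
  qed (auto simp: K_def)
  also have "K powr (\<Sum>j\<in>?J - {l}. ?q j) = 20 ^ k"
    unfolding q K_def using m by (simp add: powr_powr flip: powr_realpow)
  also have "2 * 5 ^ k * 20 ^ k = 2 * (100::real) ^ k" by (simp flip: power_mult_distrib)
  finally have P: "(\<Prod>j\<in>?J. ?X j powr ?q j) \<le> 2 * 100 ^ k" .
  have "(real m / real k) ^ k \<le> real (m choose k)"
    using binomial_ge_n_over_k_pow_k[of k m, where ?'a = real] cl by simp
  also have "\<dots> \<le> perms \<alpha>" using perms_ge_choose[OF l(1)] size k(1) by simp
  finally have pg: "(real m / real k) ^ k \<le> perms \<alpha>" .
  have "blei_weight n \<alpha> \<le> 5 * (2 * 100 ^ k) / (real m / real k) ^ k"
    unfolding blei_weight_def size using P pg m k by (intro frac_le) auto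
  also have "\<dots> = 10 * (100 * real k / real m) ^ k"
    by (simp add: power_divide power_mult_distrib)
  finally show ?thesis .
qed

section \<open>Multi-indices without a dominant variable\<close>

lemma exp_1_bounds: "5/2 < exp (1::real)" "exp (1::real) \<le> 3"
proof -
  \<comment> \<open>1.1^10 is about 2.59, which already exceeds 5/2.\<close>
  have "(1 + 1/10) ^ 10 \<le> exp (1/10::real) ^ 10" by (intro power_mono exp_ge_add_one_self) auto
  also have "\<dots> = exp 1" by (simp flip: exp_of_nat_mult)
  finally have "(1 + 1/10::real) ^ 10 \<le> exp 1" .
  moreover have "5/2 < (1 + 1/10::real) ^ 10" by (simp add: power_divide)
  ultimately show "5/2 < exp (1::real)" by linarith
  show "exp (1::real) \<le> 3" using e_less_272 by simp
qed

lemma ln_5_2: "0 < ln (5/2::real)" "ln (5/2::real) < 1"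
proof -
  have "ln (5/2::real) < ln (exp 1)" using exp_1_bounds by (subst ln_less_cancel_iff) auto
  then show "ln (5/2::real) < 1" by simp
qed simp

text \<open>The induction step needs e \<le> (1 + 1/a)^(a+1), which is ln x \<le> x - 1 at x =
  a/(a+1).\<close>

lemma fact_le_power: "a \<ge> 1 \<Longrightarrow> fact a \<le> exp 1 * real a * (real a / exp 1) ^ a"
proof (induction a rule: dec_induct)
  case (step a)
  have a: "real a > 0" using step by simp
  have "exp (real (a + 1) * (1 / (real a + 1))) = exp (1 / (real a + 1)) ^ (a + 1)"
    by (rule exp_of_nat_mult)
  moreover have "real (a + 1) * (1 / (real a + 1)) = 1" using a by simp
  ultimately have "exp 1 = exp (1 / (real a + 1)) ^ (a + 1)" by metis
  also have "\<dots> \<le> ((real a + 1) / real a) ^ (a + 1)"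
  proof (intro power_mono)
    have "ln (real a / (real a + 1)) \<le> real a / (real a + 1) - 1"
      using a by (intro ln_le_minus_one) auto
    then have "1 / (real a + 1) \<le> ln ((real a + 1) / real a)"
      using a by (simp add: ln_div field_simps)
    then show "exp (1 / (real a + 1)) \<le> (real a + 1) / real a"
      using a by (simp add: ln_ge_iff)
  qed auto
  finally have e: "exp 1 * real a ^ (a + 1) \<le> (real a + 1) ^ (a + 1)"
    using a by (simp add: power_divide divide_le_eq le_divide_eq)
  have "fact (Suc a) = (real a + 1) * fact a" by (simp add: algebra_simps)
  also have "\<dots> \<le> (real a + 1) * (exp 1 * real a * (real a / exp 1) ^ a)"
    using step.IH by (intro mult_left_mono) auto
  also have "\<dots> = (real a + 1) * (exp 1 * real a ^ (a + 1)) / exp 1 ^ a"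
    by (simp add: power_divide)
  also have "\<dots> \<le> (real a + 1) * (real a + 1) ^ (a + 1) / exp 1 ^ a"
    using e by (intro divide_right_mono mult_left_mono) auto
  also have "\<dots> = exp 1 * real (Suc a) * (real (Suc a) / exp 1) ^ Suc a"
    by (simp add: power_divide add.commute)
  finally show ?case .
qed simp

lemma fact_ge_power: "(real m / exp 1) ^ m \<le> fact m"
proof -
  have "real m ^ m / fact m \<le> exp (real m)"
  proof -
    have "(\<Sum>n\<in>{m}. inverse (fact n) *\<^sub>R real m ^ n) \<le> exp (real m)"
      unfolding exp_def by (intro sum_le_suminf summable_exp_generic) auto
    then show ?thesis by (simp add: divide_inverse mult.commute)
  qed
  then have "real m ^ m \<le> exp (real m) * fact m" by (simp add: divide_le_eq)
  also have "exp (real m) = exp 1 ^ m" by (simp flip: exp_of_nat_mult)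
  finally show ?thesis by (simp add: power_divide divide_le_eq mult.commute)
qed

text \<open>The factor contributed by one variable of degree a in \<open>blei_weight_spread\<close>.
  For t = a/m it is at most a polynomial in a times (h(t) m/e)^a with h(t) = t (5/2)^(1-t). Because
  ln (5/2) < 1, h is at most h(199/200) < 1 on the relevant range, and a \<theta> slightly above
  that value absorbs the polynomial.\<close>

lemma part_factor_bound:
  obtains \<theta> :: real and m1 :: nat where "0 < \<theta>" "\<theta> < 1"
    "\<And>m a. m \<ge> m1 \<Longrightarrow> a \<ge> 1 \<Longrightarrow> 200 * a \<le> 199 * m \<Longrightarrow>
      (real a + 1) * fact a * ((5/2) powr (1 - real a / real m)) ^ a \<le> (\<theta> * real m / exp 1) ^ a"
proof -
  define h where "h = (\<lambda>t::real. t * (5/2) powr (1 - t))"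
  define g where "g = h (199/200)"
  have g0: "g > 0" unfolding g_def h_def by simp
  have lng: "ln g = ln (199/200) + (1/200) * ln (5/2)" 
  proof -
    have "ln g = ln (199/200) + ln ((5/2) powr (1 - 199/200))"
      unfolding g_def h_def by (subst ln_mult) auto
    then show ?thesis by (simp add: ln_powr)
  qed
  have "ln (199/200::real) \<le> 199/200 - 1" by (rule ln_le_minus_one) simp
  then have "ln g < 0" unfolding lng using ln_5_2 by simp
  then have g1: "g < 1" using g0 by simp
  have hg: "h t \<le> g" if "0 < t" "t \<le> 199/200" for t
  proof -
    have "ln (t / (199/200)) \<le> t / (199/200) - 1" using that by (intro ln_le_minus_one) auto
    moreover have "ln (t / (199/200)) = ln t - ln (199/200)" using that by (subst ln_div) auto
    ultimately have "ln t - ln (199/200) \<le> t / (199/200) - 1" by linarith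
    also have "\<dots> \<le> (t - 199/200) * 1" using that by simp
    also have "\<dots> \<le> (t - 199/200) * ln (5/2)" using that ln_5_2 by (intro mult_left_mono_neg) auto
    finally have "ln t + (1 - t) * ln (5/2) \<le> ln (199/200) + (1/200) * ln (5/2)" by (simp add: algebra_simps)
    also have "\<dots> = ln g" by (rule lng[symmetric])
    also have "ln t + (1 - t) * ln (5/2) = ln (h t)" unfolding h_def using that by (simp add: ln_mult ln_powr)
    finally show ?thesis using that g0 by (simp add: h_def)
  qed
  \<comment> \<open>Any number strictly between g and 1 would serve. As \<open>s\<close> squared is
    g/\<theta>, the limit a s^a -> 0 controls a^2 (g/\<theta>)^a.\<close>
  define \<theta> where "\<theta> = (1 + g) / 2"
  have \<theta>: "0 < \<theta>" "\<theta> < 1" "g < \<theta>" using g0 g1 by (auto simp: \<theta>_def)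
  define s where "s = sqrt (g / \<theta>)"
  have s: "0 < s" "s < 1" "s\<^sup>2 = g / \<theta>" using g0 \<theta> by (auto simp: s_def)
  have "(\<lambda>a. real a * s ^ a) \<longlonglongrightarrow> 0"
    using powser_times_n_limit_0[of s] s by simp
  then have "\<forall>\<^sub>F a in sequentially. real a * s ^ a < 1/3"
    by (rule order_tendstoD) simp
  then obtain A where A: "\<And>a. a \<ge> A \<Longrightarrow> real a * s ^ a < 1/3"
    by (auto simp: eventually_sequentially)
  have big: "exp 1 * real a * (real a + 1) * g ^ a \<le> \<theta> ^ a" if "a \<ge> A" "a \<ge> 1" for a
  proof -
    have "(real a * s ^ a)\<^sup>2 \<le> (1/3)\<^sup>2" using A[OF that(1)] s by (intro power_mono) auto
    also have "(real a * s ^ a)\<^sup>2 = (real a)\<^sup>2 * (g / \<theta>) ^ a"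
      by (metis power_mult_distrib power_commutes power_mult mult.commute s(3))
    finally have *: "(real a)\<^sup>2 * (g / \<theta>) ^ a \<le> 1/9" by (simp add: power_divide)
    have "exp 1 * real a * (real a + 1) * (g / \<theta>) ^ a \<le> 3 * real a * (real a + real a) * (g / \<theta>) ^ a"
      using exp_1_bounds that g0 \<theta> by (intro mult_mono) auto
    also have "\<dots> = 6 * ((real a)\<^sup>2 * (g / \<theta>) ^ a)" by (simp add: power2_eq_square)
    also have "\<dots> \<le> 1" using * by simp
    finally show ?thesis using \<theta> by (simp add: power_divide divide_le_eq)
  qed
  \<comment> \<open>For a < A the smallness comes from m instead: h(t) is at most (5/2) A/m, and the
    polynomial prefactor is at most 12^a. The product of 12 and 5/2 is 30.\<close>
  obtain m1 :: nat where m1: "real m1 \<ge> 30 * real A / \<theta>" "m1 \<ge> 1"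
    by (metis nat_le_linear of_nat_le_iff order.trans real_arch_simple)
  have "(real a + 1) * fact a * ((5/2) powr (1 - real a / real m)) ^ a \<le> (\<theta> * real m / exp 1) ^ a"
    if m: "m \<ge> m1" and a: "a \<ge> 1" and am: "200 * a \<le> 199 * m" for m a
  proof -
    have mpos: "real m > 0" using m m1(2) by simp
    define t where "t = real a / real m"
    have t: "0 < t" "t \<le> 199/200" using a am mpos by (auto simp: t_def divide_le_eq)
    have h0: "h t > 0" using t by (simp add: h_def)
    have key: "exp 1 * real a * (real a + 1) * h t ^ a \<le> \<theta> ^ a"
    proof (cases "a \<ge> A")
      case True
      have "exp 1 * real a * (real a + 1) * h t ^ a \<le> exp 1 * real a * (real a + 1) * g ^ a"
        using hg[OF t] h0 by (intro mult_left_mono power_mono) auto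
      then show ?thesis using big[OF True a] by linarith
    next
      case False
      have ht: "h t \<le> 5/2 * (real A / real m)"
      proof -
        have "(5/2) powr (1 - t) \<le> (5/2::real) powr 1" using t by (intro powr_mono) auto
        moreover have "t \<le> real A / real m" unfolding t_def using False mpos by (intro divide_right_mono) auto
        ultimately have "h t \<le> (real A / real m) * (5/2)" unfolding h_def using t by (intro mult_mono) auto
        then show ?thesis by simp
      qed
      have 1: "real a \<le> 2 ^ a" by (rule of_nat_less_two_power[THEN less_imp_le])
      have "a + 1 \<le> 2 ^ a" using less_exp[of a] by linarith
      then have "real (a + 1) \<le> real (2 ^ a)" by (rule of_nat_mono)
      then have 2: "real a + 1 \<le> 2 ^ a" by simp
      have 3: "exp (1::real) \<le> 3 ^ a"
        using exp_1_bounds(2) power_increasing[of 1 a "3::real"] a by simp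
      have "exp 1 * real a * (real a + 1) * h t ^ a \<le> 3 ^ a * 2 ^ a * 2 ^ a * h t ^ a"
        using 1 2 3 h0 by (intro mult_mono) auto
      also have "\<dots> = (3 * 2 * 2 * h t) ^ a" by (simp only: power_mult_distrib)
      also have "3 * 2 * 2 * h t = 12 * h t" by simp
      also have "(12 * h t) ^ a \<le> \<theta> ^ a"
      proof (intro power_mono)
        have "30 * real A / \<theta> \<le> real m" using m1(1) m by (meson of_nat_le_iff order.trans)
        then have "30 * real A / real m \<le> \<theta>" using \<theta> mpos by (simp add: field_simps)
        then show "12 * h t \<le> \<theta>" using ht by simp
      qed (use h0 in auto)
      finally show ?thesis .
    qed
    have "(real a + 1) * fact a * ((5/2) powr (1 - t)) ^ a
        \<le> (real a + 1) * (exp 1 * real a * (real a / exp 1) ^ a) * ((5/2) powr (1 - t)) ^ a"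
      using fact_le_power[OF a] by (intro mult_right_mono mult_left_mono) auto
    also have "\<dots> = exp 1 * real a * (real a + 1) * ((real a / exp 1) * (5/2) powr (1 - t)) ^ a"
      unfolding power_mult_distrib[of "real a / exp 1"] by (simp only: mult.assoc mult.commute mult.left_commute)
    also have "(real a / exp 1) * (5/2) powr (1 - t) = (real m / exp 1) * h t"
      unfolding h_def t_def using mpos by simp
    also have "exp 1 * real a * (real a + 1) * ((real m / exp 1) * h t) ^ a
        = (exp 1 * real a * (real a + 1) * h t ^ a) * (real m / exp 1) ^ a"
      unfolding power_mult_distrib by (simp only: mult.assoc mult.commute mult.left_commute)
    also have "\<dots> \<le> \<theta> ^ a * (real m / exp 1) ^ a"
      using key by (intro mult_right_mono) auto
    also have "\<dots> = (\<theta> * real m / exp 1) ^ a" by (simp add: power_mult_distrib power_divide)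
    finally show ?thesis by (simp add: t_def)
  qed
  with \<theta> show ?thesis using that by blast
qed

text \<open>Once each divisor count is replaced by the full product D, the bound factorises over the
  support: D is a product of \<alpha>_j + 1, and 1/M_\<alpha> a product of the \<alpha>_j! over m!.
  The hypothesis \<open>part\<close> bounds each factor, and the product \<theta>^m (m/e)^m is at
  most \<theta>^m m!.\<close>

lemma blei_weight_spread:
  assumes m: "m \<ge> 1" and \<alpha>: "\<alpha> \<in> multisets_of_size {..<n} m" and \<theta>: "0 < \<theta>"
    and part: "\<And>a. a \<ge> 1 \<Longrightarrow> 200 * a \<le> 199 * m \<Longrightarrow>
      (real a + 1) * fact a * ((5/2) powr (1 - real a / real m)) ^ a \<le> (\<theta> * real m / exp 1) ^ a"
    and spread: "\<And>j. 200 * count \<alpha> j \<le> 199 * m"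
  shows "blei_weight n \<alpha> \<le> 5 * real m * \<theta> ^ m"
proof -
  let ?J = "set_mset \<alpha>" and ?q = "\<lambda>j. real (count \<alpha> j) / real m" and ?X = "slot_weight n \<alpha>"
  have sub: "?J \<subseteq> {..<n}" and size: "size \<alpha> = m" using \<alpha> by (auto simp: multisets_of_size_def)
  define D where "D = (\<Prod>j\<in>?J. real (count \<alpha> j) + 1)"
  have D: "D = real (\<Prod>i<n. count \<alpha> i + 1)"
    unfolding D_def of_nat_prod using sub by (intro prod.mono_neutral_cong_left) (auto simp: not_in_iff)
  have D0: "D > 0" unfolding D_def by (intro prod_pos) auto
  let ?Y = "\<lambda>j. ((5/2::real) powr (1 - ?q j)) ^ count \<alpha> j"
  have "(\<Prod>j\<in>?J. ?X j powr ?q j) \<le> (\<Prod>j\<in>?J. ((5/2) powr (1 - ?q j)) ^ count \<alpha> j * (D * real m) powr ?q j)"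
  proof (intro prod_mono conjI)
    fix j assume j: "j \<in> ?J"
    have c1: "count \<alpha> j \<ge> 1" using j by (simp add: Suc_le_eq)
    have cm: "count \<alpha> j \<le> m" using count_le_size[of \<alpha> j] size by simp
    have "?X j \<le> (5/2) ^ (m - count \<alpha> j) * real (off_divisors n j \<alpha>) * real m / 1"
      unfolding slot_weight_def size using c1 by (intro divide_left_mono) auto
    also have "\<dots> \<le> (5/2) ^ (m - count \<alpha> j) * D * real m / 1"
      unfolding D using off_divisors_le_prod[of n j \<alpha>] by (intro divide_right_mono mult_right_mono mult_left_mono of_nat_mono) auto
    also have "\<dots> = (5/2) powr (real m - real (count \<alpha> j)) * (D * real m)"
      using cm by (simp add: of_nat_diff flip: powr_realpow)
    finally have "?X j powr ?q j \<le> ((5/2) powr (real m - real (count \<alpha> j)) * (D * real m)) powr ?q j"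
      using slot_weight_pos[of j \<alpha> n] j by (intro powr_mono2) auto
    also have "\<dots> = (5/2) powr ((real m - real (count \<alpha> j)) * ?q j) * (D * real m) powr ?q j"
      using D0 m by (subst powr_mult) (auto simp: powr_powr)
    also have "(real m - real (count \<alpha> j)) * ?q j = (1 - ?q j) * real (count \<alpha> j)"
      using m by (simp add: field_simps)
    also have "(5/2::real) powr ((1 - ?q j) * real (count \<alpha> j)) = ((5/2) powr (1 - ?q j)) ^ count \<alpha> j"
      by (simp add: powr_realpow powr_powr[symmetric])
    finally show "?X j powr ?q j \<le> ((5/2) powr (1 - ?q j)) ^ count \<alpha> j * (D * real m) powr ?q j" .
  qed auto
  also have "\<dots> = (\<Prod>j\<in>?J. ?Y j) * (D * real m) powr (\<Sum>j\<in>?J. ?q j)"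
    using D0 m by (simp add: prod.distrib powr_sum)
  also have "\<dots> = (\<Prod>j\<in>?J. ?Y j) * (D * real m)"
    using D0 m sum_q_eq_1[OF size m] by simp
  finally have X: "(\<Prod>j\<in>?J. ?X j powr ?q j) \<le> (\<Prod>j\<in>?J. ?Y j) * (D * real m)" .
  have pm: "1 / perms \<alpha> = (\<Prod>j\<in>?J. fact (count \<alpha> j)) / fact m"
    using perms_mult_facts[of \<alpha>] perms_pos[of \<alpha>] size by (simp add: field_simps)
  have "blei_weight n \<alpha> \<le> 5 * ((\<Prod>j\<in>?J. ?Y j) * (D * real m)) / perms \<alpha>"
    unfolding blei_weight_def size using X perms_pos[of \<alpha>] by (intro divide_right_mono mult_left_mono) auto
  also have "\<dots> = 5 * real m * ((\<Prod>j\<in>?J. ?Y j) * D) * (1 / perms \<alpha>)" by simp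
  also have "\<dots> = 5 * real m * (\<Prod>j\<in>?J. (real (count \<alpha> j) + 1) * fact (count \<alpha> j) * ?Y j) / fact m"
    unfolding pm D_def by (simp add: prod.distrib)
  also have "\<dots> \<le> 5 * real m * (\<Prod>j\<in>?J. (\<theta> * real m / exp 1) ^ count \<alpha> j) / fact m"
    using spread by (intro divide_right_mono mult_left_mono prod_mono conjI part mult_nonneg_nonneg) (auto simp: Suc_le_eq)
  also have "(\<Prod>j\<in>?J. (\<theta> * real m / exp 1) ^ count \<alpha> j) = \<theta> ^ m * (real m / exp 1) ^ m"
    by (simp add: size size_multiset_overloaded_eq[symmetric] power_mult_distrib[symmetric] flip: power_sum)
  also have "5 * real m * (\<theta> ^ m * (real m / exp 1) ^ m) / fact m \<le> 5 * real m * (\<theta> ^ m * fact m) / fact m"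
    using \<theta> fact_ge_power[of m] by (intro divide_right_mono mult_left_mono) auto
  also have "\<dots> = 5 * real m * \<theta> ^ m" by simp
  finally show ?thesis .
qed

lemma square_le_two_power: "k\<^sup>2 \<le> 2 * (2::nat) ^ k"
proof (cases "k < 3")
  case True
  then have "k = 0 \<or> k = 1 \<or> k = 2" by auto
  then show ?thesis by auto
next
  case False
  then have "3 \<le> k" by simp
  then show ?thesis
  proof (induction k rule: dec_induct)
    case (step k)
    have "3 * k \<le> k * k" using step(1) by (intro mult_right_mono) auto
    then have "2 * k + 1 \<le> k\<^sup>2" using step(1) unfolding power2_eq_square by linarith
    then have "(Suc k)\<^sup>2 \<le> 2 * k\<^sup>2" by (simp add: power2_eq_square)
    then show ?case using step by simp
  qed simp
qed

text \<open>Either some variable has at least 199/200 of the degree, and the concentrated bound (100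
  k/m)^k applies with k = m - \<alpha>_l, or the spread bound decays exponentially in m. Only k = 1
  is as large as order 1/m; all k \<ge> 2 are of order m^(-2).\<close>

lemma blei_weight_eventually:
  obtains m1 where
    "\<And>m n \<alpha>. m \<ge> m1 \<Longrightarrow> \<alpha> \<in> multisets_of_size {..<n} m \<Longrightarrow> (\<And>j. count \<alpha> j + 1 \<le> m) \<Longrightarrow>
       blei_weight n \<alpha> \<le> 10^6 / real m"
    "\<And>m n \<alpha>. m \<ge> m1 \<Longrightarrow> \<alpha> \<in> multisets_of_size {..<n} m \<Longrightarrow> (\<And>j. count \<alpha> j + 2 \<le> m) \<Longrightarrow>
       blei_weight n \<alpha> \<le> 10^6 / (real m)\<^sup>2"
proof -
  obtain \<theta> :: real and m2 :: nat where \<theta>: "0 < \<theta>" "\<theta> < 1" and part: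
    "\<And>m a. m \<ge> m2 \<Longrightarrow> a \<ge> 1 \<Longrightarrow> 200 * a \<le> 199 * m \<Longrightarrow>
      (real a + 1) * fact a * ((5/2) powr (1 - real a / real m)) ^ a \<le> (\<theta> * real m / exp 1) ^ a"
    using part_factor_bound by metis
  \<comment> \<open>The cube root makes m s^m \<le> 1 yield m^3 \<theta>^m \<le> 1, so 5 m
    \<theta>^m is at most 5 m^(-2).\<close>
  define s where "s = root 3 \<theta>"
  have s: "0 < s" "s < 1" "s ^ 3 = \<theta>" using \<theta> by (auto simp: s_def)
  have "(\<lambda>a. real a * s ^ a) \<longlonglongrightarrow> 0"
    using powser_times_n_limit_0[of s] s by simp
  then have "\<forall>\<^sub>F a in sequentially. real a * s ^ a < 1"
    by (rule order_tendstoD) simp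
  then obtain m3 where m3: "\<And>a. a \<ge> m3 \<Longrightarrow> real a * s ^ a < 1"
    by (auto simp: eventually_sequentially)
  define m1 where "m1 = max 1 (max m2 m3)"
  have spread: "blei_weight n \<alpha> \<le> 10^6 / (real m)\<^sup>2"
    if "m \<ge> m1" "\<alpha> \<in> multisets_of_size {..<n} m" "\<And>j. 200 * count \<alpha> j \<le> 199 * m" for m n \<alpha>
  proof -
    have m: "m \<ge> 1" "m \<ge> m2" "m \<ge> m3" using that by (auto simp: m1_def)
    have "blei_weight n \<alpha> \<le> 5 * real m * \<theta> ^ m"
      by (rule blei_weight_spread[OF m(1) that(2) \<theta>(1) part[OF m(2)] that(3)])
    also have "\<dots> = 5 * (real m * s ^ m) ^ 3 / (real m)\<^sup>2"
      using m(1) by (simp add: power_mult_distrib s(3)[symmetric] power2_eq_square power3_eq_cube)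
    also have "\<dots> \<le> 5 * 1 ^ 3 / (real m)\<^sup>2"
      using m3[OF m(3)] s by (intro divide_right_mono mult_left_mono power_mono) auto
    also have "\<dots> \<le> 10^6 / (real m)\<^sup>2" by (intro divide_right_mono) auto
    finally show ?thesis .
  qed
  have two: "blei_weight n \<alpha> \<le> 10^6 / (real m)\<^sup>2"
    if "m \<ge> m1" "\<alpha> \<in> multisets_of_size {..<n} m" "\<And>j. count \<alpha> j + 2 \<le> m" for m n \<alpha>
  proof (cases "\<exists>l. 200 * (m - count \<alpha> l) \<le> m")
    case False
    have "200 * count \<alpha> j \<le> 199 * m" for j
    proof -
      have "\<not> 200 * (m - count \<alpha> j) \<le> m" using False by blast
      then show ?thesis using that(3)[of j] by arith
    qed
    then show ?thesis by (intro spread[OF that(1,2)])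
  next
    case True
    then obtain l where l: "200 * (m - count \<alpha> l) \<le> m" ..
    define k where "k = m - count \<alpha> l"
    have k: "2 \<le> k" "200 * k \<le> m" using that(3)[of l] l by (auto simp: k_def)
    have m: "m \<ge> 1" using that(1) by (simp add: m1_def)
    let ?u = "100 * real k / real m"
    have u: "0 \<le> ?u" "?u \<le> 1/2" using k m by (auto simp: divide_le_eq)
    have "blei_weight n \<alpha> \<le> 10 * ?u ^ k"
      using k by (intro blei_weight_concentrated[OF m that(2) k_def]) auto
    \<comment> \<open>The square supplies m^(-2); since u \<le> 1/2, the remaining power compensates
      the factor k^2.\<close>
    also have "?u ^ k = ?u\<^sup>2 * ?u ^ (k - 2)" using k(1) by (metis le_add_diff_inverse power_add)
    also have "10 * (?u\<^sup>2 * ?u ^ (k - 2)) \<le> 10 * (?u\<^sup>2 * (1/2) ^ (k - 2))"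
      using u by (intro mult_left_mono power_mono) auto
    also have "(1/2::real) ^ (k - 2) = 4 / 2 ^ k"
      using k(1) by (simp add: power_diff power_divide)
    also have "10 * (?u\<^sup>2 * (4 / 2 ^ k)) = 400000 * ((real k)\<^sup>2 / 2 ^ k) / (real m)\<^sup>2"
      by (simp add: power_divide power_mult_distrib)
    also have "\<dots> \<le> 400000 * 2 / (real m)\<^sup>2"
    proof (intro divide_right_mono mult_left_mono)
      have "real (k\<^sup>2) \<le> real (2 * 2 ^ k)" by (intro of_nat_mono square_le_two_power)
      then show "(real k)\<^sup>2 / 2 ^ k \<le> 2" by (simp add: divide_le_eq)
    qed auto
    also have "\<dots> \<le> 10^6 / (real m)\<^sup>2" by (intro divide_right_mono) auto
    finally show ?thesis .
  qed
  have one: "blei_weight n \<alpha> \<le> 10^6 / real m"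
    if "m \<ge> m1" "\<alpha> \<in> multisets_of_size {..<n} m" "\<And>j. count \<alpha> j + 1 \<le> m" for m n \<alpha>
  proof (cases "\<forall>j. count \<alpha> j + 2 \<le> m")
    case True
    have m: "real m \<ge> 1" using that(1) by (simp add: m1_def)
    have "blei_weight n \<alpha> \<le> 10^6 / (real m)\<^sup>2" using two[OF that(1,2)] True by blast
    also have "\<dots> \<le> 10^6 / real m"
      using m by (intro divide_left_mono) (auto simp: power2_eq_square)
    finally show ?thesis .
  next
    case False
    then obtain l where l: "\<not> count \<alpha> l + 2 \<le> m" by blast
    have m: "m \<ge> 1" using that(1) by (simp add: m1_def)
    have k: "1 = m - count \<alpha> l" using l that(3)[of l] by linarith
    show ?thesis
    proof (cases "200 * 1 \<le> m")
      case True
      have "blei_weight n \<alpha> \<le> 10 * (100 * real 1 / real m) ^ 1"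
        using True by (intro blei_weight_concentrated[OF m that(2) k]) auto
      also have "\<dots> \<le> 10^6 / real m" by (simp add: divide_right_mono)
      finally show ?thesis .
    next
      case False
      \<comment> \<open>For m < 200 even the count m - 1 is at most 199 m/200, so the spread bound
        covers this case.\<close>
      have "200 * count \<alpha> j \<le> 199 * m" for j using that(3)[of j] False by linarith
      then have "blei_weight n \<alpha> \<le> 10^6 / (real m)\<^sup>2" by (intro spread[OF that(1,2)])
      also have "\<dots> \<le> 10^6 / real m"
        using m by (intro divide_left_mono) (auto simp: power2_eq_square)
      finally show ?thesis .
    qed
  qed
  show ?thesis using that[of m1] one two by blast
qed

subsection \<open>Diagonal and off-diagonal coefficients\<close>

lemma avg_unity_roots_orth:
  "a < N \<Longrightarrow> b < N \<Longrightarrow> avg (unity_roots N) (\<lambda>w. w ^ a * cnj w ^ b) = of_bool (a = b)"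
  by (simp add: avg_def sum_unity_roots_orth card_unity_roots)

text \<open>
  Average the product of the nonnegative functions \<open>1 - Re (u f)\<close> and \<open>1 + Re (\<eta> w\<^sup>k)\<close> over the roots of unity, for
  suitable phases \<open>u\<close> and \<open>\<eta>\<close>.
\<close>

lemma coefficient_le_of_unit_bound:
  fixes h :: "nat \<Rightarrow> complex"
  assumes bound: "\<And>w. cmod w = 1 \<Longrightarrow> cmod (\<Sum>i\<le>m. h i * w ^ i) \<le> 1" and k: "1 \<le> k" "k \<le> m"
  shows "cmod (h k) \<le> 2 * (1 - cmod (h 0))"
proof -
  define N where "N = 2 * m + 1"
  define u where "u = (if h 0 = 0 then 1 else cnj (sgn (h 0)))"
  have u: "cmod u = 1" "u * h 0 = of_real (cmod (h 0))"
    by (auto simp: u_def norm_sgn cnj_sgn_mult)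
  define \<eta> where "\<eta> = sgn (u * h k)"
  have \<eta>: "cmod \<eta> \<le> 1" "u * h k * cnj \<eta> = of_real (cmod (h k))"
    using cnj_sgn_mult[of "u * h k"] u(1) by (auto simp: \<eta>_def norm_sgn mult.commute norm_mult)
  define f where "f = (\<lambda>w. \<Sum>i\<le>m. h i * w ^ i)"
  let ?A = "avg (unity_roots N)"
  have N: "N > 0" by (simp add: N_def)
  define G where "G = (\<lambda>w. (1 - u * f w) * of_real (1 + Re (\<eta> * w ^ k)))"
  have G: "G w = (w ^ 0 * cnj w ^ 0) + (\<eta> / 2) * (w ^ k * cnj w ^ 0) + (cnj \<eta> / 2) * (w ^ 0 * cnj w ^ k)
      + (\<Sum>i\<le>m. (- u * h i) * (w ^ i * cnj w ^ 0)) + (\<Sum>i\<le>m. (- u * h i * \<eta> / 2) * (w ^ (i + k) * cnj w ^ 0))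
      + (\<Sum>i\<le>m. (- u * h i * cnj \<eta> / 2) * (w ^ i * cnj w ^ k))" for w
  proof -
    have re: "of_real (1 + Re (\<eta> * w ^ k)) = 1 + (\<eta> * w ^ k + cnj \<eta> * cnj w ^ k) / 2"
      using complex_add_cnj[of "\<eta> * w ^ k"] by simp
    have sums: "(\<Sum>i\<le>m. (- u * h i) * (w ^ i * cnj w ^ 0)) = - u * f w"
      "(\<Sum>i\<le>m. (- u * h i * \<eta> / 2) * (w ^ (i + k) * cnj w ^ 0)) = - u * f w * (\<eta> * w ^ k) / 2"
      "(\<Sum>i\<le>m. (- u * h i * cnj \<eta> / 2) * (w ^ i * cnj w ^ k)) = - u * f w * (cnj \<eta> * cnj w ^ k) / 2"
      unfolding f_def sum_distrib_left sum_distrib_right sum_divide_distrib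
      by (intro sum.cong refl; simp add: power_add)+
    show ?thesis unfolding G_def re sums by (simp add: field_simps)
  qed
  have add: "?A (\<lambda>w. p w + q w) = ?A p + ?A q" for p q :: "complex \<Rightarrow> complex"
    by (simp add: avg_def sum.distrib add_divide_distrib)
  have "?A G = 1 + (\<Sum>i\<le>m. (- u * h i) * of_bool (i = 0)) + (\<Sum>i\<le>m. (- u * h i * \<eta> / 2) * of_bool (i + k = 0))
      + (\<Sum>i\<le>m. (- u * h i * cnj \<eta> / 2) * of_bool (i = k))"
  proof -
    have o: "?A (\<lambda>w. w ^ a * cnj w ^ b) = of_bool (a = b)" if "a \<le> 2 * m" "b \<le> m" for a b
      by (rule avg_unity_roots_orth) (use that in \<open>auto simp: N_def\<close>)
    have "?A G = ?A (\<lambda>w. w ^ 0 * cnj w ^ 0) + (\<eta> / 2) * ?A (\<lambda>w. w ^ k * cnj w ^ 0) + (cnj \<eta> / 2) * ?A (\<lambda>w. w ^ 0 * cnj w ^ k)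
      + (\<Sum>i\<le>m. (- u * h i) * ?A (\<lambda>w. w ^ i * cnj w ^ 0)) + (\<Sum>i\<le>m. (- u * h i * \<eta> / 2) * ?A (\<lambda>w. w ^ (i + k) * cnj w ^ 0))
      + (\<Sum>i\<le>m. (- u * h i * cnj \<eta> / 2) * ?A (\<lambda>w. w ^ i * cnj w ^ k))"
      unfolding G add avg_sum avg_cmult ..
    also have "\<dots> = of_bool (0 = (0::nat)) + (\<eta> / 2) * of_bool (k = 0) + (cnj \<eta> / 2) * of_bool (0 = k)
      + (\<Sum>i\<le>m. (- u * h i) * of_bool (i = 0)) + (\<Sum>i\<le>m. (- u * h i * \<eta> / 2) * of_bool (i + k = 0))
      + (\<Sum>i\<le>m. (- u * h i * cnj \<eta> / 2) * of_bool (i = k))"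
      using k by (intro arg_cong2[where f = plus] arg_cong2[where f = times] sum.cong refl o) auto
    finally show ?thesis using k by simp
  qed
  also have "(\<Sum>i\<le>m. (- u * h i) * of_bool (i = 0)) = - (u * h 0)"
    by (simp add: of_bool_def if_distrib cong: if_cong)
  also have "(\<Sum>i\<le>m. (- u * h i * \<eta> / 2) * of_bool (i + k = 0)) = 0" using k by simp
  also have "(\<Sum>i\<le>m. (- u * h i * cnj \<eta> / 2) * of_bool (i = k)) = - (u * h k * cnj \<eta>) / 2"
    using k by (simp add: of_bool_def if_distrib cong: if_cong)
  finally have AG: "?A G = of_real (1 - cmod (h 0) - cmod (h k) / 2)" using u \<eta> by simp
  have Re_avg: "Re (?A G) = avg (unity_roots N) (\<lambda>w. Re (G w))"
    unfolding avg_def by simp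
  have "0 \<le> avg (unity_roots N) (\<lambda>w. Re (G w))"
  proof (rule avg_nonneg)
    fix w assume "w \<in> unity_roots N"
    then have w: "cmod w = 1" by (rule unity_roots_norm[OF N])
    have "Re (u * f w) \<le> cmod (u * f w)" by (rule complex_Re_le_cmod)
    also have "\<dots> \<le> 1" using bound[OF w] u by (simp add: norm_mult f_def)
    finally have 1: "Re (u * f w) \<le> 1" .
    have "\<bar>Re (\<eta> * w ^ k)\<bar> \<le> cmod (\<eta> * w ^ k)" by (rule abs_Re_le_cmod)
    also have "\<dots> \<le> 1" using \<eta> w by (simp add: norm_mult norm_power)
    finally have 2: "0 \<le> 1 + Re (\<eta> * w ^ k)" by linarith
    have "Re (G w) = (1 - Re (u * f w)) * (1 + Re (\<eta> * w ^ k))" unfolding G_def by simp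
    then show "0 \<le> Re (G w)" using 1 2 by simp
  qed
  then have "0 \<le> 1 - cmod (h 0) - cmod (h k) / 2" unfolding Re_avg[symmetric] AG by simp
  then show ?thesis by simp
qed

lemma eq_replicate_mset:
  assumes "count \<alpha> i = size \<alpha>"
  shows "\<alpha> = replicate_mset (size \<alpha>) i"
proof -
  have "replicate_mset (size \<alpha>) i \<subseteq># \<alpha>" using assms by (simp flip: count_le_replicate_mset_subset_eq)
  then obtain \<beta> where "\<alpha> = replicate_mset (size \<alpha>) i + \<beta>" by (metis mset_subset_eq_exists_conv)
  moreover from this have "size \<beta> = 0" by (metis add_cancel_left_right size_replicate_mset size_union)
  ultimately show ?thesis by simp
qed

lemma inj_on_replicate_mset:
  assumes "m > 0"
  shows "inj_on (replicate_mset m) A"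
proof (rule inj_onI)
  fix i j assume "replicate_mset m i = replicate_mset m j"
  from arg_cong[OF this, of "\<lambda>\<alpha>. count \<alpha> i"] show "i = j"
    using assms by (simp split: if_splits)
qed

lemma unimodular_power_root:
  assumes "m \<ge> 1"
  obtains v where "cmod v = 1" "w * v ^ m = of_real (cmod w)"
proof
  let ?v = "cis (- Arg w / real m)"
  show "cmod ?v = 1" by simp
  have "?v ^ m = cis (real m * (- Arg w / real m))" by (rule Complex.DeMoivre)
  also have "real m * (- Arg w / real m) = - Arg w" using assms by simp
  finally have "?v ^ m = cis (- Arg w)" .
  then have "w * ?v ^ m = rcis (cmod w) (Arg w) * cis (- Arg w)" by (simp add: rcis_cmod_Arg)
  also have "\<dots> = of_real (cmod w)" by (simp add: rcis_def mult.assoc cis_mult)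
  finally show "w * ?v ^ m = of_real (cmod w)" .
qed

text \<open>Averaging over \<open>m\<close>-th roots of unity in every variable kills exactly the off-diagonal monomials.\<close>

lemma sum_diagonal_le:
  assumes m: "m \<ge> 1"
    and bound: "\<And>z. (\<And>i. i < n \<Longrightarrow> cmod (z i) \<le> 1) \<Longrightarrow> cmod (\<Sum>\<alpha>\<in>multisets_of_size {..<n} m. c \<alpha> * mpow z \<alpha>) \<le> V"
  shows "(\<Sum>j<n. cmod (c (replicate_mset m j))) \<le> V"
proof -
  let ?M = "multisets_of_size {..<n} m"
  have "\<exists>v. cmod v = 1 \<and> c (replicate_mset m j) * v ^ m = of_real (cmod (c (replicate_mset m j)))" for j
    using unimodular_power_root[OF m] by metis
  then obtain v where v: "\<And>j. cmod (v j) = 1"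
    "\<And>j. c (replicate_mset m j) * v j ^ m = of_real (cmod (c (replicate_mset m j)))" by metis
  have m0: "m > 0" using m by simp
  have orth: "avg (torus m n) (\<lambda>\<zeta>. mpow \<zeta> \<alpha>) = of_bool (\<forall>i<n. m dvd count \<alpha> i)" if "\<alpha> \<in> ?M" for \<alpha>
  proof -
    have "avg (torus m n) (\<lambda>\<zeta>. mpow \<zeta> \<alpha>) = avg (torus m n) (\<lambda>\<zeta>. \<Prod>i<n. \<zeta> i ^ count \<alpha> i)"
      using that by (simp add: multisets_of_size_def mpow_eq_prod[of \<alpha> n])
    also have "\<dots> = (\<Prod>i<n. avg (unity_roots m) (\<lambda>w. w ^ count \<alpha> i))" by (rule avg_torus_prod[OF m0])
    also have "\<dots> = (\<Prod>i<n. of_bool (m dvd count \<alpha> i))"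
      using m0 by (intro prod.cong) (auto simp: avg_def sum_unity_roots_power card_unity_roots)
    also have "\<dots> = of_bool (\<forall>i<n. m dvd count \<alpha> i)" by (induction n) (auto simp: less_Suc_eq)
    finally show ?thesis .
  qed
  have diag: "{\<alpha>\<in>?M. \<forall>i<n. m dvd count \<alpha> i} = replicate_mset m ` {..<n}"
  proof (intro equalityI subsetI)
    fix \<alpha> assume "\<alpha> \<in> {\<alpha>\<in>?M. \<forall>i<n. m dvd count \<alpha> i}"
    then have \<alpha>: "set_mset \<alpha> \<subseteq> {..<n}" "size \<alpha> = m" "\<forall>i<n. m dvd count \<alpha> i"
      by (auto simp: multisets_of_size_def)
    then obtain i where i: "i \<in># \<alpha>" using m0 by (metis size_eq_0_iff_empty multiset_nonemptyE less_irrefl)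
    then have "i < n" "count \<alpha> i > 0" using \<alpha>(1) by auto
    then have "m \<le> count \<alpha> i" using \<alpha>(3) by (meson dvd_imp_le)
    then have "count \<alpha> i = size \<alpha>" using count_le_size[of \<alpha> i] \<alpha>(2) by simp
    then have "\<alpha> = replicate_mset m i" using eq_replicate_mset \<alpha>(2) by metis
    then show "\<alpha> \<in> replicate_mset m ` {..<n}" using \<open>i < n\<close> by blast
  qed (auto simp: multisets_of_size_def split: if_splits)
  note inj = inj_on_replicate_mset[OF m0, of "{..<n}"]
  have "avg (torus m n) (\<lambda>\<zeta>. \<Sum>\<alpha>\<in>?M. c \<alpha> * mpow (\<lambda>i. v i * \<zeta> i) \<alpha>)
      = avg (torus m n) (\<lambda>\<zeta>. \<Sum>\<alpha>\<in>?M. (c \<alpha> * mpow v \<alpha>) * mpow \<zeta> \<alpha>)"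
    by (simp add: mpow_mult mult.assoc)
  also have "\<dots> = (\<Sum>\<alpha>\<in>?M. (c \<alpha> * mpow v \<alpha>) * of_bool (\<forall>i<n. m dvd count \<alpha> i))"
    unfolding avg_sum avg_cmult using orth by simp
  also have "\<dots> = (\<Sum>\<alpha>\<in>{\<alpha>\<in>?M. \<forall>i<n. m dvd count \<alpha> i}. c \<alpha> * mpow v \<alpha>)"
    by (rule sum.mono_neutral_cong_right) auto
  also have "\<dots> = (\<Sum>j<n. c (replicate_mset m j) * v j ^ m)"
    unfolding diag by (simp add: sum.reindex[OF inj])
  also have "\<dots> = of_real (\<Sum>j<n. cmod (c (replicate_mset m j)))" by (simp add: v(2))
  finally have eq: "avg (torus m n) (\<lambda>\<zeta>. \<Sum>\<alpha>\<in>?M. c \<alpha> * mpow (\<lambda>i. v i * \<zeta> i) \<alpha>)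
      = of_real (\<Sum>j<n. cmod (c (replicate_mset m j)))" .
  have "(\<Sum>j<n. cmod (c (replicate_mset m j)))
      = cmod (avg (torus m n) (\<lambda>\<zeta>. \<Sum>\<alpha>\<in>?M. c \<alpha> * mpow (\<lambda>i. v i * \<zeta> i) \<alpha>))"
    unfolding eq norm_of_real by (intro abs_of_nonneg[symmetric] sum_nonneg norm_ge_zero)
  also have "\<dots> \<le> avg (torus m n) (\<lambda>\<zeta>. V)"
    by (rule order.trans[OF cmod_avg], rule avg_mono, rule bound)
      (simp add: norm_mult v(1) torus_norm[OF m0])
  also have "\<dots> = V" by (rule avg_const[OF finite_torus[OF m0] torus_nonempty[OF m0]])
  finally show ?thesis .
qed

text \<open>Set z_l = 1 and multiply the other variables by \<mu>. The result is a polynomial in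
  \<mu>, bounded by 1 on the unit circle, whose constant coefficient is that of z_l^m and whose k-th
  coefficient is the slice at z_l = 1. The factor z_l^(m-k) restored at the end has modulus at most
  1.\<close>

lemma slice_bound:
  assumes m: "m \<ge> 1" and l: "l < n" and k: "1 \<le> k" "k \<le> m"
    and bound: "\<And>z. (\<And>i. i < n \<Longrightarrow> cmod (z i) \<le> 1) \<Longrightarrow> cmod (\<Sum>\<alpha>\<in>multisets_of_size {..<n} m. c \<alpha> * mpow z \<alpha>) \<le> 1"
    and z: "\<And>i. i < n \<Longrightarrow> cmod (z i) \<le> 1"
  shows "cmod (\<Sum>\<alpha>\<in>{\<alpha>\<in>multisets_of_size {..<n} m. count \<alpha> l = m - k}. c \<alpha> * mpow z \<alpha>)
    \<le> 2 * (1 - cmod (c (replicate_mset m l)))"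
proof -
  let ?M = "multisets_of_size {..<n} m"
  define z1 where "z1 = z(l := 1)"
  define h where "h = (\<lambda>k. \<Sum>\<alpha>\<in>{\<alpha>\<in>?M. m - count \<alpha> l = k}. c \<alpha> * mpow z1 \<alpha>)"
  have finM: "finite ?M" by auto
  have cm: "count \<alpha> l \<le> m" if "\<alpha> \<in> ?M" for \<alpha>
    using that count_le_size[of \<alpha> l] by (simp add: multisets_of_size_def)
  have split: "mpow (\<lambda>i. if i = l then s else t * w i) \<alpha> = s ^ count \<alpha> l * t ^ (size \<alpha> - count \<alpha> l) * mpow (w(l := 1)) \<alpha>"
    for s t :: complex and w \<alpha>
  proof (induction \<alpha>)
    case (add x \<alpha>)
    have "Suc (size \<alpha>) - count \<alpha> l = Suc (size \<alpha> - count \<alpha> l)"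
      using count_le_size[of \<alpha> l] by (simp add: Suc_diff_le)
    then show ?case using add by (auto simp: algebra_simps)
  qed simp
  have "cmod (h k) \<le> 2 * (1 - cmod (h 0))"
  proof (rule coefficient_le_of_unit_bound[OF _ k])
    fix \<mu> :: complex assume \<mu>: "cmod \<mu> = 1"
    have "(\<Sum>\<alpha>\<in>?M. c \<alpha> * mpow (\<lambda>i. if i = l then 1 else \<mu> * z i) \<alpha>)
        = (\<Sum>\<alpha>\<in>?M. c \<alpha> * mpow z1 \<alpha> * \<mu> ^ (m - count \<alpha> l))"
      unfolding z1_def by (intro sum.cong refl) (simp add: split multisets_of_size_def)
    also have "\<dots> = (\<Sum>k\<le>m. \<Sum>\<alpha>\<in>{\<alpha>\<in>?M. m - count \<alpha> l = k}. c \<alpha> * mpow z1 \<alpha> * \<mu> ^ (m - count \<alpha> l))"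
      by (rule sum.group[symmetric, OF finM]) auto
    also have "\<dots> = (\<Sum>k\<le>m. h k * \<mu> ^ k)"
      unfolding h_def sum_distrib_right by (intro sum.cong refl) auto
    finally have "(\<Sum>k\<le>m. h k * \<mu> ^ k) = (\<Sum>\<alpha>\<in>?M. c \<alpha> * mpow (\<lambda>i. if i = l then 1 else \<mu> * z i) \<alpha>)" ..
    also have "cmod \<dots> \<le> 1" by (rule bound) (use z \<mu> in \<open>auto simp: norm_mult\<close>)
    finally show "cmod (\<Sum>k\<le>m. h k * \<mu> ^ k) \<le> 1" .
  qed
  also have "h 0 = c (replicate_mset m l)"
  proof -
    have "{\<alpha>\<in>?M. m - count \<alpha> l = 0} = {replicate_mset m l}"
    proof (intro equalityI subsetI)
      fix \<alpha> assume "\<alpha> \<in> {\<alpha>\<in>?M. m - count \<alpha> l = 0}"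
      then have "count \<alpha> l = size \<alpha>" "size \<alpha> = m"
        using count_le_size[of \<alpha> l] by (auto simp: multisets_of_size_def)
      then show "\<alpha> \<in> {replicate_mset m l}" using eq_replicate_mset[of \<alpha> l] by simp
    qed (use l in \<open>auto simp: multisets_of_size_def\<close>)
    then show ?thesis by (simp add: h_def z1_def)
  qed
  finally have hk: "cmod (h k) \<le> 2 * (1 - cmod (c (replicate_mset m l)))" .
  have "(\<Sum>\<alpha>\<in>{\<alpha>\<in>?M. count \<alpha> l = m - k}. c \<alpha> * mpow z \<alpha>) = z l ^ (m - k) * h k"
  proof -
    have "{\<alpha>\<in>?M. count \<alpha> l = m - k} = {\<alpha>\<in>?M. m - count \<alpha> l = k}" using cm k by fastforce
    moreover have "mpow z \<alpha> = z l ^ count \<alpha> l * mpow z1 \<alpha>" for \<alpha>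
    proof -
      have "(\<lambda>i. if i = l then z l else 1 * z i) = z" by auto
      then show ?thesis using split[of "z l" 1 z \<alpha>] unfolding z1_def by simp
    qed
    ultimately show ?thesis using k cm unfolding h_def sum_distrib_left
      by (intro sum.cong) (auto simp: mult.left_commute)
  qed
  then have "cmod (\<Sum>\<alpha>\<in>{\<alpha>\<in>?M. count \<alpha> l = m - k}. c \<alpha> * mpow z \<alpha>) = cmod (z l) ^ (m - k) * cmod (h k)"
    by (simp add: norm_mult norm_power)
  also have "\<dots> \<le> 1 * cmod (h k)" using z[OF l] by (intro mult_right_mono power_le_one) auto
  finally show ?thesis using hk by simp
qed

section \<open>The coefficient sum for large degree\<close>

lemma count_add_count_le_size:
  assumes "i \<noteq> j"
  shows "count \<alpha> i + count \<alpha> j \<le> size \<alpha>"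
  using assms by (induction \<alpha>) auto

lemma perms_replicate_mset [simp]: "perms (replicate_mset m j) = 1"
  using perms_mult_facts[of "replicate_mset m j"] by (cases "m = 0") auto

definition bounded_on_polydisc :: "nat \<Rightarrow> nat \<Rightarrow> (nat multiset \<Rightarrow> complex) \<Rightarrow> real \<Rightarrow> bool" where
  "bounded_on_polydisc m n c V \<longleftrightarrow> (\<forall>z. (\<forall>i<n. cmod (z i) \<le> 1) \<longrightarrow>
     cmod (\<Sum>\<alpha>\<in>multisets_of_size {..<n} m. c \<alpha> * mpow z \<alpha>) \<le> V)"

lemma bounded_on_polydiscD:
  assumes "bounded_on_polydisc m n c V" "\<And>i. i < n \<Longrightarrow> cmod (z i) \<le> 1"
  shows "cmod (\<Sum>\<alpha>\<in>multisets_of_size {..<n} m. c \<alpha> * mpow z \<alpha>) \<le> V"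
  using assms by (simp add: bounded_on_polydisc_def)

text \<open>Cut the sum into slices k = m - \<alpha>_l. By \<open>slice_bound\<close> each slice
  polynomial has sup norm at most 2(1 - a) with a the modulus of the coefficient of z_l^m, so
  interpolation yields (1 - a)^p times a power of the weight bound. At most three slices are of
  order m^(-1/2); the others are of order m^(-3/2), and there are at most m of them.\<close>

lemma off_diagonal_sum_le:
  obtains m1 :: nat where
    "\<And>m n c l. m \<ge> m1 \<Longrightarrow> l < n \<Longrightarrow> cmod (c (replicate_mset m l)) < 1 \<Longrightarrow>
      bounded_on_polydisc m n c 1 \<Longrightarrow>
      (\<Sum>\<alpha>\<in>multisets_of_size {..<n} m - replicate_mset m ` {..<n}.
         perms \<alpha> * (cmod (c \<alpha>) / perms \<alpha>) powr (2 * real m / (real m + 1)))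
      \<le> 1/4 * (1 - cmod (c (replicate_mset m l))) powr (2 * real m / (real m + 1))"
proof -
  obtain m2 where
    m2: "\<And>m n \<alpha>. m \<ge> m2 \<Longrightarrow> \<alpha> \<in> multisets_of_size {..<n} m \<Longrightarrow> (\<And>j. count \<alpha> j + 1 \<le> m) \<Longrightarrow>
       blei_weight n \<alpha> \<le> 10^6 / real m"
    "\<And>m n \<alpha>. m \<ge> m2 \<Longrightarrow> \<alpha> \<in> multisets_of_size {..<n} m \<Longrightarrow> (\<And>j. count \<alpha> j + 2 \<le> m) \<Longrightarrow>
       blei_weight n \<alpha> \<le> 10^6 / (real m)\<^sup>2"
    using blei_weight_eventually by metis
  \<comment> \<open>The total below is 144 10^6 m^(-1/2), and 576 is 4 times 144.\<close>
  obtain m3 :: nat where m3: "(576 * 10^6)\<^sup>2 \<le> real m3" using real_arch_simple by blast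
  define m1 where "m1 = max 3 (max m2 m3)"
  have "(\<Sum>\<alpha>\<in>multisets_of_size {..<n} m - replicate_mset m ` {..<n}.
         perms \<alpha> * (cmod (c \<alpha>) / perms \<alpha>) powr (2 * real m / (real m + 1)))
      \<le> 1/4 * (1 - cmod (c (replicate_mset m l))) powr (2 * real m / (real m + 1))"
    if m1: "m \<ge> m1" and l: "l < n" and lt: "cmod (c (replicate_mset m l)) < 1"
      and bdd: "bounded_on_polydisc m n c 1"
    for m n l and c :: "nat multiset \<Rightarrow> complex"
  proof -
    let ?M = "multisets_of_size {..<n} m" and ?D = "replicate_mset m ` {..<n}"
    define p where "p = 2 * real m / (real m + 1)"
    define r where "r = real m / (real m + 1)"
    define b where "b = 1 - cmod (c (replicate_mset m l))"
    note bound = bounded_on_polydiscD[OF bdd]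
    let ?f = "\<lambda>\<alpha>. perms \<alpha> * (cmod (c \<alpha>) / perms \<alpha>) powr p"
    have m: "m \<ge> 3" "m \<ge> m2" "m \<ge> m3" using m1 by (auto simp: m1_def)
    have b: "b > 0" using lt by (simp add: b_def)
    \<comment> \<open>With r \<ge> 3/4 the weight bounds 1/m and 1/m^2, raised to r, are at most
      m^(-1/2) and m^(-3/2).\<close>
    have r: "3/4 \<le> r" "r \<le> 1" using m(1) by (auto simp: r_def field_simps)
    have p: "p = 2 * r" by (simp add: p_def r_def)
    have finM: "finite ?M" by auto
    have cnt: "count \<alpha> j + 1 \<le> m" if "\<alpha> \<in> ?M - ?D" for \<alpha> j
    proof (rule ccontr)
      assume "\<not> count \<alpha> j + 1 \<le> m"
      moreover have size: "size \<alpha> = m" "set_mset \<alpha> \<subseteq> {..<n}" using that by (auto simp: multisets_of_size_def)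
      ultimately have c: "count \<alpha> j = size \<alpha>" using count_le_size[of \<alpha> j] by simp
      then have "\<alpha> = replicate_mset m j" using eq_replicate_mset size by metis
      moreover have "j < n"
      proof -
        have "count \<alpha> j > 0" using c size m(1) by simp
        then show ?thesis using size(2) by auto
      qed
      ultimately show False using that by blast
    qed
    \<comment> \<open>The bounds for an exceptional and an ordinary slice. The factor 36 is 6^2
      \<ge> 6^p, with 6 = 3 times 2 from interpolation and \<open>slice_bound\<close>.\<close>
    define x where "x = 36 * b powr p * (10^6 * real m powr (- 1/2))"
    define y where "y = 36 * b powr p * (10^6 * real m powr (- 3/2))"
    have xy: "x \<ge> 0" "y \<ge> 0" by (auto simp: x_def y_def)
    have slice: "(\<Sum>\<alpha>\<in>{\<alpha>\<in>?M - ?D. m - count \<alpha> l = k}. ?f \<alpha>) \<le> \<epsilon> powr r * (36 * b powr p)"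
      if k: "1 \<le> k" "k \<le> m" and \<epsilon>: "\<epsilon> > 0"
        "\<And>\<alpha>. \<alpha> \<in> ?M - ?D \<Longrightarrow> m - count \<alpha> l = k \<Longrightarrow> blei_weight n \<alpha> \<le> \<epsilon>" for k \<epsilon>
    proof -
      \<comment> \<open>Coefficients outside the slice are set to 0, so that the sup bound of the
        slice polynomial can be used in place of that of P.\<close>
      define c' where "c' = (\<lambda>\<alpha>. if count \<alpha> l = m - k then c \<alpha> else 0)"
      have eq: "count \<alpha> l = m - k" if "m - count \<alpha> l = k" "\<alpha> \<in> ?M" for \<alpha>
        using that k count_le_size[of \<alpha> l] by (auto simp: multisets_of_size_def)
      have "(\<Sum>\<alpha>\<in>{\<alpha>\<in>?M - ?D. m - count \<alpha> l = k}. ?f \<alpha>)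
          = (\<Sum>\<alpha>\<in>{\<alpha>\<in>?M - ?D. m - count \<alpha> l = k}. perms \<alpha> * (cmod (c' \<alpha>) / perms \<alpha>) powr (2 * real m / (real m + 1)))"
        using eq by (intro sum.cong) (auto simp: c'_def p_def)
      also have "\<dots> \<le> \<epsilon> powr (real m / (real m + 1)) * (3 * (2 * b)) powr (2 * real m / (real m + 1))"
      proof (rule coefficient_sum_le)
        fix z :: "nat \<Rightarrow> complex" assume z: "\<And>i. i < n \<Longrightarrow> cmod (z i) \<le> 1"
        have "(\<Sum>\<alpha>\<in>?M. c' \<alpha> * mpow z \<alpha>) = (\<Sum>\<alpha>\<in>{\<alpha>\<in>?M. count \<alpha> l = m - k}. c \<alpha> * mpow z \<alpha>)"
          using finM by (intro sum.mono_neutral_cong_right) (auto simp: c'_def)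
        then show "cmod (\<Sum>\<alpha>\<in>?M. c' \<alpha> * mpow z \<alpha>) \<le> 2 * b"
          using slice_bound[where c = c, OF _ l k bound z] m(1) by (simp add: b_def)
      qed (use m(1) b \<epsilon> in auto)
      also have "(3 * (2 * b)) powr (2 * real m / (real m + 1)) = 6 powr p * b powr p"
        using b by (simp add: p_def powr_mult)
      also have "\<epsilon> powr (real m / (real m + 1)) * (6 powr p * b powr p) \<le> \<epsilon> powr r * (36 * b powr p)"
      proof -
        have "6 powr p \<le> (6::real) powr 2" using r p by (intro powr_mono) auto
        also have "\<dots> = 36" by simp
        finally show ?thesis unfolding r_def by (intro mult_left_mono mult_right_mono) auto
      qed
      finally show ?thesis .
    qed
    have pw: "(10^6 / real m ^ i) powr r \<le> 10^6 * real m powr (- (real i * r))" for i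
    proof -
      have "(10^6 / real m ^ i) powr r = (10^6) powr r * real m powr (- (real i * r))"
        using m(1) by (simp add: powr_divide powr_powr powr_minus_divide flip: powr_realpow)
      also have "(10^6::real) powr r \<le> (10^6) powr 1" using r by (intro powr_mono) auto
      finally show ?thesis by (simp add: mult_right_mono)
    qed
    have e1: "(10^6 / real m) powr r \<le> 10^6 * real m powr (- 1/2)"
    proof -
      have "real m powr (- (real 1 * r)) \<le> real m powr (- 1/2)" using r m(1) by (intro powr_mono) auto
      then show ?thesis using pw[of 1] by simp
    qed
    have e2: "(10^6 / (real m)\<^sup>2) powr r \<le> 10^6 * real m powr (- 3/2)"
    proof -
      have "real m powr (- (real 2 * r)) \<le> real m powr (- 3/2)" using r m(1) by (intro powr_mono) auto
      then show ?thesis using pw[of 2] by simp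
    qed
    have slice_x: "(\<Sum>\<alpha>\<in>{\<alpha>\<in>?M - ?D. m - count \<alpha> l = k}. ?f \<alpha>) \<le> x" if k: "1 \<le> k" "k \<le> m" for k
    proof -
      have "(\<Sum>\<alpha>\<in>{\<alpha>\<in>?M - ?D. m - count \<alpha> l = k}. ?f \<alpha>) \<le> (10^6 / real m) powr r * (36 * b powr p)"
      proof (rule slice[OF k])
        fix \<alpha> assume a: "\<alpha> \<in> ?M - ?D"
        show "blei_weight n \<alpha> \<le> 10^6 / real m" using a cnt[OF a] by (intro m2(1)[OF m(2)]) auto
      qed (use m(1) in simp)
      also have "\<dots> \<le> (10^6 * real m powr (- 1/2)) * (36 * b powr p)"
        by (intro mult_right_mono e1) auto
      finally show ?thesis by (simp add: x_def mult.commute)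
    qed
    have slice_y: "(\<Sum>\<alpha>\<in>{\<alpha>\<in>?M - ?D. m - count \<alpha> l = k}. ?f \<alpha>) \<le> y"
      if k: "1 \<le> k" "k \<le> m" "k \<notin> {1, m - 1, m}" for k
    proof -
      have "(\<Sum>\<alpha>\<in>{\<alpha>\<in>?M - ?D. m - count \<alpha> l = k}. ?f \<alpha>) \<le> (10^6 / (real m)\<^sup>2) powr r * (36 * b powr p)"
      proof (rule slice[OF k(1,2)])
        fix \<alpha> assume a: "\<alpha> \<in> ?M - ?D" and al: "m - count \<alpha> l = k"
        \<comment> \<open>A variable of degree m - 1 forces k = 1 if it is z_l; otherwise z_l has
          degree 1 or 0, so k is m - 1 or m.\<close>
        have "count \<alpha> j + 2 \<le> m" for j
        proof (cases "j = l")
          case True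
          then show ?thesis using al k by auto
        next
          case False
          have "size \<alpha> = m" using a by (simp add: multisets_of_size_def)
          then show ?thesis using count_add_count_le_size[OF False, of \<alpha>] al k by auto
        qed
        then show "blei_weight n \<alpha> \<le> 10^6 / (real m)\<^sup>2" using a by (intro m2(2)[OF m(2)]) auto
      qed (use m(1) in simp)
      also have "\<dots> \<le> (10^6 * real m powr (- 3/2)) * (36 * b powr p)"
        by (intro mult_right_mono e2) auto
      finally show ?thesis by (simp add: y_def mult.commute)
    qed
    have "(\<Sum>\<alpha>\<in>?M - ?D. ?f \<alpha>) = (\<Sum>k\<in>{1..m}. \<Sum>\<alpha>\<in>{\<alpha>\<in>?M - ?D. m - count \<alpha> l = k}. ?f \<alpha>)"
    proof (rule sum.group[symmetric])
      show "(\<lambda>\<alpha>. m - count \<alpha> l) ` (?M - ?D) \<subseteq> {1..m}"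
      proof (intro image_subsetI)
        fix \<alpha> assume "\<alpha> \<in> ?M - ?D"
        then show "m - count \<alpha> l \<in> {1..m}" using cnt[of \<alpha> l] by simp
      qed
    qed (use finM in auto)
    also have "\<dots> \<le> (\<Sum>k\<in>{1..m}. y + (if k \<in> {1, m - 1, m} then x else 0))"
      using slice_x slice_y xy by (intro sum_mono) (auto simp: add_increasing)
    also have "\<dots> = real m * y + real (card ({1..m} \<inter> {1, m - 1, m})) * x"
      by (simp add: sum.distrib sum.If_cases del: insert_iff)
    also have "\<dots> \<le> real m * y + 3 * x"
    proof -
      have "card ({1..m} \<inter> {1, m - 1, m}) \<le> card {1, m - 1, m}" by (intro card_mono) auto
      also have "\<dots> \<le> 3" by (simp add: card_insert_if)
      finally have "real (card ({1..m} \<inter> {1, m - 1, m})) \<le> 3" by simp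
      then show ?thesis using xy by (intro add_left_mono mult_right_mono) auto
    qed
    also have "real m * y = x"
    proof -
      have "real m * real m powr (- 3/2) = real m powr 1 * real m powr (- 3/2)" using m(1) by simp
      also have "\<dots> = real m powr (1 + - 3/2)" by (rule powr_add[symmetric])
      also have "\<dots> = real m powr (- 1/2)" by simp
      finally have *: "real m * real m powr (- 3/2) = real m powr (- 1/2)" .
      have "real m * y = 36 * b powr p * (10^6 * (real m * real m powr (- 3/2)))" by (simp add: y_def)
      then show ?thesis unfolding * x_def .
    qed
    also have "x + 3 * x = 144 * 10^6 * real m powr (- 1/2) * b powr p" by (simp add: x_def)
    also have "\<dots> \<le> 1/4 * b powr p"
    proof (intro mult_right_mono)
      have "(576 * 10^6)\<^sup>2 \<le> real m" using m3 m(3) by linarith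
      then have "576 * 10^6 \<le> sqrt (real m)" by (rule real_le_rsqrt)
      moreover have "real m powr (- (1/2)) = 1 / sqrt (real m)"
        using m(1) by (simp add: powr_minus_divide powr_half_sqrt)
      ultimately have "144 * 10^6 * real m powr (- (1/2)) \<le> 1/4"
        using m(1) by (simp add: divide_le_eq)
      then show "144 * 10^6 * real m powr (- 1/2) \<le> 1/4" by simp
    qed auto
    finally show ?thesis by (simp add: p_def b_def)
  qed
  then show ?thesis using that by blast
qed

text \<open>The diagonal moduli a_j sum to less than 1, and p \<ge> 3/2 makes their p-th powers
  leave slack. If the largest, a, is at most 1/2, all terms gain a factor 3/4; otherwise all but the
  largest do. Either way the slack covers the off-diagonal share, at most (1 - a)^p/4.\<close>

lemma coefficient_sum_eventually_le_1:
  obtains m0 :: nat where "m0 \<ge> 1"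
    "\<And>m n c V. m \<ge> m0 \<Longrightarrow> V < 1 \<Longrightarrow>
      bounded_on_polydisc m n c V \<Longrightarrow>
      (\<Sum>\<alpha>\<in>multisets_of_size {..<n} m.
         perms \<alpha> * (cmod (c \<alpha>) / perms \<alpha>) powr (2 * real m / (real m + 1))) \<le> 1"
proof -
  obtain m1 :: nat where m1:
    "\<And>m n c l. m \<ge> m1 \<Longrightarrow> l < n \<Longrightarrow> cmod (c (replicate_mset m l)) < 1 \<Longrightarrow>
      bounded_on_polydisc m n c 1 \<Longrightarrow>
      (\<Sum>\<alpha>\<in>multisets_of_size {..<n} m - replicate_mset m ` {..<n}.
         perms \<alpha> * (cmod (c \<alpha>) / perms \<alpha>) powr (2 * real m / (real m + 1)))
      \<le> 1/4 * (1 - cmod (c (replicate_mset m l))) powr (2 * real m / (real m + 1))"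
    using off_diagonal_sum_le by blast
  have "(\<Sum>\<alpha>\<in>multisets_of_size {..<n} m.
         perms \<alpha> * (cmod (c \<alpha>) / perms \<alpha>) powr (2 * real m / (real m + 1))) \<le> 1"
    if mm: "m \<ge> max 3 m1" and V: "V < 1" and bdd: "bounded_on_polydisc m n c V"
    for m n V and c :: "nat multiset \<Rightarrow> complex"
  proof (cases "n = 0")
    case True
    then show ?thesis using mm by simp
  next
    case False
    let ?M = "multisets_of_size {..<n} m" and ?D = "replicate_mset m ` {..<n}"
    define p where "p = 2 * real m / (real m + 1)"
    define a where "a = (\<lambda>j. cmod (c (replicate_mset m j)))"
    let ?f = "\<lambda>\<alpha>. perms \<alpha> * (cmod (c \<alpha>) / perms \<alpha>) powr p"
    have m: "m \<ge> 3" "m \<ge> m1" using mm by auto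
    have p: "p \<ge> 3/2" using m(1) by (simp add: p_def field_simps)
    note bound = bounded_on_polydiscD[OF bdd]
    have suma: "(\<Sum>j<n. a j) < 1" using sum_diagonal_le[OF _ bound] m(1) V unfolding a_def by fastforce
    have a0: "a j \<ge> 0" for j by (simp add: a_def)
    have "Max (a ` {..<n}) \<in> a ` {..<n}" using False by (intro Max_in) auto
    then obtain l where l: "l < n" "a l = Max (a ` {..<n})" by auto
    have amax: "a j \<le> a l" if "j < n" for j unfolding l(2) using that by (intro Max_ge) auto
    have split: "(\<Sum>j<n. a j) = a l + (\<Sum>j\<in>{..<n} - {l}. a j)" using l(1) by (simp add: sum.remove)
    have rest: "(\<Sum>j\<in>{..<n} - {l}. a j) \<le> 1 - a l" using split suma by linarith
    have al: "0 \<le> a l" "a l < 1"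
    proof -
      have "(\<Sum>j\<in>{..<n} - {l}. a j) \<ge> 0" by (intro sum_nonneg a0)
      then show "a l < 1" using split suma by linarith
    qed (rule a0)
    have inj: "inj_on (replicate_mset m) {..<n}" using m(1) by (intro inj_on_replicate_mset) simp
    have D: "?D \<subseteq> ?M" by (auto simp: multisets_of_size_def split: if_splits)
    have "(\<Sum>\<alpha>\<in>?M. ?f \<alpha>) = (\<Sum>\<alpha>\<in>?M - ?D. ?f \<alpha>) + (\<Sum>\<alpha>\<in>?D. ?f \<alpha>)"
      by (rule sum.subset_diff[OF D]) auto
    also have "(\<Sum>\<alpha>\<in>?D. ?f \<alpha>) = (\<Sum>j<n. a j powr p)"
      by (simp add: sum.reindex[OF inj] a_def)
    also have "(\<Sum>\<alpha>\<in>?M - ?D. ?f \<alpha>) \<le> 1/4 * (1 - a l) powr p"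
      unfolding p_def a_def
    proof (rule m1[OF m(2) l(1)])
      show "bounded_on_polydisc m n c 1"
        using bdd V unfolding bounded_on_polydisc_def by fastforce
    qed (use al in \<open>simp add: a_def\<close>)
    finally have total: "(\<Sum>\<alpha>\<in>?M. ?f \<alpha>) \<le> 1/4 * (1 - a l) powr p + (\<Sum>j<n. a j powr p)" by simp
    have pm1: "t powr p \<le> s powr (p - 1) * t" if "0 \<le> t" "t \<le> s" for s t
    proof (cases "t = 0")
      case False
      then have "t powr p = t powr (p - 1) * t" using that by (simp add: powr_diff)
      also have "\<dots> \<le> s powr (p - 1) * t" using that p by (intro mult_right_mono powr_mono2) auto
      finally show ?thesis .
    qed simp
    have half: "s powr (p - 1) \<le> 3/4" if "0 \<le> s" "s \<le> 1/2" for s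
    proof -
      have "s powr (p - 1) \<le> (1/2) powr (p - 1)" using that p by (intro powr_mono2) auto
      also have "\<dots> \<le> (1/2) powr (1/2)" using p by (intro powr_mono') auto
      also have "\<dots> = sqrt (1/2)" by (simp add: powr_half_sqrt)
      also have "\<dots> \<le> 3/4" by (rule real_le_lsqrt) (auto simp: power2_eq_square)
      finally show ?thesis .
    qed
    have "1/4 * (1 - a l) powr p + (\<Sum>j<n. a j powr p) \<le> 1"
    proof (cases "a l \<le> 1/2")
      case True
      have "(\<Sum>j<n. a j powr p) \<le> (\<Sum>j<n. 3/4 * a j)"
      proof (intro sum_mono)
        fix j assume "j \<in> {..<n}"
        then have "a j powr p \<le> a l powr (p - 1) * a j" by (intro pm1 a0 amax) auto
        also have "\<dots> \<le> 3/4 * a j" using half[OF al(1) True] by (intro mult_right_mono a0)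
        finally show "a j powr p \<le> 3/4 * a j" .
      qed
      also have "\<dots> = 3/4 * (\<Sum>j<n. a j)" by (simp add: sum_distrib_left)
      finally have "(\<Sum>j<n. a j powr p) \<le> 3/4" using suma by linarith
      moreover have "(1 - a l) powr p \<le> 1" using al p by (intro powr_le1) auto
      ultimately show ?thesis by linarith
    next
      case False
      have "(\<Sum>j<n. a j powr p) = a l powr p + (\<Sum>j\<in>{..<n} - {l}. a j powr p)"
        using l(1) by (simp add: sum.remove)
      moreover have "a l powr p \<le> a l" using pm1[of "a l" 1] al by simp
      moreover have "(\<Sum>j\<in>{..<n} - {l}. a j powr p) \<le> 3/4 * (1 - a l)"
      proof -
        have "(\<Sum>j\<in>{..<n} - {l}. a j powr p) \<le> (\<Sum>j\<in>{..<n} - {l}. 3/4 * a j)"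
        proof (intro sum_mono)
          fix j assume j: "j \<in> {..<n} - {l}"
          have "a j \<le> (\<Sum>j\<in>{..<n} - {l}. a j)" using j by (intro member_le_sum a0) auto
          then have "a j powr p \<le> (1 - a l) powr (p - 1) * a j" using rest by (intro pm1 a0) auto
          also have "\<dots> \<le> 3/4 * a j" using half[of "1 - a l"] al False by (intro mult_right_mono a0) auto
          finally show "a j powr p \<le> 3/4 * a j" .
        qed
        also have "\<dots> = 3/4 * (\<Sum>j\<in>{..<n} - {l}. a j)" by (simp add: sum_distrib_left)
        also have "\<dots> \<le> 3/4 * (1 - a l)" using rest by (intro mult_left_mono) auto
        finally show ?thesis .
      qed
      moreover have "(1 - a l) powr p \<le> 1 - a l" using pm1[of "1 - a l" 1] al by simp
      \<comment> \<open>The three contributions t, 3/4 (1 - t) and 1/4 (1 - t) add up to exactly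
        1.\<close>
      moreover have "1/4 * P + S \<le> 1" if "S = A + B" "A \<le> t" "B \<le> 3/4 * (1 - t)" "P \<le> 1 - t"
        for P S A B t :: real
        using that by (simp add: field_simps)
      ultimately show ?thesis by blast
    qed
    with total show ?thesis by (simp add: p_def)
  qed
  note main = this
  show ?thesis
  proof (rule that)
    show "1 \<le> max 3 m1" by simp
  qed (rule main)
qed

subsection \<open>From forms to polynomials\<close>

lemma multilinear_slot_expansion:
  assumes T: "multilinear_form m n T" and x: "x \<in> {..<m} \<rightarrow>\<^sub>E carrier_vec n" and k: "k < m"
    and z: "z \<in> carrier_vec n"
  shows "T (x(k := z)) = (\<Sum>j<n. vec_index z j * T (x(k := unit_vec n j)))"
proof -
  \<comment> \<open>Truncations of z to its first r coordinates, increased one coordinate at a time.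
    For r = 0 the zero vector is written as 0 times z, so homogeneity gives the value 0.\<close>
  define w where "w = (\<lambda>r. Matrix.vec n (\<lambda>j. if j < r then vec_index z j else 0))"
  have add: "T (x(k := u + v)) = T (x(k := u)) + T (x(k := v))"
    if "u \<in> carrier_vec n" "v \<in> carrier_vec n" for u v
    using T x k that unfolding multilinear_form_def by blast
  have scale: "T (x(k := c \<cdot>\<^sub>v u)) = c * T (x(k := u))" if "u \<in> carrier_vec n" for c u
    using T x k that unfolding multilinear_form_def by blast
  have w: "w r \<in> carrier_vec n" for r by (simp add: w_def)
  have "T (x(k := w r)) = (\<Sum>j<r. vec_index z j * T (x(k := unit_vec n j)))" if "r \<le> n" for r
    using that
  proof (induction r)
    case 0
    have "w 0 = 0 \<cdot>\<^sub>v z" using z by (intro eq_vecI) (auto simp: w_def)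
    then have "T (x(k := w 0)) = 0 * T (x(k := z))" by (simp only: scale[OF z])
    then show ?case by (simp only: lessThan_0 sum.empty mult_zero_left)
  next
    case (Suc r)
    have "w (Suc r) = w r + vec_index z r \<cdot>\<^sub>v unit_vec n r"
      using Suc.prems by (intro eq_vecI) (auto simp: w_def unit_vec_def less_Suc_eq)
    then have "T (x(k := w (Suc r))) = T (x(k := w r)) + T (x(k := vec_index z r \<cdot>\<^sub>v unit_vec n r))"
      by (simp only: add[OF w] smult_carrier_vec unit_vec_carrier)
    also have "T (x(k := vec_index z r \<cdot>\<^sub>v unit_vec n r)) = vec_index z r * T (x(k := unit_vec n r))"
      by (rule scale) simp
    also have "T (x(k := w r)) = (\<Sum>j<r. vec_index z j * T (x(k := unit_vec n j)))"
      by (rule Suc.IH) (use Suc.prems in simp)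
    finally show ?case by (simp only: sum.lessThan_Suc)
  qed
  moreover have "w n = z" using z by (intro eq_vecI) (auto simp: w_def)
  ultimately show ?thesis by (metis order_refl)
qed

lemma sum_PiE_Suc:
  "(\<Sum>i\<in>{..<s} \<rightarrow>\<^sub>E B. \<Sum>j\<in>B. g (i(s := j))) = (\<Sum>i\<in>{..<Suc s} \<rightarrow>\<^sub>E B. g i)"
proof -
  have "(\<Sum>i\<in>{..<s} \<rightarrow>\<^sub>E B. \<Sum>j\<in>B. g (i(s := j))) = (\<Sum>p\<in>({..<s} \<rightarrow>\<^sub>E B) \<times> B. g ((fst p)(s := snd p)))"
    by (simp add: sum.cartesian_product case_prod_unfold)
  also have "\<dots> = (\<Sum>i\<in>{..<Suc s} \<rightarrow>\<^sub>E B. g i)"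
  proof (rule sum.reindex_bij_witness[where j = "\<lambda>p. (fst p)(s := snd p)" and i = "\<lambda>i. (restrict i {..<s}, i s)"])
    fix p assume p: "p \<in> ({..<s} \<rightarrow>\<^sub>E B) \<times> B"
    then have "restrict ((fst p)(s := snd p)) {..<s} = fst p"
      by (intro ext) (auto simp: restrict_def PiE_def extensional_def)
    then show "(restrict ((fst p)(s := snd p)) {..<s}, ((fst p)(s := snd p)) s) = p"
      by (simp add: prod_eq_iff)
    show "(fst p)(s := snd p) \<in> {..<Suc s} \<rightarrow>\<^sub>E B"
      using p by (auto simp: PiE_def Pi_def extensional_def less_Suc_eq)
  next
    fix i assume i: "i \<in> {..<Suc s} \<rightarrow>\<^sub>E B"
    then show "(fst (restrict i {..<s}, i s))(s := snd (restrict i {..<s}, i s)) = i"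
      by (intro ext) (auto simp: restrict_def PiE_def extensional_def less_Suc_eq)
    show "(restrict i {..<s}, i s) \<in> ({..<s} \<rightarrow>\<^sub>E B) \<times> B"
      using i by (auto simp: PiE_def Pi_def)
  qed simp
  finally show ?thesis .
qed

lemma multilinear_diagonal_expansion:
  assumes T: "multilinear_form m n T" and z: "z \<in> carrier_vec n"
  shows "T (\<lambda>k\<in>{..<m}. z)
    = (\<Sum>i\<in>{..<m} \<rightarrow>\<^sub>E {..<n}. (\<Prod>k<m. vec_index z (i k)) * T (\<lambda>k\<in>{..<m}. unit_vec n (i k)))"
proof -
  \<comment> \<open>The first s slots already hold basis vectors and the others still hold z; the
    induction expands one slot per step.\<close>
  define y where "y = (\<lambda>s (i :: nat \<Rightarrow> nat). \<lambda>k\<in>{..<m}. if k < s then unit_vec n (i k) else z)"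
  have "T (\<lambda>k\<in>{..<m}. z) = (\<Sum>i\<in>{..<s} \<rightarrow>\<^sub>E {..<n}. (\<Prod>k<s. vec_index z (i k)) * T (y s i))" if "s \<le> m" for s
    using that
  proof (induction s)
    case 0
    show ?case by (simp add: y_def)
  next
    case (Suc s)
    have step: "T (y s i) = (\<Sum>j<n. vec_index z j * T (y (Suc s) (i(s := j))))" for i
    proof -
      have "y s i \<in> {..<m} \<rightarrow>\<^sub>E carrier_vec n" using z by (auto simp: y_def)
      then have "T ((y s i)(s := z)) = (\<Sum>j<n. vec_index z j * T ((y s i)(s := unit_vec n j)))"
        using Suc.prems by (intro multilinear_slot_expansion[OF T _ _ z]) auto
      moreover have "(y s i)(s := z) = y s i" using Suc.prems by (auto simp: y_def)
      moreover have "(y s i)(s := unit_vec n j) = y (Suc s) (i(s := j))" for j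
        using Suc.prems by (auto simp: y_def less_Suc_eq)
      ultimately show ?thesis by simp
    qed
    have "T (\<lambda>k\<in>{..<m}. z) = (\<Sum>i\<in>{..<s} \<rightarrow>\<^sub>E {..<n}. (\<Prod>k<s. vec_index z (i k)) * T (y s i))"
      by (rule Suc.IH) (use Suc.prems in simp)
    also have "\<dots> = (\<Sum>i\<in>{..<s} \<rightarrow>\<^sub>E {..<n}. \<Sum>j<n.
        (\<Prod>k<Suc s. vec_index z ((i(s := j)) k)) * T (y (Suc s) (i(s := j))))"
      unfolding step sum_distrib_left by (intro sum.cong refl) simp
    also have "\<dots> = (\<Sum>i\<in>{..<Suc s} \<rightarrow>\<^sub>E {..<n}. (\<Prod>k<Suc s. vec_index z (i k)) * T (y (Suc s) i))"
      by (rule sum_PiE_Suc)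
    finally show ?case .
  qed
  from this[of m] show ?thesis by (simp add: y_def cong: restrict_cong)
qed

text \<open>Lists with equal multisets differ by a permutation of positions, so the value at basis
  vectors depends on the type alone.\<close>

lemma symmetric_form_type:
  assumes T: "symmetric_form m n T" and eq: "mset (map i [0..<m]) = mset (map i' [0..<m])"
  shows "T (\<lambda>k\<in>{..<m}. unit_vec n (i k)) = T (\<lambda>k\<in>{..<m}. unit_vec n (i' k))"
proof -
  obtain \<pi> where \<pi>: "\<pi> permutes {..<length (map i' [0..<m])}" "permute_list \<pi> (map i' [0..<m]) = map i [0..<m]"
    using mset_eq_permutation[OF eq] by blast
  then have pm: "\<pi> permutes {..<m}" by simp
  have i: "i k = i' (\<pi> k)" if "k < m" for k
  proof -
    have "map i [0..<m] ! k = map i' [0..<m] ! \<pi> k"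
      using \<pi> that by (metis diff_zero length_map length_upt permute_list_nth)
    moreover have "\<pi> k < m" using permutes_in_image[OF pm, of k] that by simp
    ultimately show ?thesis using that by simp
  qed
  have "(\<lambda>k\<in>{..<m}. unit_vec n (i' k)) \<circ> \<pi> = (\<lambda>k\<in>{..<m}. unit_vec n (i k))"
  proof
    fix k
    show "((\<lambda>k\<in>{..<m}. unit_vec n (i' k)) \<circ> \<pi>) k = (\<lambda>k\<in>{..<m}. unit_vec n (i k)) k"
      using permutes_in_image[OF pm, of k] permutes_not_in[OF pm, of k] i by (cases "k < m") auto
  qed
  moreover have "(\<lambda>k\<in>{..<m}. unit_vec n (i' k)) \<in> {..<m} \<rightarrow>\<^sub>E carrier_vec n" by auto
  ultimately show ?thesis using T pm unfolding symmetric_form_def by metis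
qed

text \<open>The transfer from polynomials to forms. The gap V < V' in \<open>est\<close> makes V'
  positive even if the sup norm is 0, so one may divide by it; at the end V' decreases to the sup
  norm.\<close>

lemma form_estimate:
  assumes m: "m \<ge> 1" and n: "n \<ge> 1" and T: "multilinear_form m n T" "symmetric_form m n T"
    and K: "K > 0" and est: "\<And>c V V'. 0 \<le> V \<Longrightarrow> V < V' \<Longrightarrow> bounded_on_polydisc m n c V \<Longrightarrow>
      (\<Sum>\<alpha>\<in>multisets_of_size {..<n} m. perms \<alpha> * (cmod (c \<alpha>) / perms \<alpha>) powr (2 * real m / (real m + 1)))
      \<le> (K * V') powr (2 * real m / (real m + 1))"
  shows "(\<Sum>i \<in> {..<m} \<rightarrow>\<^sub>E {..<n}.
           cmod (T (\<lambda>k\<in>{..<m}. unit_vec n (i k))) powr (2 * real m / (real m + 1)))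
          powr ((real m + 1) / (2 * real m)) \<le> K * diag_sup_norm m n T"
proof -
  let ?I = "{..<m} \<rightarrow>\<^sub>E {..<n}" and ?M = "multisets_of_size {..<n} m"
  let ?ty = "\<lambda>i. mset (map i [0..<m])"
  define t where "t = (\<lambda>i. T (\<lambda>k\<in>{..<m}. unit_vec n (i k)))"
  define p where "p = 2 * real m / (real m + 1)"
  \<comment> \<open>By symmetry all tuples of type \<alpha> give the same value, so any
    representative serves.\<close>
  define \<tau> where "\<tau> = (\<lambda>\<alpha>. t (SOME i. ?ty i = \<alpha>))"
  define c where "c = (\<lambda>\<alpha>. of_nat (card (permutations_of_multiset \<alpha>)) * \<tau> \<alpha>)"
  define W where "W = diag_sup_norm m n T"
  have p: "p > 0" "(real m + 1) / (2 * real m) = 1 / p" using m by (auto simp: p_def)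
  have t\<tau>: "t i = \<tau> (?ty i)" for i
  proof -
    have "?ty (SOME i'. ?ty i' = ?ty i) = ?ty i" by (rule someI[of _ i]) simp
    then show ?thesis unfolding \<tau>_def t_def by (intro symmetric_form_type[OF T(2)]) simp
  qed
  have cmodc: "cmod (c \<alpha>) / perms \<alpha> = cmod (\<tau> \<alpha>)" for \<alpha>
    using perms_pos[of \<alpha>] by (simp add: c_def perms_def norm_mult)
  have S: "(\<Sum>i\<in>?I. cmod (t i) powr p) = (\<Sum>\<alpha>\<in>?M. perms \<alpha> * (cmod (c \<alpha>) / perms \<alpha>) powr p)"
    unfolding t\<tau> cmodc unfolding perms_def by (rule sum_mset_types)
  have P: "(\<Sum>\<alpha>\<in>?M. c \<alpha> * mpow (vec_index z) \<alpha>) = T (\<lambda>k\<in>{..<m}. z)" if z: "z \<in> carrier_vec n" for z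
  proof -
    have "(\<Sum>\<alpha>\<in>?M. c \<alpha> * mpow (vec_index z) \<alpha>) = (\<Sum>i\<in>?I. \<tau> (?ty i) * mpow (vec_index z) (?ty i))"
      unfolding c_def mult.assoc by (rule sum_mset_types[symmetric])
    also have "\<dots> = (\<Sum>i\<in>?I. (\<Prod>k<m. vec_index z (i k)) * t i)"
      by (simp only: mpow_mset_map t\<tau> mult.commute)
    also have "\<dots> = T (\<lambda>k\<in>{..<m}. z)"
      unfolding t_def by (rule multilinear_diagonal_expansion[OF T(1) z, symmetric])
    finally show ?thesis .
  qed
  let ?Z = "{z \<in> carrier_vec n. linf_norm z \<le> 1}"
  \<comment> \<open>Here n \<ge> 1 ensures that \<open>Max\<close> in \<open>linf_norm\<close> is
    taken over a nonempty set.\<close>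
  have Z: "z \<in> ?Z \<longleftrightarrow> z \<in> carrier_vec n \<and> (\<forall>j<n. cmod (vec_index z j) \<le> 1)" for z
  proof (cases "z \<in> carrier_vec n")
    case True
    then have "(\<lambda>j. cmod (vec_index z j)) ` {..<dim_vec z} \<noteq> {}" "dim_vec z = n" using n by (auto simp: lessThan_empty_iff)
    then show ?thesis using True by (auto simp: linf_norm_def)
  qed simp
  have bdd: "bdd_above ((\<lambda>z. cmod (T (\<lambda>k\<in>{..<m}. z))) ` ?Z)"
  proof (rule bdd_aboveI2)
    fix z assume "z \<in> ?Z"
    then have z: "z \<in> carrier_vec n" "\<And>j. j < n \<Longrightarrow> cmod (vec_index z j) \<le> 1" using Z by auto
    have "cmod (T (\<lambda>k\<in>{..<m}. z)) \<le> (\<Sum>i\<in>?I. cmod ((\<Prod>k<m. vec_index z (i k)) * t i))"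
      unfolding multilinear_diagonal_expansion[OF T(1) z(1)] t_def by (rule norm_sum)
    also have "\<dots> \<le> (\<Sum>i\<in>?I. cmod (t i))"
    proof (intro sum_mono)
      fix i assume "i \<in> ?I"
      then have "(\<Prod>k<m. cmod (vec_index z (i k))) \<le> 1" by (intro prod_le_1) (auto intro!: z(2))
      then show "cmod ((\<Prod>k<m. vec_index z (i k)) * t i) \<le> cmod (t i)"
        by (simp add: norm_mult prod_norm[symmetric] mult_left_le_one_le prod_nonneg)
    qed
    finally show "cmod (T (\<lambda>k\<in>{..<m}. z)) \<le> (\<Sum>i\<in>?I. cmod (t i))" .
  qed
  have upper: "cmod (T (\<lambda>k\<in>{..<m}. z)) \<le> W" if "z \<in> ?Z" for z
    unfolding W_def diag_sup_norm_def by (rule cSUP_upper[OF that bdd])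
  have W0: "W \<ge> 0"
  proof -
    have "0\<^sub>v n \<in> ?Z" unfolding Z by simp
    from upper[OF this] show ?thesis using norm_ge_zero order.trans by blast
  qed
  have cW: "bounded_on_polydisc m n c W"
    unfolding bounded_on_polydisc_def
  proof (intro allI impI)
    fix z :: "nat \<Rightarrow> complex" assume z: "\<forall>i<n. cmod (z i) \<le> 1"
    have "Matrix.vec n z \<in> ?Z" unfolding Z using z by simp
    moreover have "(\<Sum>\<alpha>\<in>?M. c \<alpha> * mpow z \<alpha>) = (\<Sum>\<alpha>\<in>?M. c \<alpha> * mpow (\<lambda>j. vec_index (Matrix.vec n z) j) \<alpha>)"
    proof (intro sum.cong refl arg_cong2[where f = "(*)"] mpow_cong)
      fix \<alpha> i assume "\<alpha> \<in> ?M" "i \<in># \<alpha>"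
      then have "i < n" by (auto simp: multisets_of_size_def)
      then show "z i = vec_index (Matrix.vec n z) i" by simp
    qed
    ultimately show "cmod (\<Sum>\<alpha>\<in>?M. c \<alpha> * mpow z \<alpha>) \<le> W" using upper P[of "Matrix.vec n z"] by simp
  qed
  have main: "(\<Sum>i\<in>?I. cmod (t i) powr p) powr (1 / p) \<le> K * V'" if "V' > W" for V'
  proof -
    have "(\<Sum>i\<in>?I. cmod (t i) powr p) \<le> (K * V') powr p"
      unfolding S using est[OF W0 that cW] by (simp add: p_def)
    then have "(\<Sum>i\<in>?I. cmod (t i) powr p) powr (1 / p) \<le> ((K * V') powr p) powr (1 / p)"
      using p by (intro powr_mono2 sum_nonneg) auto
    also have "\<dots> = K * V'" using p K W0 that by (simp add: powr_powr)
    finally show ?thesis .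
  qed
  have "(\<Sum>i\<in>?I. cmod (t i) powr p) powr (1 / p) / K \<le> W"
  proof (rule dense_ge)
    fix V' assume "W < V'"
    from main[OF this] show "(\<Sum>i\<in>?I. cmod (t i) powr p) powr (1 / p) / K \<le> V'"
      using K by (simp only: pos_divide_le_eq mult.commute)
  qed
  then have "(\<Sum>i\<in>?I. cmod (t i) powr p) powr (1 / p) \<le> K * W"
    using K by (simp only: pos_divide_le_eq mult.commute)
  then show ?thesis unfolding p(2) unfolding p_def t_def W_def .
qed

section \<open>Large and small degrees combined\<close>

theorem corollary1p3:
  shows "(\<exists>C::real. C > 0 \<and>
           (\<forall>m n :: nat. \<forall>T. m \<ge> 1 \<longrightarrow> n \<ge> 1 \<longrightarrow> multilinear_form m n T \<longrightarrow> symmetric_form m n T \<longrightarrow>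
              (\<Sum>i \<in> {..<m} \<rightarrow>\<^sub>E {..<n}.
                 cmod (T (\<lambda>k\<in>{..<m}. unit_vec n (i k))) powr (2 * real m / (real m + 1)))
                powr ((real m + 1) / (2 * real m))
              \<le> (1 + C / real m) * diag_sup_norm m n T))
       \<and> (\<exists>m0::nat. m0 \<ge> 1 \<and>
           (\<forall>m n :: nat. \<forall>T. m \<ge> m0 \<longrightarrow> n \<ge> 1 \<longrightarrow> multilinear_form m n T \<longrightarrow> symmetric_form m n T \<longrightarrow>
              (\<Sum>i \<in> {..<m} \<rightarrow>\<^sub>E {..<n}.
                 cmod (T (\<lambda>k\<in>{..<m}. unit_vec n (i k))) powr (2 * real m / (real m + 1)))
                powr ((real m + 1) / (2 * real m))
              \<le> diag_sup_norm m n T))"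
proof -
  obtain m0 :: nat where m0: "m0 \<ge> 1" and ev:
    "\<And>m n c V. m \<ge> m0 \<Longrightarrow> V < 1 \<Longrightarrow> bounded_on_polydisc m n c V \<Longrightarrow>
      (\<Sum>\<alpha>\<in>multisets_of_size {..<n} m.
         perms \<alpha> * (cmod (c \<alpha>) / perms \<alpha>) powr (2 * real m / (real m + 1))) \<le> 1"
    using coefficient_sum_eventually_le_1 by blast
  let ?L = "\<lambda>m n T. (\<Sum>i \<in> {..<m} \<rightarrow>\<^sub>E {..<n}.
      cmod (T (\<lambda>k\<in>{..<m}. unit_vec n (i k))) powr (2 * real m / (real m + 1))) powr ((real m + 1) / (2 * real m))"
  have large: "?L m n T \<le> 1 * diag_sup_norm m n T"
    if "m \<ge> m0" "n \<ge> 1" "multilinear_form m n T" "symmetric_form m n T" for m n T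
  proof (rule form_estimate)
    fix c and V V' :: real
    assume V: "0 \<le> V" "V < V'" and bd: "bounded_on_polydisc m n c V"
    let ?p = "2 * real m / (real m + 1)" and ?M = "multisets_of_size {..<n} m"
    \<comment> \<open>Dividing by V' lowers the bound to V/V' < 1, as \<open>ev\<close>
      requires.\<close>
    have "bounded_on_polydisc m n (\<lambda>\<alpha>. c \<alpha> / of_real V') (V / V')"
      using bd V unfolding bounded_on_polydisc_def
      by (simp add: norm_divide divide_right_mono flip: sum_divide_distrib)
    then have "(\<Sum>\<alpha>\<in>?M. perms \<alpha> * (cmod (c \<alpha> / of_real V') / perms \<alpha>) powr ?p) \<le> 1"
      using V by (intro ev[OF that(1)]) auto
    also have "(\<Sum>\<alpha>\<in>?M. perms \<alpha> * (cmod (c \<alpha> / of_real V') / perms \<alpha>) powr ?p)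
        = (\<Sum>\<alpha>\<in>?M. perms \<alpha> * (cmod (c \<alpha>) / perms \<alpha>) powr ?p) / V' powr ?p"
      unfolding sum_divide_distrib
    proof (intro sum.cong refl)
      fix \<alpha>
      have "cmod (c \<alpha> / of_real V') / perms \<alpha> = (cmod (c \<alpha>) / perms \<alpha>) / V'"
        using V by (simp add: norm_divide)
      moreover have "((cmod (c \<alpha>) / perms \<alpha>) / V') powr ?p = (cmod (c \<alpha>) / perms \<alpha>) powr ?p / V' powr ?p"
        by (rule powr_divide)
      ultimately show "perms \<alpha> * (cmod (c \<alpha> / of_real V') / perms \<alpha>) powr ?p
          = perms \<alpha> * (cmod (c \<alpha>) / perms \<alpha>) powr ?p / V' powr ?p"
        by (simp only: times_divide_eq_right)
    qed
    finally show "(\<Sum>\<alpha>\<in>?M. perms \<alpha> * (cmod (c \<alpha>) / perms \<alpha>) powr ?p) \<le> (1 * V') powr ?p"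
      using V by (simp add: divide_le_eq)
  qed (use that m0 in auto)
  \<comment> \<open>Interpolation with the crude weight \<epsilon> gives \<epsilon>^r (3 V')^(2r),
    the power 2r of 3 sqrt(\<epsilon>) V'.\<close>
  define K where "K = (\<lambda>m::nat. 3 * sqrt (5 * (5 ^ m * real m)))"
  have crude: "?L m n T \<le> K m * diag_sup_norm m n T"
    if "m \<ge> 1" "n \<ge> 1" "multilinear_form m n T" "symmetric_form m n T" for m n T
  proof (rule form_estimate)
    show "K m > 0" using that by (simp add: K_def)
    fix c and V V' :: real
    assume V: "0 \<le> V" "V < V'" and bd: "bounded_on_polydisc m n c V"
    let ?e = "5 * (5 ^ m * real m)"
    have "(\<Sum>\<alpha>\<in>multisets_of_size {..<n} m. perms \<alpha> * (cmod (c \<alpha>) / perms \<alpha>) powr (2 * real m / (real m + 1)))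
        \<le> ?e powr (real m / (real m + 1)) * (3 * V') powr (2 * real m / (real m + 1))"
    proof (rule coefficient_sum_le[OF that(1)])
      fix z :: "nat \<Rightarrow> complex" assume "\<And>i. i < n \<Longrightarrow> cmod (z i) \<le> 1"
      then have "cmod (\<Sum>\<alpha>\<in>multisets_of_size {..<n} m. c \<alpha> * mpow z \<alpha>) \<le> V"
        by (rule bounded_on_polydiscD[OF bd])
      then show "cmod (\<Sum>\<alpha>\<in>multisets_of_size {..<n} m. c \<alpha> * mpow z \<alpha>) \<le> V'" using V by linarith
    qed (use V that blei_weight_crude in auto)
    also have "?e powr (real m / (real m + 1)) = sqrt ?e powr (2 * real m / (real m + 1))"
      by (simp add: powr_half_sqrt[symmetric] powr_powr)
    also have "sqrt ?e powr (2 * real m / (real m + 1)) * (3 * V') powr (2 * real m / (real m + 1))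
        = (sqrt ?e * (3 * V')) powr (2 * real m / (real m + 1))"
      using V by (subst powr_mult) auto
    also have "sqrt ?e * (3 * V') = K m * V'" by (simp add: K_def)
    finally show "(\<Sum>\<alpha>\<in>multisets_of_size {..<n} m. perms \<alpha> * (cmod (c \<alpha>) / perms \<alpha>) powr (2 * real m / (real m + 1)))
        \<le> (K m * V') powr (2 * real m / (real m + 1))" .
  qed (use that in auto)
  \<comment> \<open>The crude inequality itself shows this: its left-hand side is nonnegative and
    K(m) > 0.\<close>
  have D0: "diag_sup_norm m n T \<ge> 0"
    if "m \<ge> 1" "n \<ge> 1" "multilinear_form m n T" "symmetric_form m n T" for m n T
  proof -
    have "0 \<le> K m * diag_sup_norm m n T" using crude[OF that] powr_ge_zero order.trans by blast
    moreover have "K m > 0" using that by (simp add: K_def)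
    ultimately show ?thesis by (simp add: zero_le_mult_iff)
  qed
  \<comment> \<open>K increases with m, so for m < m0 the crude factor K(m) is at most K(m0) \<le>
    C/m.\<close>
  define C where "C = real m0 * K m0"
  have C: "C > 0" using m0 by (simp add: C_def K_def)
  have "?L m n T \<le> (1 + C / real m) * diag_sup_norm m n T"
    if T: "m \<ge> 1" "n \<ge> 1" "multilinear_form m n T" "symmetric_form m n T" for m n T
  proof (cases "m \<ge> m0")
    case True
    have "?L m n T \<le> 1 * diag_sup_norm m n T" by (rule large[OF True T(2-)])
    also have "\<dots> \<le> (1 + C / real m) * diag_sup_norm m n T"
      using C D0[OF T] by (intro mult_right_mono) auto
    finally show ?thesis .
  next
    case False
    have "K m \<le> K m0"
      unfolding K_def using False by (intro mult_left_mono real_sqrt_le_mono mult_mono power_increasing) auto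
    also have "\<dots> \<le> C / real m"
    proof -
      have "real m * K m0 \<le> C" unfolding C_def using False by (intro mult_right_mono) (auto simp: K_def)
      then show ?thesis using T(1) by (simp add: le_divide_eq mult.commute)
    qed
    finally have "K m \<le> 1 + C / real m" by simp
    then have "K m * diag_sup_norm m n T \<le> (1 + C / real m) * diag_sup_norm m n T"
      using D0[OF T] by (rule mult_right_mono)
    with crude[OF T] show ?thesis by linarith
  qed
  with C m0 large show ?thesis by auto
qed

end
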